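(* Identify colorings $x : T \to \{0,1\}$ with points of the Cantor space $\{0,1\}^{\mathbb{N}}$ via a fixed computable enumeration of $T$. Then the set $\mathcal{W} \subseteq \{0,1\}^T$ of colorings that are winning for black is $\Delta^0_5$ in the lightface (effective) Borel hierarchy, and hence $\mathbf{\Delta}^0_5$ in the boldface Borel hierarchy.
   Context: Fix a regular hexagonal tiling of $\mathbb{R}^2$ in which some tile edges are horizontal, and let $T$ be its set of tiles. Two tiles are adjacent if they share an edge. A coloring is a map $x : T \to \{0,1\}$; tiles with $x(t)=1$ are black, the others vacant. A path is a sequence of tiles $(t_i)_{i\in I}$, $I\subseteq\mathbb{Z}$ an interval, with consecutive tiles adjacent; it is black if all its tiles are black. Fix a sequence of tiles $(d_n)_{n\in\mathbb{Z}}$ with each $d_n$ the northeast neighbour of $d_{n-1}$. The northeast quarter-plane $Q^+_n$ is the set of tiles obtained from $d_n$ by translations by vectors in $[0,\infty)^2$, and the southwest quarter-plane $Q^-_n$ the set of tiles obtained from $d_n$ by translations by vectors in $(-\infty,0]^2$. For $*\in\{+,-\}$, a one-way infinite path $(t_i)_{i\in\mathbb{N}}$ reaches to $*$ if for every $n$ there is $i$ with $t_j\in Q^*_n$ for all $j\ge i$. A coloring is winning for black if there are black paths $(t_i)_{i\in\mathbb{N}}$ and $(s_i)_{i\in\mathbb{N}}$ with $t_0=s_0$ such that $(t_i)$ reaches to $+$ and $(s_i)$ reaches to $-$. $\Delta^0_5=\Sigma^0_5\cap\Pi^0_5$ in the effective Borel hierarchy, where $\Sigma^0_1$ sets are effectively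 open sets and $\Sigma^0_{k+1}$ sets are computable unions of $\Pi^0_k$ sets, $\Pi^0_k$ being complements of $\Sigma^0_k$ sets; the boldface classes are defined analogously with arbitrary countable unions. *)

theory Defs
  imports "HOL-Analysis.Analysis" "HOL-Library.Nat_Bijection"
begin

section \<open>The hexagonal tiling\<close>

type_synonym point = "real \<times> real"
type_synonym tile = "point set"

(* The vertices lie at angles k * 60 degrees, so two of the six edges are horizontal. *)
definition hex_vertex :: "real \<Rightarrow> point \<Rightarrow> nat \<Rightarrow> point" where
  "hex_vertex a c k = c + a *\<^sub>R (cos (real k * pi / 3), sin (real k * pi / 3))"

definition hexagon :: "real \<Rightarrow> point \<Rightarrow> tile" where
  "hexagon a c = convex hull (hex_vertex a c ` {..<6})"

(* The centres form the lattice through p spanned by the displacements to the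
   northeast and to the north neighbour of a tile with side length a. *)
definition hex_centre :: "real \<Rightarrow> point \<Rightarrow> int \<Rightarrow> int \<Rightarrow> point" where
  "hex_centre a p i j =
     p + of_int i *\<^sub>R (3 / 2 * a, sqrt 3 / 2 * a) + of_int j *\<^sub>R (0, sqrt 3 * a)"

(* Up to the choice of a > 0 and p this is the only regular hexagonal tiling
   with horizontal edges. *)
definition hex_tiling :: "real \<Rightarrow> point \<Rightarrow> tile set" where
  "hex_tiling a p = {hexagon a (hex_centre a p i j) | i j. True}"

definition adjacent :: "tile \<Rightarrow> tile \<Rightarrow> bool" where
  "adjacent t t' \<longleftrightarrow> t \<noteq> t' \<and> (\<exists>e. e edge_of t \<and> e edge_of t')"

definition northeast_neighbour :: "tile \<Rightarrow> tile \<Rightarrow> bool" where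
  "northeast_neighbour t t' \<longleftrightarrow>
     adjacent t t' \<and> (\<exists>v. fst v > 0 \<and> snd v > 0 \<and> t' = (\<lambda>z. v + z) ` t)"

definition diagonal :: "tile set \<Rightarrow> (int \<Rightarrow> tile) \<Rightarrow> bool" where
  "diagonal T d \<longleftrightarrow> (\<forall>n. d n \<in> T) \<and> (\<forall>n. northeast_neighbour (d (n - 1)) (d n))"


section \<open>Winning colorings\<close>

definition Q_plus :: "tile set \<Rightarrow> (int \<Rightarrow> tile) \<Rightarrow> int \<Rightarrow> tile set" where
  "Q_plus T d n = {t \<in> T. \<exists>v \<in> {0..} \<times> {0..}. t = (\<lambda>z. v + z) ` d n}"

definition Q_minus :: "tile set \<Rightarrow> (int \<Rightarrow> tile) \<Rightarrow> int \<Rightarrow> tile set" where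
  "Q_minus T d n = {t \<in> T. \<exists>v \<in> {..0} \<times> {..0}. t = (\<lambda>z. v + z) ` d n}"

definition inf_path :: "tile set \<Rightarrow> (nat \<Rightarrow> tile) \<Rightarrow> bool" where
  "inf_path T t \<longleftrightarrow> (\<forall>i. t i \<in> T) \<and> (\<forall>i. adjacent (t i) (t (Suc i)))"

definition black_path :: "tile set \<Rightarrow> (tile \<Rightarrow> bool) \<Rightarrow> (nat \<Rightarrow> tile) \<Rightarrow> bool" where
  "black_path T x t \<longleftrightarrow> inf_path T t \<and> (\<forall>i. x (t i))"

definition reaches :: "(int \<Rightarrow> tile set) \<Rightarrow> (nat \<Rightarrow> tile) \<Rightarrow> bool" where
  "reaches Q t \<longleftrightarrow> (\<forall>n. \<exists>i. \<forall>j\<ge>i. t j \<in> Q n)"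

definition winning_for_black :: "tile set \<Rightarrow> (int \<Rightarrow> tile) \<Rightarrow> (tile \<Rightarrow> bool) \<Rightarrow> bool" where
  "winning_for_black T d x \<longleftrightarrow>
     (\<exists>t s. black_path T x t \<and> black_path T x s \<and> t 0 = s 0 \<and>
            reaches (Q_plus T d) t \<and> reaches (Q_minus T d) s)"

definition winning_set :: "tile set \<Rightarrow> (int \<Rightarrow> tile) \<Rightarrow> (tile \<Rightarrow> bool) set" where
  "winning_set T d = {x \<in> T \<rightarrow>\<^sub>E UNIV. winning_for_black T d x}"


section \<open>Computability\<close>

(* The total recursive functions of n arguments, generated by composition,
   primitive recursion and minimization of regular functions. A function of n
   arguments is applied to lists of length n; its values on other lists are
   irrelevant. *)
inductive recursive_fn :: "nat \<Rightarrow> (nat list \<Rightarrow> nat) \<Rightarrow> bool" where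
  zero: "recursive_fn n (\<lambda>xs. 0)"
| succ: "recursive_fn 1 (\<lambda>xs. Suc (xs ! 0))"
| proj: "i < n \<Longrightarrow> recursive_fn n (\<lambda>xs. xs ! i)"
| comp: "recursive_fn (length fs) g \<Longrightarrow> \<forall>f \<in> set fs. recursive_fn n f \<Longrightarrow>
    recursive_fn n (\<lambda>xs. g (map (\<lambda>f. f xs) fs))"
| prec: "recursive_fn n f \<Longrightarrow> recursive_fn (Suc (Suc n)) g \<Longrightarrow>
    recursive_fn (Suc n) (\<lambda>xs. rec_nat (f (tl xs)) (\<lambda>k r. g (k # r # tl xs)) (hd xs))"
| minim: "recursive_fn (Suc n) f \<Longrightarrow> \<forall>xs. length xs = n \<longrightarrow> (\<exists>y. f (y # xs) = 0) \<Longrightarrow>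
    recursive_fn n (\<lambda>xs. LEAST y. f (y # xs) = 0)"

definition computable :: "(nat \<Rightarrow> nat) \<Rightarrow> bool" where
  "computable f \<longleftrightarrow> (\<exists>g. recursive_fn 1 g \<and> (\<forall>n. f n = g [n]))"

definition comp_enumerable :: "nat set \<Rightarrow> bool" where
  "comp_enumerable S \<longleftrightarrow> (\<exists>g. recursive_fn 2 g \<and> S = {n. \<exists>k. g [n, k] = 0})"

(* The enumeration is a bijection, so that it identifies colorings with points of
   Cantor space; it is computable with respect to the lattice coordinates of tiles. *)
definition computable_enumeration :: "real \<Rightarrow> point \<Rightarrow> (nat \<Rightarrow> tile) \<Rightarrow> bool" where
  "computable_enumeration a p e \<longleftrightarrow> bij_betw e UNIV (hex_tiling a p) \<and>
     (\<exists>i j. computable (\<lambda>n. int_encode (i n)) \<and> computable (\<lambda>n. int_encode (j n)) \<and>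
            (\<forall>n. e n = hexagon a (hex_centre a p (i n) (j n))))"


section \<open>The effective Borel hierarchy on Cantor space\<close>

type_synonym cantor = "nat \<Rightarrow> bool"

definition cylinder :: "bool list \<Rightarrow> cantor set" where
  "cylinder w = {x. \<forall>i < length w. x i = w ! i}"

definition word_code :: "bool list \<Rightarrow> nat" where
  "word_code w = list_encode (map of_bool w)"

definition unif_effectively_open :: "(nat \<Rightarrow> cantor set) \<Rightarrow> bool" where
  "unif_effectively_open A \<longleftrightarrow> (\<exists>S. comp_enumerable S \<and>
     (\<forall>m. A m = \<Union> {cylinder w | w. prod_encode (m, word_code w) \<in> S}))"

(* A union of Pi-k sets is computable if its members form a uniformly Pi-k sequence.
   The hierarchy is therefore generated simultaneously for all sequences of sets;
   its levels start at 1 (no sequence has level 0). *)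
inductive unif_Sigma :: "nat \<Rightarrow> (nat \<Rightarrow> cantor set) \<Rightarrow> bool"
  and unif_Pi :: "nat \<Rightarrow> (nat \<Rightarrow> cantor set) \<Rightarrow> bool" where
  eff_open: "unif_effectively_open A \<Longrightarrow> unif_Sigma 1 A"
| eff_union: "unif_Pi k B \<Longrightarrow> unif_Sigma (Suc k) (\<lambda>m. \<Union>n. B (prod_encode (m, n)))"
| eff_compl: "unif_Sigma k A \<Longrightarrow> unif_Pi k (\<lambda>m. - A m)"

definition lightface_Sigma :: "nat \<Rightarrow> cantor set \<Rightarrow> bool" where
  "lightface_Sigma k A \<longleftrightarrow> unif_Sigma k (\<lambda>m. A)"

definition lightface_Pi :: "nat \<Rightarrow> cantor set \<Rightarrow> bool" where
  "lightface_Pi k A \<longleftrightarrow> lightface_Sigma k (- A)"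

definition lightface_Delta :: "nat \<Rightarrow> cantor set \<Rightarrow> bool" where
  "lightface_Delta k A \<longleftrightarrow> lightface_Sigma k A \<and> lightface_Pi k A"


section \<open>The Borel hierarchy\<close>

(* On the type cantor, open refers to the product of the discrete topologies. *)
inductive boldface_Sigma :: "nat \<Rightarrow> 'a::topological_space set \<Rightarrow> bool"
  and boldface_Pi :: "nat \<Rightarrow> 'a set \<Rightarrow> bool" where
  bf_open: "open A \<Longrightarrow> boldface_Sigma 1 A"
| bf_union: "(\<And>n::nat. boldface_Pi k (B n)) \<Longrightarrow> boldface_Sigma (Suc k) (\<Union>n. B n)"
| bf_compl: "boldface_Sigma k A \<Longrightarrow> boldface_Pi k (- A)"

definition boldface_Delta :: "nat \<Rightarrow> 'a::topological_space set \<Rightarrow> bool" where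
  "boldface_Delta k A \<longleftrightarrow> boldface_Sigma k A \<and> boldface_Pi k A"

end

theory Submission
  imports Defs
begin

text \<open>
  Whether a black cluster contains a path reaching to + is a priori a \<open>\<Sigma>\<^sup>1\<^sub>1\<close> question; planarity makes it
  arithmetical. Let \<open>S\<^sub>k\<close> be the set of black tiles in the quarter-plane \<open>Q\<^sub>k\<close>. The interface between \<open>S\<^sub>k\<close>
  and its complement through a given tile edge is computable from the coloring, so for each of its two
  ends it is a \<open>\<Pi>\<^sup>0\<^sub>3\<close> question whether it reaches to + and a \<open>\<Sigma>\<^sup>0\<^sub>3\<close> question whether it returns
  infinitely often to a bounded horizontal distance, or to a bounded height. If a cluster contains a path
  \<open>R\<close> reaching to +, then for every \<open>k\<close> the outer boundary of the component of \<open>S\<^sub>k\<close> around the tail of \<open>R\<close>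
  has two infinite ends, one on each side of \<open>R\<close>. Either some such end reaches to +, or for every \<open>k\<close>
  the left end is recurrent in the first sense and the right end in the second one (the component
  straddles \<open>Q\<^sub>k\<close>). Conversely, if no interface end is recurrent in both senses, then two straddling
  components of \<open>S\<^sub>k\<close> contained in one cluster coincide, so straddling components at all levels are
  nested and yield a path reaching to +.

  This gives \<open>\<Sigma>\<^sup>0\<^sub>5\<close>. For \<open>\<Pi>\<^sup>0\<^sub>5\<close>, observe that as soon as one path reaches to +, all straddling
  components meet a fixed finite set; hence the quantifier over the clusters may be moved inside the
  quantifier over the levels, by the pigeonhole principle.

  All planarity arguments are parity counts: \<open>side\<close> counts the crossings of a walk below a tile.
\<close>

section \<open>Recursive functions\<close>

text \<open>The constant 5 is a count of quantifiers. Recurrence of an interface end costs three, so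
  \<open>straddling\<close> is Sigma-3 and \<open>tame\<close> is Pi-3, while
  \<open>by_interface\<close> and \<open>anchored\<close> are Sigma-4. Straddling at all levels is
  Pi-4, and choosing the cluster in front of it gives Sigma-5; with all levels in front of a Sigma-4
  approximation to the choice of a cluster one gets Pi-5. The conditions \<open>tame\<close> and
  \<open>anchored\<close> cannot be assumed, but each follows as soon as one path reaches to +, so
  they enter as conjuncts. For \<open>tame\<close> the reason is that the cells on the outer side of
  an interface avoid the path; an end recurrent in both senses would be above and below it
  infinitely often. The inner side would not do, since it may share cells with the path. The two
  directions cannot be treated independently, because both paths must lie in one cluster. The point
  reflection \<open>z\<close> to \<open>- z\<close> turns the southwest into the northeast, and the
  pigeonhole argument is carried out for a cell and its mirror image simultaneously.\<close>

definition recn :: "nat \<Rightarrow> (nat list \<Rightarrow> nat) \<Rightarrow> bool" where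
  "recn k f \<longleftrightarrow> (\<exists>g. recursive_fn k g \<and> (\<forall>xs. length xs = k \<longrightarrow> f xs = g xs))"

lemma recnI: "recursive_fn k f \<Longrightarrow> recn k f"
  unfolding recn_def by blast

text \<open>The generating clauses of \<open>recursive_fn\<close> yield one literal function each,
  with irrelevant values on lists of other lengths; agreement on lists of length \<open>k\<close> is
  the usable notion.\<close>

lemma recn_cong: "recn k g \<Longrightarrow> (\<And>xs. length xs = k \<Longrightarrow> f xs = g xs) \<Longrightarrow> recn k f"
  unfolding recn_def by auto

lemma recn_proj: "i < k \<Longrightarrow> recn k (\<lambda>xs. xs ! i)"
  by (intro recnI recursive_fn.proj)

lemma recn_zero: "recn k (\<lambda>xs. 0)"
  by (intro recnI recursive_fn.zero)

lemma recn_comp: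
  assumes "recn (length fs) g" "\<forall>f \<in> set fs. recn k f"
  shows "recn k (\<lambda>xs. g (map (\<lambda>f. f xs) fs))"
proof -
  obtain g' where g': "recursive_fn (length fs) g'" "\<And>xs. length xs = length fs \<Longrightarrow> g xs = g' xs"
    using assms(1) unfolding recn_def by blast
  obtain h where h: "\<And>f. f \<in> set fs \<Longrightarrow> recursive_fn k (h f) \<and> (\<forall>xs. length xs = k \<longrightarrow> f xs = h f xs)"
    using assms(2) unfolding recn_def by metis
  have "recursive_fn k (\<lambda>xs. g' (map (\<lambda>f. f xs) (map h fs)))"
    using g' h by (intro recursive_fn.comp) auto
  moreover have "g (map (\<lambda>f. f xs) fs) = g' (map (\<lambda>f. f xs) (map h fs))" if "length xs = k" for xs
  proof -
    have "map (\<lambda>f. f xs) fs = map (\<lambda>f. f xs) (map h fs)" using h that by simp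
    then show ?thesis using g'(2) by (metis length_map)
  qed
  ultimately show ?thesis unfolding recn_def by blast
qed

lemma recn_comp1: "recn 1 (\<lambda>xs. g (xs ! 0)) \<Longrightarrow> recn k f \<Longrightarrow> recn k (\<lambda>xs. g (f xs))"
  using recn_comp[of "[f]" "\<lambda>xs. g (xs ! 0)" k] by simp

lemma recn_comp2:
  "recn 2 (\<lambda>xs. g (xs ! 0) (xs ! 1)) \<Longrightarrow> recn k f1 \<Longrightarrow> recn k f2 \<Longrightarrow> recn k (\<lambda>xs. g (f1 xs) (f2 xs))"
  using recn_comp[of "[f1, f2]" "\<lambda>xs. g (xs ! 0) (xs ! 1)" k] by (simp add: numeral_2_eq_2)

lemma recn_comp3:
  "recn 3 (\<lambda>xs. g (xs ! 0) (xs ! 1) (xs ! 2)) \<Longrightarrow> recn k f1 \<Longrightarrow> recn k f2 \<Longrightarrow> recn k f3 \<Longrightarrow>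
   recn k (\<lambda>xs. g (f1 xs) (f2 xs) (f3 xs))"
  using recn_comp[of "[f1, f2, f3]" "\<lambda>xs. g (xs ! 0) (xs ! 1) (xs ! 2)" k]
  by (simp add: numeral_3_eq_3 numeral_2_eq_2)

lemma recn_Suc: "recn k f \<Longrightarrow> recn k (\<lambda>xs. Suc (f xs))"
  by (rule recn_comp1[where g=Suc]) (rule recnI, rule recursive_fn.succ)

lemma recn_const: "recn k (\<lambda>xs. c)"
  by (induction c) (auto intro: recn_zero recn_Suc)

lemma recn_prec:
  assumes "recn k f" "recn (Suc (Suc k)) g"
  shows "recn (Suc k) (\<lambda>xs. rec_nat (f (tl xs)) (\<lambda>i r. g (i # r # tl xs)) (hd xs))"
proof -
  obtain f' where f': "recursive_fn k f'" "\<And>xs. length xs = k \<Longrightarrow> f xs = f' xs"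
    using assms(1) unfolding recn_def by blast
  obtain g' where g': "recursive_fn (Suc (Suc k)) g'" "\<And>xs. length xs = Suc (Suc k) \<Longrightarrow> g xs = g' xs"
    using assms(2) unfolding recn_def by blast
  show ?thesis
    by (rule recn_cong[OF recnI[OF recursive_fn.prec[OF f'(1) g'(1)]]]) (simp add: f' g')
qed

lemma recn_minim:
  assumes "recn (Suc k) f" "\<And>xs. length xs = k \<Longrightarrow> \<exists>y. f (y # xs) = 0"
  shows "recn k (\<lambda>xs. LEAST y. f (y # xs) = 0)"
proof -
  obtain f' where f': "recursive_fn (Suc k) f'" "\<And>xs. length xs = Suc k \<Longrightarrow> f xs = f' xs"
    using assms(1) unfolding recn_def by blast
  have "recursive_fn k (\<lambda>xs. LEAST y. f' (y # xs) = 0)"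
    using assms(2) f' by (intro recursive_fn.minim) auto
  then show ?thesis
    by (rule recn_cong[OF recnI]) (simp add: f')
qed

lemma length_eq_2_conv: "length xs = 2 \<longleftrightarrow> (\<exists>a b. xs = [a, b])"
  by (auto simp: numeral_2_eq_2 length_Suc_conv)

lemma recn_add: "recn k f \<Longrightarrow> recn k g \<Longrightarrow> recn k (\<lambda>xs. f xs + g xs)"
proof (rule recn_comp2[where g="(+)"])
  have "recn (Suc 1) (\<lambda>xs. rec_nat (tl xs ! 0) (\<lambda>i r. Suc ((i # r # tl xs) ! 1)) (hd xs))"
    by (intro recn_prec[where g="\<lambda>xs. Suc (xs ! 1)"] recn_proj recn_Suc) auto
  moreover have "rec_nat a (\<lambda>i r. Suc r) b = b + a" for a b :: nat by (induction b) auto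
  ultimately show "recn 2 (\<lambda>xs. xs ! 0 + xs ! 1)"
    by - (rule recn_cong[where k=2], simp add: numeral_2_eq_2, auto simp: length_eq_2_conv)
qed

lemma recn_pred: "recn k f \<Longrightarrow> recn k (\<lambda>xs. f xs - 1)"
proof (rule recn_comp1[where g="\<lambda>a. a - 1"])
  have "recn (Suc 0) (\<lambda>xs. rec_nat 0 (\<lambda>i r. (i # r # tl xs) ! 0) (hd xs))"
    by (intro recn_prec[where f="\<lambda>_. 0" and g="\<lambda>xs. xs ! 0"] recn_proj recn_zero) auto
  moreover have "rec_nat 0 (\<lambda>i r. i) b = b - 1" for b :: nat by (cases b) auto
  ultimately show "recn 1 (\<lambda>xs. xs ! 0 - 1)"
    by - (rule recn_cong[where k=1], simp, auto simp: length_Suc_conv)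
qed

lemma recn_diff: "recn k f \<Longrightarrow> recn k g \<Longrightarrow> recn k (\<lambda>xs. f xs - g xs)"
\<comment> \<open>Primitive recursion runs on the head of the list, so the subtrahend has to be the
  first argument.\<close>
proof (rule recn_comp2[where g="\<lambda>b a. a - b", rotated])
  have "recn (Suc 1) (\<lambda>xs. rec_nat (tl xs ! 0) (\<lambda>i r. (i # r # tl xs) ! 1 - 1) (hd xs))"
    by (intro recn_prec[where g="\<lambda>xs. xs ! 1 - 1"] recn_proj recn_pred) auto
  moreover have "rec_nat a (\<lambda>i r. r - 1) b = a - b" for a b :: nat by (induction b) auto
  ultimately show "recn 2 (\<lambda>xs. xs ! 1 - xs ! 0)"
    by - (rule recn_cong[where k=2], simp add: numeral_2_eq_2, auto simp: length_eq_2_conv)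
qed

lemma recn_if:
  "recn k f \<Longrightarrow> recn k g \<Longrightarrow> recn k h \<Longrightarrow> recn k (\<lambda>xs. if f xs = 0 then g xs else h xs)"
proof (rule recn_comp3[where g="\<lambda>a b c. if a = 0 then b else c"])
  have "recn (Suc 2) (\<lambda>xs. rec_nat (tl xs ! 0) (\<lambda>i r. (i # r # tl xs) ! 3) (hd xs))"
    by (intro recn_prec[where g="\<lambda>xs. xs ! 3"] recn_proj) auto
  moreover have "rec_nat a (\<lambda>i r. b) n = (if n = 0 then a else b)" for a b :: nat and n
    by (cases n) auto
  ultimately show "recn 3 (\<lambda>xs. if xs ! 0 = 0 then xs ! 1 else xs ! 2)"
    by - (rule recn_cong[where k=3], simp add: numeral_3_eq_3 numeral_2_eq_2,
      auto simp: numeral_3_eq_3 numeral_2_eq_2 length_Suc_conv)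
qed

section \<open>Cantor pairing and its inverses\<close>

lemma recn_triangle: "recn k f \<Longrightarrow> recn k (\<lambda>xs. triangle (f xs))"
proof (rule recn_comp1[where g=triangle])
  have "recn (Suc 0) (\<lambda>xs. rec_nat 0 (\<lambda>i r. (i # r # tl xs) ! 1 + Suc ((i # r # tl xs) ! 0)) (hd xs))"
    by (intro recn_prec[where f="\<lambda>_. 0" and g="\<lambda>xs. xs ! 1 + Suc (xs ! 0)"]
        recn_proj recn_zero recn_add recn_Suc) auto
  moreover have "rec_nat 0 (\<lambda>i r. r + Suc i) b = triangle b" for b :: nat by (induction b) auto
  ultimately show "recn 1 (\<lambda>xs. triangle (xs ! 0))"
    by - (rule recn_cong[where k=1], simp, auto simp: length_Suc_conv)
qed

lemma recn_pair: "recn k f \<Longrightarrow> recn k g \<Longrightarrow> recn k (\<lambda>xs. prod_encode (f xs, g xs))"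
  unfolding prod_encode_def by (simp, intro recn_add recn_triangle)

definition pfst :: "nat \<Rightarrow> nat" where "pfst n = fst (prod_decode n)"
definition psnd :: "nat \<Rightarrow> nat" where "psnd n = snd (prod_decode n)"

lemma pfst_pair [simp]: "pfst (prod_encode (a, b)) = a" by (simp add: pfst_def)
lemma psnd_pair [simp]: "psnd (prod_encode (a, b)) = b" by (simp add: psnd_def)
lemma pair_collapse [simp]: "prod_encode (pfst n, psnd n) = n"
  by (simp add: pfst_def psnd_def)

lemma triangle_mono: "a \<le> b \<Longrightarrow> triangle a \<le> triangle b"
  by (induction rule: dec_induct) auto

text \<open>The pair is coded as \<open>triangle (a + b) + a\<close>, which lies below the next
  triangular number; the first triangular number above the code therefore reveals the sum.\<close>

lemma Least_triangle:
  "(LEAST k. Suc (prod_encode (a, b)) - triangle (Suc k) = 0) = a + b"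
proof (rule Least_equality)
  show "Suc (prod_encode (a, b)) - triangle (Suc (a + b)) = 0"
    by (simp add: prod_encode_def)
  fix k assume *: "Suc (prod_encode (a, b)) - triangle (Suc k) = 0"
  show "a + b \<le> k"
  proof (rule ccontr)
    assume "\<not> a + b \<le> k"
    then have "triangle (Suc k) \<le> triangle (a + b)" by (intro triangle_mono) auto
    then show False using * by (simp add: prod_encode_def)
  qed
qed

lemma recn_unpair:
  assumes "recn k f"
  shows recn_pfst: "recn k (\<lambda>xs. pfst (f xs))" and recn_psnd: "recn k (\<lambda>xs. psnd (f xs))"
proof -
  define t where "t n = (LEAST k. Suc n - triangle (Suc k) = 0)" for n
  have t: "t (prod_encode (a, b)) = a + b" for a b unfolding t_def by (rule Least_triangle)
  have "n \<le> triangle n" for n by (induction n) auto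
  then have ex: "\<exists>y. Suc n - triangle (Suc y) = 0" for n
    by (metis diff_is_0_eq)
  have "recn 1 (\<lambda>xs. LEAST y. Suc ((y # xs) ! 1) - triangle (Suc ((y # xs) ! 0)) = 0)"
    using ex by (intro recn_minim[where f="\<lambda>xs. Suc (xs ! 1) - triangle (Suc (xs ! 0))"]
        recn_diff recn_Suc recn_triangle recn_proj) auto
  then have "recn 1 (\<lambda>xs. t (xs ! 0))" by (simp add: t_def)
  then have rt: "recn k g \<Longrightarrow> recn k (\<lambda>xs. t (g xs))" for k g by (rule recn_comp1)
  have f: "pfst n = n - triangle (t n)" and s: "psnd n = t n - pfst n" for n
  proof -
    obtain a b where n: "n = prod_encode (a, b)" by (metis pair_collapse)
    show "pfst n = n - triangle (t n)" "psnd n = t n - pfst n"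
      unfolding n t pfst_pair psnd_pair by (simp_all add: prod_encode_def)
  qed
  show f': "recn k (\<lambda>xs. pfst (f xs))"
    unfolding f by (intro recn_diff recn_triangle rt assms)
  show "recn k (\<lambda>xs. psnd (f xs))"
    unfolding s by (intro recn_diff f' rt assms)
qed

section \<open>Unary computable functions with packed arguments\<close>

lemma computable_iff_recn: "computable f \<longleftrightarrow> recn 1 (\<lambda>xs. f (xs ! 0))"
proof
  assume "computable f"
  then show "recn 1 (\<lambda>xs. f (xs ! 0))"
    unfolding computable_def recn_def by (auto simp: length_Suc_conv)
next
  assume "recn 1 (\<lambda>xs. f (xs ! 0))"
  then obtain g where "recursive_fn 1 g" "\<forall>xs. length xs = 1 \<longrightarrow> f (xs ! 0) = g xs"
    unfolding recn_def by blast
  then show "computable f" unfolding computable_def by (intro exI[of _ g]) (auto dest: spec[of _ "[_]"])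
qed

lemma recn_computable: "computable g \<Longrightarrow> recn k f \<Longrightarrow> recn k (\<lambda>xs. g (f xs))"
  unfolding computable_iff_recn by (rule recn_comp1)

named_theorems comp_intros

lemma computable_id [comp_intros]: "computable (\<lambda>n. n)"
  unfolding computable_iff_recn by (rule recn_proj) simp

lemma computable_const [comp_intros]: "computable (\<lambda>n. c)"
  unfolding computable_iff_recn by (rule recn_const)

lemma computable_comp: "computable g \<Longrightarrow> computable f \<Longrightarrow> computable (\<lambda>n. g (f n))"
  unfolding computable_iff_recn[of f] computable_iff_recn[of "\<lambda>n. g (f n)"] by (rule recn_computable)

lemma computable_Suc [comp_intros]: "computable f \<Longrightarrow> computable (\<lambda>n. Suc (f n))"
  unfolding computable_iff_recn by (rule recn_Suc)

lemma computable_add [comp_intros]: "computable f \<Longrightarrow> computable g \<Longrightarrow> computable (\<lambda>n. f n + g n)"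
  unfolding computable_iff_recn by (rule recn_add)

lemma computable_diff [comp_intros]: "computable f \<Longrightarrow> computable g \<Longrightarrow> computable (\<lambda>n. f n - g n)"
  unfolding computable_iff_recn by (rule recn_diff)

lemma computable_pair [comp_intros]:
  "computable f \<Longrightarrow> computable g \<Longrightarrow> computable (\<lambda>n. prod_encode (f n, g n))"
  unfolding computable_iff_recn by (rule recn_pair)

lemma computable_pfst [comp_intros]: "computable f \<Longrightarrow> computable (\<lambda>n. pfst (f n))"
  unfolding computable_iff_recn by (rule recn_pfst)

lemma computable_psnd [comp_intros]: "computable f \<Longrightarrow> computable (\<lambda>n. psnd (f n))"
  unfolding computable_iff_recn by (rule recn_psnd)

lemma computable_if0:
  "computable f \<Longrightarrow> computable g \<Longrightarrow> computable h \<Longrightarrow> computable (\<lambda>n. if f n = 0 then g n else h n)"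
  unfolding computable_iff_recn by (rule recn_if)

text \<open>The step function is unary too, so it receives parameter, counter and previous value as
  the single code \<open>((n, k), r)\<close>.\<close>

lemma computable_rec:
  assumes "computable a" "computable b" "computable c"
  shows "computable (\<lambda>n. rec_nat (a n) (\<lambda>k r. b (prod_encode (prod_encode (n, k), r))) (c n))"
proof -
  let ?g = "\<lambda>xs. b (prod_encode (prod_encode (xs ! 2, xs ! 0), xs ! 1))"
  have "recn (Suc (Suc 1)) ?g"
    by (intro recn_computable[OF assms(2)] recn_pair recn_proj) auto
  moreover have "recn 1 (\<lambda>xs. a (xs ! 0))" by (intro recn_computable[OF assms(1)] recn_proj) auto
  ultimately have "recn (Suc 1) (\<lambda>xs. rec_nat (a (tl xs ! 0)) (\<lambda>i r. ?g (i # r # tl xs)) (hd xs))"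
    by (intro recn_prec)
  then have "recn 2 (\<lambda>xs. rec_nat (a (xs ! 1))
      (\<lambda>i r. b (prod_encode (prod_encode (xs ! 1, i), r))) (xs ! 0))"
    by - (rule recn_cong[where k=2], simp add: numeral_2_eq_2, auto simp: length_eq_2_conv)
  from recn_comp2[OF this, where k=1 and ?f1.0="\<lambda>xs. c (xs ! 0)" and ?f2.0="\<lambda>xs. xs ! 0"] assms(3)
  show ?thesis by (simp add: computable_iff_recn recn_proj)
qed

lemma computable_Least:
  assumes "computable f" "\<And>n. \<exists>y. f (prod_encode (n, y)) = 0"
  shows "computable (\<lambda>n. LEAST y. f (prod_encode (n, y)) = 0)"
proof -
  have "recn 1 (\<lambda>xs. LEAST y. f (prod_encode ((y # xs) ! 1, (y # xs) ! 0)) = 0)"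
    using assms(2) by (intro recn_minim[where f="\<lambda>xs. f (prod_encode (xs ! 1, xs ! 0))"]
        recn_computable[OF assms(1)] recn_pair recn_proj) auto
  then show ?thesis by (simp add: computable_iff_recn)
qed

definition decidable :: "(nat \<Rightarrow> bool) \<Rightarrow> bool" where
  "decidable P \<longleftrightarrow> computable (\<lambda>n. of_bool (P n))"

lemma computable_cong: "computable f \<Longrightarrow> (\<And>n. f n = g n) \<Longrightarrow> computable g"
  by (simp add: computable_def)

lemma decidable_cong: "decidable P \<Longrightarrow> (\<And>n. P n = Q n) \<Longrightarrow> decidable Q"
  by (simp add: decidable_def)

lemma computable_if [comp_intros]:
  "decidable P \<Longrightarrow> computable g \<Longrightarrow> computable h \<Longrightarrow> computable (\<lambda>n. if P n then g n else h n)"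
  unfolding decidable_def by (rule computable_cong[OF computable_if0[of "\<lambda>n. of_bool (P n)" h g]]) auto

lemma decidable_less [comp_intros]:
  assumes "computable f" "computable g" shows "decidable (\<lambda>n. f n < g n)"
proof -
  have "computable (\<lambda>n. if g n - f n = 0 then 0 else Suc 0)"
    by (intro computable_if0 comp_intros assms)
  moreover have "(\<lambda>n. if g n - f n = 0 then 0 else Suc 0) = (\<lambda>n. of_bool (f n < g n))" by auto
  ultimately show ?thesis by (simp add: decidable_def)
qed

lemma decidable_not [comp_intros]: "decidable P \<Longrightarrow> decidable (\<lambda>n. \<not> P n)"
  unfolding decidable_def
  by (rule computable_cong[OF computable_diff[OF computable_const[of 1]]]) auto

lemma decidable_conj [comp_intros]:
  assumes "decidable P" "decidable Q" shows "decidable (\<lambda>n. P n \<and> Q n)"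
proof -
  have "computable (\<lambda>n. if P n then of_bool (Q n) else 0)"
    using assms by (intro comp_intros) (auto simp: decidable_def)
  then show ?thesis unfolding decidable_def by (rule computable_cong) auto
qed

lemma decidable_disj [comp_intros]: "decidable P \<Longrightarrow> decidable Q \<Longrightarrow> decidable (\<lambda>n. P n \<or> Q n)"
  using decidable_not[OF decidable_conj[OF decidable_not decidable_not], of P Q] by simp

lemma decidable_eq [comp_intros]:
  assumes "computable f" "computable g" shows "decidable (\<lambda>n. f n = g n)"
proof -
  have "decidable (\<lambda>n. \<not> f n < g n \<and> \<not> g n < f n)" by (intro comp_intros assms)
  moreover have "(\<lambda>n. \<not> f n < g n \<and> \<not> g n < f n) = (\<lambda>n. f n = g n)" by auto
  ultimately show ?thesis by simp
qed

lemma decidable_le [comp_intros]: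
  "computable f \<Longrightarrow> computable g \<Longrightarrow> decidable (\<lambda>n. f n \<le> g n)"
  using decidable_not[OF decidable_less, of g f] by (simp add: linorder_not_less)

lemma decidable_finite [comp_intros]:
  "finite A \<Longrightarrow> computable f \<Longrightarrow> decidable (\<lambda>n. f n \<in> A)"
proof (induction A rule: finite_induct)
  case empty
  have "decidable (\<lambda>n. Suc 0 = 0)" by (intro comp_intros)
  then show ?case by simp
next
  case (insert a A)
  then have "decidable (\<lambda>n. f n = a \<or> f n \<in> A)" by (intro comp_intros)
  then show ?case by simp
qed

lemma computable_half [comp_intros]: "computable f \<Longrightarrow> computable (\<lambda>n. f n div 2)"
proof (rule computable_comp[where g="\<lambda>n. n div 2"])
  \<comment> \<open>Truncated subtraction turns \<open>n \<le> 2 * y + 1\<close> into an equation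
    with 0.\<close>
  have *: "(LEAST y. n - Suc (y + y) = 0) = n div 2" for n :: nat
    by (rule Least_equality) auto
  have "computable (\<lambda>n. LEAST y. pfst (prod_encode (n, y))
      - Suc (psnd (prod_encode (n, y)) + psnd (prod_encode (n, y))) = 0)"
    by (intro computable_Least[where f="\<lambda>p. pfst p - Suc (psnd p + psnd p)"] comp_intros)
      (simp, metis * LeastI diff_is_0_eq le_add1 le_SucI)
  then show "computable (\<lambda>n. n div 2)" by (simp only: pfst_pair psnd_pair *)
qed

section \<open>Integer-valued computable functions\<close>

definition icomputable :: "(nat \<Rightarrow> int) \<Rightarrow> bool" where
  "icomputable f \<longleftrightarrow> computable (\<lambda>n. int_encode (f n))"

lemma int_encode_diff:
  "int_encode (int a - int b) = (if b \<le> a then (a - b) + (a - b) else Suc ((b - a - 1) + (b - a - 1)))"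
  by (auto simp: int_encode_def sum_encode_def nat_diff_distrib)

text \<open>Integer arithmetic is reduced to natural numbers: values are taken apart into
  \<open>nat i\<close> and \<open>nat (- i)\<close> and put together again as a difference.\<close>

lemma icomputable_int_diff:
  assumes "computable a" "computable b"
  shows "icomputable (\<lambda>n. int (a n) - int (b n))"
  unfolding icomputable_def int_encode_diff by (intro comp_intros assms)

lemma nat_int_encode:
  "nat i = (if int_encode i = int_encode i div 2 + int_encode i div 2 then int_encode i div 2 else 0)"
  "nat (- i) = (if int_encode i = int_encode i div 2 + int_encode i div 2 then 0 else Suc (int_encode i div 2))"
  by (auto simp: int_encode_def sum_encode_def)

lemma computable_nat [comp_intros]:
  assumes "icomputable f"
  shows "computable (\<lambda>n. nat (f n))" "computable (\<lambda>n. nat (- f n))"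
  using assms unfolding icomputable_def nat_int_encode(1)[of "f _"] nat_int_encode(2)[of "f _"]
  by (intro comp_intros; assumption)+

lemma computable_int_encode [comp_intros]:
  "icomputable f \<Longrightarrow> computable (\<lambda>n. int_encode (f n))"
  by (simp add: icomputable_def)

lemma icomputable_decode [comp_intros]: "computable f \<Longrightarrow> icomputable (\<lambda>n. int_decode (f n))"
  by (simp add: icomputable_def)

lemma icomputable_const [comp_intros]: "icomputable (\<lambda>n. c)"
  by (simp add: icomputable_def computable_const)

lemma icomputable_of_nat [comp_intros]: "computable f \<Longrightarrow> icomputable (\<lambda>n. int (f n))"
  using icomputable_int_diff[OF _ computable_const[of 0]] by simp

lemma icomputable_minus [comp_intros]: "icomputable f \<Longrightarrow> icomputable (\<lambda>n. - f n)"
proof -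
  assume f: "icomputable f"
  have "icomputable (\<lambda>n. int (nat (- f n)) - int (nat (f n)))"
    by (intro icomputable_int_diff comp_intros f)
  moreover have "(\<lambda>n. int (nat (- f n)) - int (nat (f n))) = (\<lambda>n. - f n)" by auto
  ultimately show ?thesis by simp
qed

lemma icomputable_add [comp_intros]:
  assumes "icomputable f" "icomputable g" shows "icomputable (\<lambda>n. f n + g n)"
proof -
  have "icomputable (\<lambda>n. int (nat (f n) + nat (g n)) - int (nat (- f n) + nat (- g n)))"
    by (intro icomputable_int_diff comp_intros assms)
  moreover have "(\<lambda>n. int (nat (f n) + nat (g n)) - int (nat (- f n) + nat (- g n))) = (\<lambda>n. f n + g n)"
    by auto
  ultimately show ?thesis by simp
qed

lemma icomputable_diff [comp_intros]:
  "icomputable f \<Longrightarrow> icomputable g \<Longrightarrow> icomputable (\<lambda>n. f n - g n)"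
  using icomputable_add[OF _ icomputable_minus, of f g] by simp

lemma decidable_int_le [comp_intros]:
  assumes "icomputable f" "icomputable g" shows "decidable (\<lambda>n. f n \<le> g n)"
proof -
  have "decidable (\<lambda>n. nat (f n) + nat (- g n) \<le> nat (g n) + nat (- f n))"
    by (intro comp_intros assms)
  then show ?thesis by (rule decidable_cong) arith
qed

lemma decidable_int_eq [comp_intros]:
  assumes "icomputable f" "icomputable g" shows "decidable (\<lambda>n. f n = g n)"
proof -
  have "decidable (\<lambda>n. f n \<le> g n \<and> g n \<le> f n)" by (intro comp_intros assms)
  then show ?thesis by (rule decidable_cong) arith
qed

section \<open>Computable functionals on Cantor space\<close>

definition prefix_code :: "cantor \<Rightarrow> nat \<Rightarrow> nat" where
  "prefix_code x M = word_code (map x [0..<M])"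

text \<open>The approximation \<open>g\<close> returns 0 until the prefix is long enough, and then \<open>Suc\<close> of the value.\<close>

definition approximates :: "(nat \<Rightarrow> nat) \<Rightarrow> (cantor \<Rightarrow> nat \<Rightarrow> nat) \<Rightarrow> bool" where
  "approximates g F \<longleftrightarrow> (\<forall>x n.
     (\<forall>M. g (prod_encode (n, prefix_code x M)) \<in> {0, Suc (F x n)}) \<and>
     (\<exists>N. \<forall>M\<ge>N. g (prod_encode (n, prefix_code x M)) = Suc (F x n)))"

text \<open>These are the functions computable from the oracle \<open>x\<close> and total for every
  oracle: each value is settled by a finite prefix.\<close>

definition functional :: "(cantor \<Rightarrow> nat \<Rightarrow> nat) \<Rightarrow> bool" where
  "functional F \<longleftrightarrow> (\<exists>g. computable g \<and> approximates g F)"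

lemma approximates_cases:
  "approximates g F \<Longrightarrow>
    g (prod_encode (n, prefix_code x M)) = 0 \<or> g (prod_encode (n, prefix_code x M)) = Suc (F x n)"
  unfolding approximates_def by (metis empty_iff insert_iff)

lemma approximates_eventually:
  "approximates g F \<Longrightarrow> \<exists>N. \<forall>M\<ge>N. g (prod_encode (n, prefix_code x M)) = Suc (F x n)"
  unfolding approximates_def by blast

lemma approximatesI:
  assumes "\<And>x n M. g (prod_encode (n, prefix_code x M)) \<in> {0, Suc (F x n)}"
    and "\<And>x n. \<exists>N. \<forall>M\<ge>N. g (prod_encode (n, prefix_code x M)) = Suc (F x n)"
  shows "approximates g F"
  unfolding approximates_def using assms by blast

lemma functional_computable: "computable f \<Longrightarrow> functional (\<lambda>x n. f n)"
  unfolding functional_def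
  by (intro exI[of _ "\<lambda>p. Suc (f (pfst p))"] conjI computable_Suc computable_comp[OF _ computable_pfst]
      computable_id approximatesI) auto

lemma functional_compose:
  assumes "functional F" "functional G"
  shows "functional (\<lambda>x n. F x (G x n))"
proof -
  obtain f where "computable f" "approximates f F"
    using assms(1) unfolding functional_def by blast
  note f = this(1) approximates_cases[OF this(2)] approximates_eventually[OF this(2)]
  obtain g where "computable g" "approximates g G"
    using assms(2) unfolding functional_def by blast
  note g = this(1) approximates_cases[OF this(2)] approximates_eventually[OF this(2)]
  let ?h = "\<lambda>p. if g p = 0 then 0 else f (prod_encode (g p - 1, psnd p))"
  have "computable ?h" by (intro comp_intros g(1) computable_comp[OF f(1)])
  moreover have "?h (prod_encode (n, prefix_code x M)) \<in> {0, Suc (F x (G x n))}" for x n M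
    using f(2)[of "G x n" x M] g(2)[of n x M] by auto
  moreover have "\<exists>N. \<forall>M\<ge>N. ?h (prod_encode (n, prefix_code x M)) = Suc (F x (G x n))" for x n
  proof -
    obtain N where N: "\<forall>M\<ge>N. f (prod_encode (G x n, prefix_code x M)) = Suc (F x (G x n))"
      using f(3) by blast
    obtain N' where N': "\<forall>M\<ge>N'. g (prod_encode (n, prefix_code x M)) = Suc (G x n)"
      using g(3) by blast
    show ?thesis by (rule exI[of _ "max N N'"]) (use N N' in auto)
  qed
  ultimately show ?thesis unfolding functional_def approximates_def by blast
qed

lemma functional_pair:
  assumes "functional F" "functional G"
  shows "functional (\<lambda>x n. prod_encode (F x n, G x n))"
proof -
  obtain f where "computable f" "approximates f F"
    using assms(1) unfolding functional_def by blast
  note f = this(1) approximates_cases[OF this(2)] approximates_eventually[OF this(2)]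
  obtain g where "computable g" "approximates g G"
    using assms(2) unfolding functional_def by blast
  note g = this(1) approximates_cases[OF this(2)] approximates_eventually[OF this(2)]
  let ?h = "\<lambda>p. if f p = 0 \<or> g p = 0 then 0 else Suc (prod_encode (f p - 1, g p - 1))"
  have "computable ?h" by (intro comp_intros g(1) f(1))
  moreover have "?h (prod_encode (n, prefix_code x M)) \<in> {0, Suc (prod_encode (F x n, G x n))}" for x n M
    using f(2)[of n x M] g(2)[of n x M] by auto
  moreover have "\<exists>N. \<forall>M\<ge>N. ?h (prod_encode (n, prefix_code x M)) = Suc (prod_encode (F x n, G x n))" for x n
  proof -
    obtain N where N: "\<forall>M\<ge>N. f (prod_encode (n, prefix_code x M)) = Suc (F x n)"
      using f(3) by blast
    obtain N' where N': "\<forall>M\<ge>N'. g (prod_encode (n, prefix_code x M)) = Suc (G x n)"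
      using g(3) by blast
    show ?thesis by (rule exI[of _ "max N N'"]) (use N N' in auto)
  qed
  ultimately show ?thesis unfolding functional_def approximates_def by blast
qed

text \<open>The argument packs parameter, starting value and number of rounds as
  \<open>((p, s), k)\<close>. An undefined round makes all later ones undefined, and finitely many
  rounds need only a finite prefix.\<close>

lemma functional_iterate:
  assumes "functional H"
  shows "functional (\<lambda>x n. ((\<lambda>s. H x (prod_encode (pfst (pfst n), s))) ^^ psnd n) (psnd (pfst n)))"
    (is "functional ?J")
proof -
  obtain h where "computable h" "approximates h H"
    using assms unfolding functional_def by blast
  note h = this(1) approximates_cases[OF this(2)] approximates_eventually[OF this(2)]
  let ?b = "\<lambda>n r. if r = 0 then 0 else h (prod_encode (prod_encode (pfst (pfst (pfst n)), r - 1), psnd n))"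
  define j where "j = (\<lambda>n. rec_nat (Suc (psnd (pfst (pfst n)))) (\<lambda>k. ?b n) (psnd (pfst n)))"
  have "computable (\<lambda>n. rec_nat (Suc (psnd (pfst (pfst n))))
     (\<lambda>k r. (\<lambda>m. ?b (pfst (pfst m)) (psnd m)) (prod_encode (prod_encode (n, k), r))) (psnd (pfst n)))"
    by (rule computable_rec) (intro comp_intros computable_comp[OF h(1)])+
  then have "computable j" unfolding j_def pfst_pair psnd_pair .
  moreover have "(\<forall>M. j (prod_encode (n, prefix_code x M)) \<in> {0, Suc (?J x n)}) \<and>
    (\<exists>N. \<forall>M\<ge>N. j (prod_encode (n, prefix_code x M)) = Suc (?J x n))" for x n
  proof -
    let ?p = "pfst (pfst n)" and ?s = "psnd (pfst n)"
    define R where "R k M = rec_nat (Suc ?s) (\<lambda>k r. if r = 0 then 0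
      else h (prod_encode (prod_encode (?p, r - 1), prefix_code x M))) k" for k M
    let ?I = "\<lambda>k. ((\<lambda>s. H x (prod_encode (?p, s))) ^^ k) ?s"
    have "(\<forall>M. R k M \<in> {0, Suc (?I k)}) \<and> (\<exists>N. \<forall>M\<ge>N. R k M = Suc (?I k))" for k
    proof (induction k)
      case 0
      then show ?case by (simp add: R_def)
    next
      case (Suc k)
      from Suc obtain N where N: "\<forall>M\<ge>N. R k M = Suc (?I k)" by blast
      obtain N' where N': "\<forall>M\<ge>N'. h (prod_encode (prod_encode (?p, ?I k), prefix_code x M))
          = Suc (H x (prod_encode (?p, ?I k)))" using h(3) by blast
      have R: "R (Suc k) M = (if R k M = 0 then 0
          else h (prod_encode (prod_encode (?p, R k M - 1), prefix_code x M)))" for M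
        by (simp add: R_def)
      have "\<exists>N. \<forall>M\<ge>N. R (Suc k) M = Suc (?I (Suc k))"
        unfolding R by (rule exI[of _ "max N N'"]) (use N N' in auto)
      moreover have "R (Suc k) M \<in> {0, Suc (?I (Suc k))}" for M
      proof -
        have "R k M = 0 \<or> R k M = Suc (?I k)" using Suc by blast
        then show ?thesis unfolding R using h(2)[of "prod_encode (?p, ?I k)" x M] by auto
      qed
      ultimately show ?case by blast
    qed
    then show ?thesis unfolding j_def R_def pfst_pair psnd_pair by blast
  qed
  ultimately show ?thesis unfolding functional_def approximates_def by blast
qed

text \<open>\<open>list_encode\<close> maps the empty list to 0 and a nonempty one to the successor
  of the coded pair of head and tail. Hence \<open>psnd (c - 1)\<close> codes the tail, and 0 stays
  0.\<close>

definition drop_code :: "nat \<Rightarrow> nat \<Rightarrow> nat" where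
  "drop_code k c = ((\<lambda>c. psnd (c - 1)) ^^ k) c"

lemma drop_code_list_encode: "drop_code k (list_encode xs) = list_encode (drop k xs)"
proof (induction k arbitrary: xs)
  case (Suc k)
  have "psnd 0 = 0" using psnd_pair[of 0 0] by (simp add: prod_encode_def)
  then have "psnd (list_encode xs - 1) = list_encode (tl xs)" for xs by (cases xs) simp_all
  moreover have "drop_code (Suc k) c = drop_code k (psnd (c - 1))" for c
    unfolding drop_code_def funpow_Suc_right by simp
  ultimately show ?case using Suc[of "tl xs"] by (simp only: drop_Suc)
qed (simp add: drop_code_def)

lemma computable_drop_code [comp_intros]:
  assumes "computable f" "computable g" shows "computable (\<lambda>n. drop_code (f n) (g n))"
proof -
  have "computable (\<lambda>n. rec_nat (g n) (\<lambda>k r. (\<lambda>p. psnd (psnd p - 1)) (prod_encode (prod_encode (n, k), r))) (f n))"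
    by (rule computable_rec) (intro comp_intros assms)+
  moreover have "rec_nat a (\<lambda>k r. psnd (r - 1)) k = drop_code k a" for a k
    by (induction k) (auto simp: drop_code_def)
  ultimately show ?thesis by simp
qed

lemma functional_oracle: "functional (\<lambda>x n. of_bool (x n))"
proof -
  \<comment> \<open>The code 0 after dropping means that the prefix does not contain bit
    \<open>n\<close> yet, which is the undefined answer.\<close>
  define g where "g p = (let d = drop_code (pfst p) (psnd p) in if d = 0 then 0 else Suc (pfst (d - 1)))" for p
  have "computable g" unfolding g_def Let_def by (intro comp_intros)
  moreover have g: "g (prod_encode (n, prefix_code x M)) = (if n < M then Suc (of_bool (x n)) else 0)" for n x M
  proof (cases "n < M")
    case True
    then have "drop n [0..<M] = n # [Suc n..<M]" unfolding drop_upt by (simp add: upt_conv_Cons)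
    then show ?thesis using True
      by (simp add: g_def prefix_code_def word_code_def drop_code_list_encode drop_map)
  qed (simp add: g_def prefix_code_def word_code_def drop_code_list_encode drop_map)
  moreover have "approximates g (\<lambda>x n. of_bool (x n))"
  proof (rule approximatesI)
    show "\<exists>N. \<forall>M\<ge>N. g (prod_encode (n, prefix_code x M)) = Suc (of_bool (x n))" for x n
      by (rule exI[of _ "Suc n"]) (simp add: g)
  qed (simp add: g)
  ultimately show ?thesis unfolding functional_def by blast
qed

definition odecidable :: "(cantor \<Rightarrow> nat \<Rightarrow> bool) \<Rightarrow> bool" where
  "odecidable P \<longleftrightarrow> functional (\<lambda>x n. of_bool (P x n))"

definition ifunctional :: "(cantor \<Rightarrow> nat \<Rightarrow> int) \<Rightarrow> bool" where
  "ifunctional F \<longleftrightarrow> functional (\<lambda>x n. int_encode (F x n))"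

named_theorems fun_intros

lemma functional_comp1: "computable g \<Longrightarrow> functional F \<Longrightarrow> functional (\<lambda>x n. g (F x n))"
  using functional_compose[OF functional_computable] .

lemma functional_comp2:
  "computable (\<lambda>p. g (pfst p) (psnd p)) \<Longrightarrow> functional F \<Longrightarrow> functional G \<Longrightarrow> functional (\<lambda>x n. g (F x n) (G x n))"
  using functional_comp1[OF _ functional_pair, of "\<lambda>p. g (pfst p) (psnd p)" F G] by simp

lemma functional_id [fun_intros]: "functional (\<lambda>x n. n)"
  by (rule functional_computable[OF computable_id])

lemma functional_const [fun_intros]: "functional (\<lambda>x n. c)"
  by (rule functional_computable[OF computable_const])

lemma functional_Suc [fun_intros]: "functional F \<Longrightarrow> functional (\<lambda>x n. Suc (F x n))"
  by (rule functional_comp1) (intro comp_intros)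

lemma functional_pfst [fun_intros]: "functional F \<Longrightarrow> functional (\<lambda>x n. pfst (F x n))"
  by (rule functional_comp1) (intro comp_intros)

lemma functional_psnd [fun_intros]: "functional F \<Longrightarrow> functional (\<lambda>x n. psnd (F x n))"
  by (rule functional_comp1) (intro comp_intros)

lemmas [fun_intros] = functional_pair

lemma functional_diff [fun_intros]: "functional F \<Longrightarrow> functional G \<Longrightarrow> functional (\<lambda>x n. F x n - G x n)"
  by (rule functional_comp2[where g="(-)"]) (intro comp_intros)

lemma functional_if [fun_intros]:
  assumes "odecidable P" "functional F" "functional G"
  shows "functional (\<lambda>x n. if P x n then F x n else G x n)"
proof -
  let ?g = "\<lambda>p. if pfst p = 0 then psnd (psnd p) else pfst (psnd p)"
  have "computable ?g" by (intro comp_intros)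
  moreover have "functional (\<lambda>x n. prod_encode (of_bool (P x n), prod_encode (F x n, G x n)))"
    using assms unfolding odecidable_def by (intro functional_pair)
  ultimately have "functional (\<lambda>x n. ?g (prod_encode (of_bool (P x n), prod_encode (F x n, G x n))))"
    by (rule functional_comp1)
  moreover have "?g (prod_encode (of_bool (P x n), prod_encode (F x n, G x n))) = (if P x n then F x n else G x n)"
    for x n by simp
  ultimately show ?thesis by (simp only:)
qed

lemma odecidable_comp1: "decidable P \<Longrightarrow> functional F \<Longrightarrow> odecidable (\<lambda>x n. P (F x n))"
  unfolding odecidable_def decidable_def by (rule functional_comp1)

lemma odecidable_comp2:
  "decidable (\<lambda>p. P (pfst p) (psnd p)) \<Longrightarrow> functional F \<Longrightarrow> functional G \<Longrightarrow> odecidable (\<lambda>x n. P (F x n) (G x n))"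
  using odecidable_comp1[OF _ functional_pair, of "\<lambda>p. P (pfst p) (psnd p)" F G] by simp

lemma odecidable_oracle [fun_intros]: "functional F \<Longrightarrow> odecidable (\<lambda>x n. x (F x n))"
  unfolding odecidable_def using functional_compose[OF functional_oracle] .

lemma odecidable_not [fun_intros]: "odecidable P \<Longrightarrow> odecidable (\<lambda>x n. \<not> P x n)"
proof -
  assume "odecidable P"
  then have "functional (\<lambda>x n. 1 - of_bool (P x n))"
    unfolding odecidable_def by (intro fun_intros)
  moreover have "(\<lambda>x n. 1 - of_bool (P x n)) = (\<lambda>x n. of_bool (\<not> P x n) :: nat)" by (intro ext) auto
  ultimately show ?thesis unfolding odecidable_def by simp
qed

lemma odecidable_conj [fun_intros]:
  assumes "odecidable P" "odecidable Q" shows "odecidable (\<lambda>x n. P x n \<and> Q x n)"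
proof -
  have "functional (\<lambda>x n. if P x n then of_bool (Q x n) else 0)"
    using assms by (intro fun_intros) (simp_all add: odecidable_def)
  moreover have "(\<lambda>x n. if P x n then of_bool (Q x n) else 0) = (\<lambda>x n. of_bool (P x n \<and> Q x n) :: nat)"
    by (intro ext) auto
  ultimately show ?thesis unfolding odecidable_def by simp
qed

lemma odecidable_disj [fun_intros]:
  "odecidable P \<Longrightarrow> odecidable Q \<Longrightarrow> odecidable (\<lambda>x n. P x n \<or> Q x n)"
  using odecidable_not[OF odecidable_conj[OF odecidable_not odecidable_not], of P Q] by simp

lemma odecidable_imp [fun_intros]:
  "odecidable P \<Longrightarrow> odecidable Q \<Longrightarrow> odecidable (\<lambda>x n. P x n \<longrightarrow> Q x n)"
  unfolding imp_conv_disj by (intro fun_intros)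

lemma odecidable_eq [fun_intros]: "functional F \<Longrightarrow> functional G \<Longrightarrow> odecidable (\<lambda>x n. F x n = G x n)"
  by (rule odecidable_comp2[where P="(=)"]) (intro comp_intros)

lemma odecidable_le [fun_intros]: "functional F \<Longrightarrow> functional G \<Longrightarrow> odecidable (\<lambda>x n. F x n \<le> G x n)"
  by (rule odecidable_comp2[where P="(\<le>)"]) (intro comp_intros)

lemma odecidable_finite [fun_intros]: "finite A \<Longrightarrow> functional F \<Longrightarrow> odecidable (\<lambda>x n. F x n \<in> A)"
  by (rule odecidable_comp1[where P="\<lambda>n. n \<in> A"]) (intro comp_intros)

lemma ifunctional_decode [fun_intros]: "functional F \<Longrightarrow> ifunctional (\<lambda>x n. int_decode (F x n))"
  by (simp add: ifunctional_def)

lemma functional_int_encode [fun_intros]: "ifunctional F \<Longrightarrow> functional (\<lambda>x n. int_encode (F x n))"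
  by (simp add: ifunctional_def)

lemma ifunctional_const [fun_intros]: "ifunctional (\<lambda>x n. c)"
  by (simp add: ifunctional_def functional_const)

lemma ifunctional_of_nat [fun_intros]: "functional F \<Longrightarrow> ifunctional (\<lambda>x n. int (F x n))"
  unfolding ifunctional_def
  by (rule functional_comp1[where g="\<lambda>n. int_encode (int n)"]) (intro comp_intros)

lemma ifunctional_minus [fun_intros]: "ifunctional F \<Longrightarrow> ifunctional (\<lambda>x n. - F x n)"
  unfolding ifunctional_def
  using functional_comp1[where g="\<lambda>n. int_encode (- int_decode n)" and F="\<lambda>x n. int_encode (F x n)",
      OF computable_int_encode[OF icomputable_minus[OF icomputable_decode[OF computable_id]]]] by simp

lemma ifunctional_add [fun_intros]:
  assumes "ifunctional F" "ifunctional G" shows "ifunctional (\<lambda>x n. F x n + G x n)"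
proof -
  have "functional (\<lambda>x n. int_encode (int_decode (int_encode (F x n)) + int_decode (int_encode (G x n))))"
    by (rule functional_comp2[where g="\<lambda>a b. int_encode (int_decode a + int_decode b)"])
      (intro comp_intros fun_intros assms)+
  then show ?thesis by (simp add: ifunctional_def)
qed

lemma ifunctional_diff [fun_intros]:
  "ifunctional F \<Longrightarrow> ifunctional G \<Longrightarrow> ifunctional (\<lambda>x n. F x n - G x n)"
  using ifunctional_add[OF _ ifunctional_minus, of F G] by simp

lemma odecidable_int_le [fun_intros]:
  assumes "ifunctional F" "ifunctional G" shows "odecidable (\<lambda>x n. F x n \<le> G x n)"
proof -
  have "odecidable (\<lambda>x n. int_decode (int_encode (F x n)) \<le> int_decode (int_encode (G x n)))"
    by (rule odecidable_comp2[where P="\<lambda>a b. int_decode a \<le> int_decode b"])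
      (intro comp_intros fun_intros assms)+
  then show ?thesis by simp
qed

lemma functional_funpow:
  assumes "functional H" "functional P" "functional I" "functional K"
  shows "functional (\<lambda>x n. ((\<lambda>s. H x (prod_encode (P x n, s))) ^^ K x n) (I x n))"
  using functional_compose[OF functional_iterate[OF assms(1)]
      functional_pair[OF functional_pair[OF assms(2,3)] assms(4)]] by simp

section \<open>Arithmetical classes\<close>

text \<open>For \<open>k \<ge> 1\<close> this is the class Sigma-k, uniformly in the index
  \<open>m\<close>; the negation after each quantifier makes the quantifiers alternate.
  \<open>coarith\<close> is the dual class.\<close>

fun arith :: "nat \<Rightarrow> (nat \<Rightarrow> cantor \<Rightarrow> bool) \<Rightarrow> bool" where
  "arith 0 P \<longleftrightarrow> odecidable (\<lambda>x m. P m x)"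
| "arith (Suc k) P \<longleftrightarrow> (\<exists>Q. arith k Q \<and> (\<forall>m x. P m x \<longleftrightarrow> (\<exists>n. \<not> Q (prod_encode (m, n)) x)))"

lemma arith_SucI:
  "arith k Q \<Longrightarrow> (\<And>m x. P m x \<longleftrightarrow> (\<exists>n. \<not> Q (prod_encode (m, n)) x)) \<Longrightarrow> arith (Suc k) P"
  by auto

lemma arith_SucE:
  assumes "arith (Suc k) P"
  obtains Q where "arith k Q" "\<forall>m x. P m x \<longleftrightarrow> (\<exists>n. \<not> Q (prod_encode (m, n)) x)"
  using assms by auto

declare arith.simps(2) [simp del]

definition coarith :: "nat \<Rightarrow> (nat \<Rightarrow> cantor \<Rightarrow> bool) \<Rightarrow> bool" where
  "coarith k P \<longleftrightarrow> arith k (\<lambda>m x. \<not> P m x)"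

lemma arith_subst_functional:
  "arith k P \<Longrightarrow> functional F \<Longrightarrow> arith k (\<lambda>m x. P (F x m) x)"
proof (induction k arbitrary: P F)
  case 0
  then show ?case using functional_compose[of "\<lambda>x m. of_bool (P m x)" F] by (simp add: odecidable_def)
next
  case (Suc k)
  from Suc.prems(1) obtain Q where "arith k Q" "\<forall>m x. P m x \<longleftrightarrow> (\<exists>n. \<not> Q (prod_encode (m, n)) x)"
    by (rule arith_SucE)
  note Q = this(1) this(2)[rule_format]
  have "arith k (\<lambda>m x. Q (prod_encode (F x (pfst m), psnd m)) x)"
    by (rule Suc.IH[OF Q(1)]) (intro fun_intros functional_compose[OF Suc.prems(2)])
  then show ?case by (rule arith_SucI) (simp add: Q(2))
qed

lemma arith_subst: "arith k P \<Longrightarrow> computable f \<Longrightarrow> arith k (\<lambda>m x. P (f m) x)"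
  by (rule arith_subst_functional[OF _ functional_computable])

lemma arith_conj_disj:
  "arith k P \<Longrightarrow> arith k Q \<Longrightarrow> arith k (\<lambda>m x. P m x \<and> Q m x) \<and> arith k (\<lambda>m x. P m x \<or> Q m x)"
proof (induction k arbitrary: P Q)
  case 0
  then show ?case by (auto intro: fun_intros)
next
  case (Suc k)
  from Suc.prems(1) obtain P' where "arith k P'" "\<forall>m x. P m x \<longleftrightarrow> (\<exists>n. \<not> P' (prod_encode (m, n)) x)"
    by (rule arith_SucE)
  note P' = this(1) this(2)[rule_format]
  from Suc.prems(2) obtain Q' where "arith k Q'" "\<forall>m x. Q m x \<longleftrightarrow> (\<exists>n. \<not> Q' (prod_encode (m, n)) x)"
    by (rule arith_SucE)
  note Q' = this(1) this(2)[rule_format]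
  \<comment> \<open>The two witnesses are packed into one. The negation turns the conjunction into a
    disjunction one level down, so both connectives have to go through the same induction.\<close>
  have "arith k (\<lambda>m x. P' (prod_encode (pfst m, pfst (psnd m))) x \<or> Q' (prod_encode (pfst m, psnd (psnd m))) x)"
    by (intro Suc.IH[THEN conjunct2] arith_subst[OF P'(1)] arith_subst[OF Q'(1)] comp_intros)
  then have "arith (Suc k) (\<lambda>m x. P m x \<and> Q m x)"
  proof (rule arith_SucI)
    show "(P m x \<and> Q m x) \<longleftrightarrow> (\<exists>n. \<not> (P' (prod_encode (pfst (prod_encode (m, n)), pfst (psnd (prod_encode (m, n))))) x \<or>
        Q' (prod_encode (pfst (prod_encode (m, n)), psnd (psnd (prod_encode (m, n))))) x))" for m x
      unfolding P'(2) Q'(2) pfst_pair psnd_pair by (metis pfst_pair psnd_pair)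
  qed
  moreover have "arith k (\<lambda>m x. P' m x \<and> Q' m x)" using Suc.IH[OF P'(1) Q'(1)] by blast
  then have "arith (Suc k) (\<lambda>m x. P m x \<or> Q m x)" by (rule arith_SucI) (auto simp: P'(2) Q'(2))
  ultimately show ?case by blast
qed

lemma arith_conj: "arith k P \<Longrightarrow> arith k Q \<Longrightarrow> arith k (\<lambda>m x. P m x \<and> Q m x)"
  using arith_conj_disj by blast

lemma arith_disj: "arith k P \<Longrightarrow> arith k Q \<Longrightarrow> arith k (\<lambda>m x. P m x \<or> Q m x)"
  using arith_conj_disj by blast

lemma coarith_conj: "coarith k P \<Longrightarrow> coarith k Q \<Longrightarrow> coarith k (\<lambda>m x. P m x \<and> Q m x)"
  unfolding coarith_def de_Morgan_conj by (rule arith_disj)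

lemma coarith_imp: "arith k P \<Longrightarrow> coarith k Q \<Longrightarrow> coarith k (\<lambda>m x. P m x \<longrightarrow> Q m x)"
  unfolding coarith_def not_imp by (rule arith_conj)

lemma coarith_not: "arith k P \<Longrightarrow> coarith k (\<lambda>m x. \<not> P m x)"
  unfolding coarith_def by simp

lemma arith_decidable: "odecidable (\<lambda>x m. P m x) \<Longrightarrow> arith 0 P" by simp

lemma arith_of_coarith: "coarith k P \<Longrightarrow> arith (Suc k) P"
proof -
  assume "coarith k P"
  then have "arith k (\<lambda>m x. \<not> P (pfst m) x)"
    unfolding coarith_def by (rule arith_subst) (intro comp_intros)
  then show ?thesis by (rule arith_SucI) simp
qed

lemma coarith_of_arith: "arith k P \<Longrightarrow> coarith (Suc k) P"
  using arith_of_coarith[of k "\<lambda>m x. \<not> P m x"] by (simp add: coarith_def)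

lemma arith_Suc: "arith k P \<Longrightarrow> arith (Suc k) P"
proof (induction k arbitrary: P)
  case 0
  then have "coarith 0 P" by (auto simp: coarith_def intro: fun_intros)
  then show ?case by (rule arith_of_coarith)
next
  case (Suc k)
  from Suc.prems obtain Q where "arith k Q" "\<forall>m x. P m x \<longleftrightarrow> (\<exists>n. \<not> Q (prod_encode (m, n)) x)"
    by (rule arith_SucE)
  note Q = this(1) this(2)[rule_format]
  show ?case by (rule arith_SucI[OF Suc.IH[OF Q(1)] Q(2)])
qed

lemma arith_mono: "arith k P \<Longrightarrow> k \<le> l \<Longrightarrow> arith l P"
  by (rotate_tac, induction rule: dec_induct) (auto intro: arith_Suc)

lemma coarith_mono: "coarith k P \<Longrightarrow> k \<le> l \<Longrightarrow> coarith l P"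
  unfolding coarith_def by (rule arith_mono)

lemma arith_of_coarith_less: "coarith k P \<Longrightarrow> k < l \<Longrightarrow> arith l P"
  by (rule arith_mono[OF arith_of_coarith]) auto

lemma coarith_of_arith_less: "arith k P \<Longrightarrow> k < l \<Longrightarrow> coarith l P"
  by (rule coarith_mono[OF coarith_of_arith]) auto

text \<open>Two adjacent existential quantifiers merge by pairing, so no level is spent.\<close>

lemma arith_ex:
  assumes "arith (Suc k) (\<lambda>m x. P (pfst m) (psnd m) x)"
  shows "arith (Suc k) (\<lambda>m x. \<exists>n. P m n x)"
proof -
  obtain Q where "arith k Q" "\<forall>m x. P (pfst m) (psnd m) x \<longleftrightarrow> (\<exists>n. \<not> Q (prod_encode (m, n)) x)"
    using assms by (rule arith_SucE)
  note Q = this(1) this(2)[rule_format]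
  let ?Q = "\<lambda>m. Q (prod_encode (prod_encode (pfst m, pfst (psnd m)), psnd (psnd m)))"
  have "arith k ?Q" by (rule arith_subst[OF Q(1)]) (intro comp_intros)
  then show ?thesis
  proof (rule arith_SucI)
    have P: "P m n x \<longleftrightarrow> (\<exists>k. \<not> Q (prod_encode (prod_encode (m, n), k)) x)" for m n x
      using Q(2)[of "prod_encode (m, n)" x] by simp
    show "(\<exists>n. P m n x) \<longleftrightarrow> (\<exists>n. \<not> ?Q (prod_encode (m, n)) x)" for m x
      unfolding P pfst_pair psnd_pair by (metis pfst_pair psnd_pair)
  qed
qed

lemma arith_ex_coarith:
  assumes "coarith k (\<lambda>m x. P (pfst m) (psnd m) x)"
  shows "arith (Suc k) (\<lambda>m x. \<exists>n. P m n x)"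
  by (rule arith_ex[OF arith_of_coarith[OF assms]])

lemma coarith_all:
  assumes "coarith (Suc k) (\<lambda>m x. P (pfst m) (psnd m) x)"
  shows "coarith (Suc k) (\<lambda>m x. \<forall>n. P m n x)"
  using arith_ex[of k "\<lambda>m n x. \<not> P m n x"] assms by (simp add: coarith_def)

lemma coarith_all_arith:
  assumes "arith k (\<lambda>m x. P (pfst m) (psnd m) x)"
  shows "coarith (Suc k) (\<lambda>m x. \<forall>n. P m n x)"
  by (rule coarith_all[OF coarith_of_arith[OF assms]])

section \<open>From arithmetical classes to the Borel hierarchies\<close>

lemma comp_enumerable_nonzero:
  assumes "computable g" shows "comp_enumerable {p. \<exists>k. \<not> g (prod_encode (p, k)) \<le> 1}"
proof -
  have "computable (\<lambda>n. of_bool (g n \<le> 1))"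
    using decidable_le[OF assms computable_const] by (simp add: decidable_def)
  then have "recn 2 (\<lambda>xs. of_bool (g (prod_encode (xs ! 0, xs ! 1)) \<le> 1))"
    by (rule recn_computable) (intro recn_pair recn_proj; simp)
  then obtain h where h: "recursive_fn 2 h"
    "\<And>xs. length xs = 2 \<Longrightarrow> h xs = of_bool (g (prod_encode (xs ! 0, xs ! 1)) \<le> 1)"
    unfolding recn_def by metis
  then show ?thesis unfolding comp_enumerable_def by (intro exI[of _ h] conjI) simp_all
qed

text \<open>A word is listed once the approximation answers \<open>Suc 1\<close> on it for some
  witness \<open>n\<close>. The values up to 1 are the other two answers: 0 for a prefix that is too
  short, \<open>Suc 0\<close> for false.\<close>

lemma unif_effectively_open_arith:
  assumes "arith 0 Q" shows "unif_effectively_open (\<lambda>m. {x. \<exists>n. \<not> Q (prod_encode (m, n)) x})"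
proof -
  have "functional (\<lambda>x n. of_bool (\<not> Q n x))"
    using odecidable_not[of "\<lambda>x n. Q n x"] assms by (simp add: odecidable_def)
  then obtain g where "computable g" "approximates g (\<lambda>x n. of_bool (\<not> Q n x))"
    unfolding functional_def by blast
  note g = this(1) approximates_cases[OF this(2)] approximates_eventually[OF this(2)]
  \<comment> \<open>The enumeration is indexed by \<open>m\<close> and the word with witness
    \<open>n\<close>, the approximation by \<open>m\<close> and \<open>n\<close> with the word last;
    \<open>h\<close> regroups.\<close>
  define h where "h t = g (prod_encode (prod_encode (pfst (pfst t), psnd t), psnd (pfst t)))" for t
  have "computable h" unfolding h_def by (intro computable_comp[OF g(1)] comp_intros)
  then have "comp_enumerable {p. \<exists>k. \<not> h (prod_encode (p, k)) \<le> 1}" by (rule comp_enumerable_nonzero)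
  moreover have "{x. \<exists>n. \<not> Q (prod_encode (m, n)) x} =
    \<Union> {cylinder w |w. prod_encode (m, word_code w) \<in> {p. \<exists>k. \<not> h (prod_encode (p, k)) \<le> 1}}" for m
  proof (intro equalityI subsetI)
    fix x assume "x \<in> {x. \<exists>n. \<not> Q (prod_encode (m, n)) x}"
    then obtain n where n: "\<not> Q (prod_encode (m, n)) x" by blast
    obtain M where "g (prod_encode (prod_encode (m, n), prefix_code x M)) = Suc 1"
      using g(3)[of "prod_encode (m, n)" x] n by auto
    then have "\<not> h (prod_encode (prod_encode (m, prefix_code x M), n)) \<le> 1" by (simp add: h_def)
    moreover have "x \<in> cylinder (map x [0..<M])" by (simp add: cylinder_def)
    ultimately show "x \<in> \<Union> {cylinder w |w. prod_encode (m, word_code w) \<in> {p. \<exists>k. \<not> h (prod_encode (p, k)) \<le> 1}}"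
      unfolding prefix_code_def by blast
  next
    fix x assume "x \<in> \<Union> {cylinder w |w. prod_encode (m, word_code w) \<in> {p. \<exists>k. \<not> h (prod_encode (p, k)) \<le> 1}}"
    then obtain w k where w: "x \<in> cylinder w" "\<not> h (prod_encode (prod_encode (m, word_code w), k)) \<le> 1" by blast
    have "map x [0..<length w] = w" using w(1) by (intro nth_equalityI) (auto simp: cylinder_def)
    then have "prefix_code x (length w) = word_code w" by (simp add: prefix_code_def)
    then have "\<not> Q (prod_encode (m, k)) x" using w(2) g(2)[of "prod_encode (m, k)" x "length w"]
      by (auto simp: h_def split: if_splits)
    then show "x \<in> {x. \<exists>n. \<not> Q (prod_encode (m, n)) x}" by blast
  qed
  ultimately show ?thesis unfolding unif_effectively_open_def by blast
qed

lemma unif_Sigma_arith: "arith (Suc k) P \<Longrightarrow> unif_Sigma (Suc k) (\<lambda>m. {x. P m x})"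
proof (induction k arbitrary: P)
  case 0
  then obtain Q where "arith 0 Q" "\<forall>m x. P m x \<longleftrightarrow> (\<exists>n. \<not> Q (prod_encode (m, n)) x)"
    by (rule arith_SucE)
  note Q = this(1) this(2)[rule_format]
  have "unif_Sigma 1 (\<lambda>m. {x. \<exists>n. \<not> Q (prod_encode (m, n)) x})"
    by (rule eff_open[OF unif_effectively_open_arith[OF Q(1)]])
  then show ?case by (simp add: Q(2))
next
  case (Suc k)
  from Suc.prems obtain Q where "arith (Suc k) Q" "\<forall>m x. P m x \<longleftrightarrow> (\<exists>n. \<not> Q (prod_encode (m, n)) x)"
    by (rule arith_SucE)
  note Q = this(1) this(2)[rule_format]
  have "unif_Sigma (Suc (Suc k)) (\<lambda>m. \<Union>n. - {x. Q (prod_encode (m, n)) x})"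
    by (rule eff_union[OF eff_compl[OF Suc.IH[OF Q(1)]]])
  moreover have "(\<Union>n. - {x. Q (prod_encode (m, n)) x}) = {x. P m x}" for m by (auto simp: Q(2))
  ultimately show ?case by simp
qed

lemma lightface_Delta_arith:
  assumes "arith (Suc k) (\<lambda>_ x. P x)" "coarith (Suc k) (\<lambda>_ x. P x)"
  shows "lightface_Delta (Suc k) {x. P x}"
  using unif_Sigma_arith[OF assms(1)] unif_Sigma_arith[OF assms(2)[unfolded coarith_def]]
  by (simp add: lightface_Delta_def lightface_Pi_def lightface_Sigma_def Collect_neg_eq)

lemma open_cylinder: "open (cylinder w)"
proof -
  have "cylinder w = (\<Inter>i<length w. (\<lambda>x. x i) -` {w ! i})" by (auto simp: cylinder_def)
  moreover have "open ((\<lambda>x::cantor. x i) -` {w ! i})" for i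
    by (rule open_vimage) (auto intro: open_discrete continuous_on_product_coordinates)
  ultimately show ?thesis by (auto intro: open_INT)
qed

lemma unif_imp_boldface:
  "unif_Sigma k A \<Longrightarrow> boldface_Sigma k (A m)"
  "unif_Pi k A \<Longrightarrow> boldface_Pi k (A m)"
proof (induction arbitrary: m and m rule: unif_Sigma_unif_Pi.inducts)
  case (eff_open A)
  then have "open (A m)" unfolding unif_effectively_open_def by (force intro: open_cylinder)
  then show ?case by (rule bf_open)
next
  case (eff_union k B)
  then show ?case by (intro bf_union)
next
  case (eff_compl k A)
  then show ?case by (intro bf_compl)
qed

lemma boldface_Delta_of_lightface: "lightface_Delta k A \<Longrightarrow> boldface_Delta k A"
  unfolding lightface_Delta_def lightface_Pi_def lightface_Sigma_def boldface_Delta_def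
  using unif_imp_boldface(1)[of k "\<lambda>m. A"] bf_compl[OF unif_imp_boldface(1)[of k "\<lambda>m. - A"]] by simp

section \<open>Walks in the triangular lattice\<close>

type_synonym cell = "int \<times> int"

text \<open>A cell \<open>(s, q)\<close> stands for the tile with lattice coordinates \<open>i = - q\<close>, \<open>j = s + q\<close> relative to
  \<open>d\<^sub>0\<close>. The columns \<open>s = const\<close> run from northwest to southeast, so that each of them meets a
  northeast quarter-plane in a finite set. Up to scaling, \<open>xco\<close> and \<open>yco\<close> are the Euclidean coordinates
  of the centre.\<close>

definition dirs :: "cell set" where
  "dirs = {(1, 0), (1, -1), (0, -1), (-1, 0), (-1, 1), (0, 1)}"

definition adj :: "cell \<Rightarrow> cell \<Rightarrow> bool" where
  "adj p p' \<longleftrightarrow> (fst p' - fst p, snd p' - snd p) \<in> dirs"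

definition xco :: "cell \<Rightarrow> int" where "xco p = - snd p"
definition yco :: "cell \<Rightarrow> int" where "yco p = 2 * fst p + snd p"

definition quad :: "int \<Rightarrow> cell set" where
  "quad n = {p. n \<le> xco p \<and> n \<le> yco p}"

text \<open>Idle steps are allowed because an interface changes only one of its two cells at each
  turn.\<close>

definition walk :: "(nat \<Rightarrow> cell) \<Rightarrow> bool" where
  "walk p \<longleftrightarrow> (\<forall>n. p (Suc n) = p n \<or> adj (p n) (p (Suc n)))"

text \<open>This is what makes the crossing counts finite.\<close>

definition proper :: "(nat \<Rightarrow> cell) \<Rightarrow> bool" where
  "proper p \<longleftrightarrow> (\<forall>c. finite {n. fst (p n) \<le> c})"

definition reach :: "(nat \<Rightarrow> cell) \<Rightarrow> bool" where
  "reach p \<longleftrightarrow> (\<forall>r::nat. \<exists>N. \<forall>n\<ge>N. p n \<in> quad (int r))"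

definition Xrec :: "(nat \<Rightarrow> cell) \<Rightarrow> bool" where
  "Xrec p \<longleftrightarrow> (\<exists>r::nat. \<forall>N. \<exists>n\<ge>N. xco (p n) \<le> int r)"

definition Yrec :: "(nat \<Rightarrow> cell) \<Rightarrow> bool" where
  "Yrec p \<longleftrightarrow> (\<exists>r::nat. \<forall>N. \<exists>n\<ge>N. yco (p n) \<le> int r)"

lemma adj_sym: "adj p p' \<Longrightarrow> adj p' p"
  unfolding adj_def dirs_def by (elim insertE emptyE; simp add: diff_eq_eq)

lemma adj_cases:
  assumes "adj p p'"
  obtains "p' = (fst p, snd p + 1)" | "p' = (fst p + 1, snd p)" | "p' = (fst p + 1, snd p - 1)"
    | "p = (fst p', snd p' + 1)" | "p = (fst p' + 1, snd p')" | "p = (fst p' + 1, snd p' - 1)"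
proof -
  have "p' = (fst p, snd p + 1) \<or> p' = (fst p + 1, snd p) \<or> p' = (fst p + 1, snd p - 1) \<or>
     p = (fst p', snd p' + 1) \<or> p = (fst p' + 1, snd p') \<or> p = (fst p' + 1, snd p' - 1)"
    using assms unfolding adj_def dirs_def by (elim insertE emptyE; simp add: prod_eq_iff diff_eq_eq)
  then show thesis using that by blast
qed

lemma adj_minus: "adj (- z) (- z') \<longleftrightarrow> adj z z'"
proof -
  have "adj (- z) (- z')" if "adj z z'" for z z'
    using that by (rule adj_cases) (simp_all add: adj_def dirs_def prod_eq_iff)
  from this[of z z'] this[of "- z" "- z'"] show ?thesis by auto
qed

lemma adj_fst: "adj p p' \<Longrightarrow> \<bar>fst p' - fst p\<bar> \<le> 1"
  by (erule adj_cases) (auto simp: prod_eq_iff)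

lemma adj_xco: "adj p p' \<Longrightarrow> xco p' \<le> xco p + 1"
  by (erule adj_cases) (auto simp: xco_def prod_eq_iff)

lemma adj_yco: "adj p p' \<Longrightarrow> yco p' \<le> yco p + 2"
  by (erule adj_cases) (auto simp: yco_def prod_eq_iff)

lemma quad_mono: "m \<le> n \<Longrightarrow> quad n \<subseteq> quad m"
  by (auto simp: quad_def)

text \<open>The sum of \<open>xco p\<close> and \<open>yco p\<close> is
  \<open>2 * fst p\<close>.\<close>

lemma quad_fst: "p \<in> quad n \<Longrightarrow> n \<le> fst p"
  by (auto simp: quad_def xco_def yco_def)

lemma finite_quad: "finite {p \<in> quad n. fst p \<le> c}"
proof (rule finite_subset)
  show "{p \<in> quad n. fst p \<le> c} \<subseteq> {n..c} \<times> {n - 2 * c..- n}"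
    by (auto simp: quad_def xco_def yco_def)
qed simp

lemma properD: "proper p \<Longrightarrow> \<exists>N. \<forall>n\<ge>N. c < fst (p n)"
proof -
  assume "proper p"
  then have "finite {n. fst (p n) \<le> c}" by (simp add: proper_def)
  then obtain N where "\<forall>n \<in> {n. fst (p n) \<le> c}. n < N" using finite_nat_set_iff_bounded by blast
  then show ?thesis by (intro exI[of _ N]) (auto simp: not_less[symmetric])
qed

lemma proper_if_reach: "reach p \<Longrightarrow> proper p"
  unfolding proper_def
proof
  fix c assume "reach p"
  then obtain N where N: "\<forall>n\<ge>N. p n \<in> quad (int (nat (c + 1)))" unfolding reach_def by blast
  have "{n. fst (p n) \<le> c} \<subseteq> {..<N}"
  proof
    fix n assume "n \<in> {n. fst (p n) \<le> c}"
    then show "n \<in> {..<N}" using N[rule_format, of n] quad_fst[of "p n" "int (nat (c + 1))"]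
      by (cases "N \<le> n") (auto split: if_splits)
  qed
  then show "finite {n. fst (p n) \<le> c}" by (rule finite_subset) simp
qed

lemma not_rec_if_reach: assumes "reach p" shows "\<not> Xrec p" "\<not> Yrec p"
proof -
  have "\<exists>N. \<forall>n\<ge>N. int r < xco (p n) \<and> int r < yco (p n)" for r
  proof -
    obtain N where "\<forall>n\<ge>N. p n \<in> quad (int (Suc r))" using assms unfolding reach_def by blast
    then show ?thesis by (intro exI[of _ N]) (force simp: quad_def)
  qed
  then show "\<not> Xrec p" "\<not> Yrec p" unfolding Xrec_def Yrec_def by (meson not_less)+
qed

lemma walk_shift: "walk p \<Longrightarrow> walk (\<lambda>n. p (N + n))"
  by (simp add: walk_def)

section \<open>The two sides of a walk\<close>

text \<open>Modulo 2, the size of this set is the intersection number of the walk with a ray going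
  down from \<open>t\<close>, pushed slightly to the left; \<open>rcross\<close> is the same with
  the ray pushed to the right.\<close>

definition lcross :: "(nat \<Rightarrow> cell) \<Rightarrow> cell \<Rightarrow> nat set" where
  "lcross p t = {n. (fst (p n) = fst t - 1 \<and> fst (p (Suc n)) = fst t \<and> snd (p (Suc n)) < snd t) \<or>
     (fst (p n) = fst t \<and> fst (p (Suc n)) = fst t - 1 \<and> snd (p n) < snd t)}"

definition rcross :: "(nat \<Rightarrow> cell) \<Rightarrow> cell \<Rightarrow> nat set" where
  "rcross p t = {n. (fst (p n) = fst t + 1 \<and> fst (p (Suc n)) = fst t \<and> snd (p (Suc n)) < snd t) \<or>
     (fst (p n) = fst t \<and> fst (p (Suc n)) = fst t + 1 \<and> snd (p n) < snd t)}"

text \<open>The walk is thought of as prolonged from its initial cell by the ray of all cells with the same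
  second and smaller first coordinate; the second condition accounts for the crossings of that ray.\<close>

definition side :: "(nat \<Rightarrow> cell) \<Rightarrow> cell \<Rightarrow> bool" where
  "side p t \<longleftrightarrow> odd (card (lcross p t)) \<noteq> (fst t \<le> fst (p 0) \<and> snd (p 0) < snd t)"

text \<open>A finite set of times is eventually left for good, so the parity of the number of
  changes tells whether the sequence starts inside.\<close>

lemma odd_card_changes:
  assumes "finite (A :: nat set)"
  shows "odd (card {n. (n \<in> A) \<noteq> (Suc n \<in> A)}) \<longleftrightarrow> 0 \<in> A"
proof -
  have *: "odd (card {n. n < M \<and> (n \<in> A) \<noteq> (Suc n \<in> A)}) \<longleftrightarrow> (0 \<in> A) \<noteq> (M \<in> A)" for M
  proof (induction M)
    case (Suc M)
    have "{n. n < Suc M \<and> (n \<in> A) \<noteq> (Suc n \<in> A)} = {n. n < M \<and> (n \<in> A) \<noteq> (Suc n \<in> A)} \<union>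
        (if (M \<in> A) \<noteq> (Suc M \<in> A) then {M} else {})" by (auto simp: less_Suc_eq)
    then show ?case using Suc by auto
  qed simp
  obtain M where "\<forall>n\<in>A. n < M" using assms finite_nat_set_iff_bounded by blast
  then have "{n. (n \<in> A) \<noteq> (Suc n \<in> A)} = {n. n < M \<and> (n \<in> A) \<noteq> (Suc n \<in> A)}" "M \<notin> A"
    by (auto dest: Suc_lessD)
  then show ?thesis using *[of M] by simp
qed

lemma finite_cross: assumes "proper p" shows "finite (lcross p t)" "finite (rcross p t)"
proof -
  have "finite {n. fst (p n) \<le> fst t + 1}" using assms by (simp add: proper_def)
  then show "finite (lcross p t)" "finite (rcross p t)"
    by (auto simp: lcross_def rcross_def elim!: rev_finite_subset)
qed

lemma walk_cases:
  assumes "walk p"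
  obtains "p (Suc n) = p n" | "adj (p n) (p (Suc n))"
  using assms by (auto simp: walk_def)

text \<open>Left and right crossings together are the moments at which the walk enters or leaves the
  part of the column below \<open>t\<close>: within the column this part could be left only through
  \<open>t\<close>.\<close>

lemma odd_cross_sum:
  assumes "walk p" "proper p" "t \<notin> range p"
  shows "odd (card (lcross p t) + card (rcross p t)) \<longleftrightarrow> fst (p 0) = fst t \<and> snd (p 0) < snd t"
proof -
  let ?A = "{n. fst (p n) = fst t \<and> snd (p n) < snd t}"
  have "n \<in> lcross p t \<union> rcross p t \<longleftrightarrow> (n \<in> ?A) \<noteq> (Suc n \<in> ?A)" for n
  proof -
    have ne: "p n \<noteq> t" "p (Suc n) \<noteq> t" using assms(3) by auto
    from assms(1) show ?thesis
    proof (cases rule: walk_cases[of p n])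
      case 2
      then show ?thesis by (rule adj_cases) (use ne in \<open>auto simp: lcross_def rcross_def prod_eq_iff\<close>)
    qed (simp add: lcross_def rcross_def)
  qed
  then have "lcross p t \<union> rcross p t = {n. (n \<in> ?A) \<noteq> (Suc n \<in> ?A)}" by blast
  moreover have "lcross p t \<inter> rcross p t = {}" by (auto simp: lcross_def rcross_def)
  moreover have "finite ?A"
    by (rule finite_subset[of _ "{n. fst (p n) \<le> fst t}"]) (use assms(2) in \<open>auto simp: proper_def\<close>)
  ultimately show ?thesis using odd_card_changes[of ?A] finite_cross[OF assms(2), of t]
    by (simp add: card_Un_disjoint[symmetric])
qed

text \<open>The cells \<open>t\<close> and \<open>t'\<close> are adjacent, and distinct edges of the
  triangular lattice meet only in common endpoints. So a step between the two columns that avoids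
  both cells passes below both or above both.\<close>

lemma rcross_eq_lcross:
  assumes "walk p" "t \<notin> range p" "t' \<notin> range p"
    and "t' = (fst t + 1, snd t) \<or> t' = (fst t + 1, snd t - 1)"
  shows "rcross p t = lcross p t'"
proof -
  have "n \<in> rcross p t \<longleftrightarrow> n \<in> lcross p t'" for n
  proof -
    have ne: "p n \<noteq> t" "p (Suc n) \<noteq> t" "p n \<noteq> t'" "p (Suc n) \<noteq> t'" using assms(2,3) by auto
    from assms(1) show ?thesis
    proof (cases rule: walk_cases[of p n])
      case 2
      obtain a b a' b' s q q' where pq: "p n = (a, b)" "p (Suc n) = (a', b')" "t = (s, q)" "t' = (s + 1, q')"
        using assms(4) by (metis surj_pair fst_conv)
      have d: "a' = a \<and> b' = b + 1 \<or> a' = a + 1 \<and> b' = b \<or> a' = a + 1 \<and> b' = b - 1 \<or>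
        a' = a \<and> b' = b - 1 \<or> a' = a - 1 \<and> b' = b \<or> a' = a - 1 \<and> b' = b + 1"
        using 2 by (rule adj_cases) (simp_all add: pq)
      have q': "q' = q \<or> q' = q - 1" using assms(4) by (simp add: pq)
      have "n \<in> rcross p t \<longleftrightarrow> (a = s + 1 \<and> a' = s \<and> b' < q) \<or> (a = s \<and> a' = s + 1 \<and> b < q)"
        "n \<in> lcross p t' \<longleftrightarrow> (a = s \<and> a' = s + 1 \<and> b' < q') \<or> (a = s + 1 \<and> a' = s \<and> b < q')"
        by (simp_all add: rcross_def lcross_def pq)
      then show ?thesis using d q' ne unfolding pq prod.inject by smt
    qed (use assms(4) in \<open>auto simp: lcross_def rcross_def\<close>)
  qed
  then show ?thesis by blast
qed

lemma lcross_up: "t \<notin> range p \<Longrightarrow> lcross p (fst t, snd t + 1) = lcross p t"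
proof -
  assume "t \<notin> range p"
  then have "p n \<noteq> t" for n by auto
  then have "snd (p n) < snd t + 1 \<longleftrightarrow> snd (p n) < snd t" if "fst (p n) = fst t" for n
    using that by (force simp: prod_eq_iff)
  then show ?thesis by (auto simp: lcross_def)
qed

lemma lcross_right:
  assumes "walk p" "proper p" "t \<notin> range p" "t' \<notin> range p"
    and "t' = (fst t + 1, snd t) \<or> t' = (fst t + 1, snd t - 1)"
  shows "odd (card (lcross p t')) \<longleftrightarrow> odd (card (lcross p t)) \<noteq> (fst (p 0) = fst t \<and> snd (p 0) < snd t)"
  using odd_cross_sum[OF assms(1-3)] rcross_eq_lcross[OF assms(1,3-5)] by auto

text \<open>The side can change only on the walk or on the ray prolonging it; the last two
  hypotheses keep both cells off that ray. A move within a column leaves \<open>lcross\<close>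
  fixed, and a move to the next column exchanges it for \<open>rcross\<close>.\<close>

lemma side_adj:
  assumes "walk p" "proper p" "adj t t'" "t \<notin> range p" "t' \<notin> range p"
    and "\<not> (fst t < fst (p 0) \<and> snd t = snd (p 0))" "\<not> (fst t' < fst (p 0) \<and> snd t' = snd (p 0))"
  shows "side p t \<longleftrightarrow> side p t'"
proof -
  have up: "side p t \<longleftrightarrow> side p t'" if "t' = (fst t, snd t + 1)" "t \<notin> range p"
    "\<not> (fst t < fst (p 0) \<and> snd t = snd (p 0))" for t t'
  proof -
    have "p 0 \<noteq> t" using that(2) by auto
    then have "(fst t \<le> fst (p 0) \<and> snd (p 0) < snd t + 1) = (fst t \<le> fst (p 0) \<and> snd (p 0) < snd t)"
      using that(3) unfolding prod_eq_iff by smt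
    then show ?thesis by (simp add: side_def that(1) lcross_up[OF that(2)])
  qed
  have right: "side p t \<longleftrightarrow> side p t'" if "t' = (fst t + 1, snd t) \<or> t' = (fst t + 1, snd t - 1)"
    "t \<notin> range p" "t' \<notin> range p" "\<not> (fst t' < fst (p 0) \<and> snd t' = snd (p 0))" for t t'
  proof -
    have "p 0 \<noteq> t'" using that(3) by auto
    moreover have "fst t' = fst t + 1 \<and> (snd t' = snd t \<or> snd t' = snd t - 1)" using that(1) by auto
    ultimately show ?thesis using that(4) lcross_right[OF assms(1,2) that(2,3,1)]
      unfolding side_def prod_eq_iff by smt
  qed
  show ?thesis using assms(3)
    by (rule adj_cases) (use up[of t' t] right[of t' t] up[of t t'] right[of t t'] assms(4-) in blast)+
qed

lemma lcross_empty:
  "(\<And>n. fst (p n) = fst t \<Longrightarrow> snd t \<le> snd (p n)) \<Longrightarrow> lcross p t = {}"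
  by (force simp: lcross_def)

text \<open>Here every passage between the columns left of \<open>t\<close> and the rest is counted,
  and the walk ends up in the rest.\<close>

lemma odd_lcross_above:
  assumes "walk p" "proper p" "\<And>n. fst (p n) = fst t \<Longrightarrow> snd (p n) < snd t"
  shows "odd (card (lcross p t)) \<longleftrightarrow> fst (p 0) < fst t"
proof -
  let ?A = "{n. fst (p n) < fst t}"
  have "n \<in> lcross p t \<longleftrightarrow> (n \<in> ?A) \<noteq> (Suc n \<in> ?A)" for n
    using assms(1) by (cases rule: walk_cases[of p n], simp add: lcross_def)
      (drule adj_fst, use assms(3)[of n] assms(3)[of "Suc n"] in \<open>auto simp: lcross_def\<close>)
  then have "lcross p t = {n. (n \<in> ?A) \<noteq> (Suc n \<in> ?A)}" by blast
  moreover have "finite ?A"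
    by (rule finite_subset[of _ "{n. fst (p n) \<le> fst t}"]) (use assms(2) in \<open>auto simp: proper_def\<close>)
  ultimately show ?thesis using odd_card_changes[of ?A] by simp
qed

lemma not_side_below:
  assumes "\<And>n. fst (p n) = fst t \<Longrightarrow> snd t \<le> snd (p n)" "fst (p 0) < fst t"
  shows "\<not> side p t"
  using lcross_empty[OF assms(1)] assms(2) by (simp add: side_def)

lemma side_above:
  assumes "walk p" "proper p" "\<And>n. fst (p n) = fst t \<Longrightarrow> snd (p n) < snd t" "fst (p 0) < fst t"
  shows "side p t"
  using odd_lcross_above[OF assms(1-3)] assms(4) by (simp add: side_def)

lemma far_bound: "\<exists>c. fst (p 0) \<le> c \<and> (\<forall>n. c < fst (p n) \<longrightarrow> N \<le> n)" for p :: "nat \<Rightarrow> cell"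
proof -
  let ?c = "Max ((\<lambda>n. fst (p n)) ` {..N})"
  have *: "fst (p n) \<le> ?c" if "n \<le> N" for n using that by (intro Max_ge) auto
  show ?thesis
  proof (intro exI conjI allI impI)
    show "fst (p 0) \<le> ?c" by (rule *) simp
    show "N \<le> n" if "?c < fst (p n)" for n
    proof (rule ccontr)
      assume "\<not> N \<le> n"
      then have "fst (p n) \<le> ?c" by (intro *) simp
      with that show False by linarith
    qed
  qed
qed

text \<open>In a far column all visits of \<open>p\<close> are late and hence higher than
  \<open>r\<close>, so a cell of height at most \<open>r\<close> there lies below the whole
  walk.\<close>

lemma not_side_far:
  assumes "\<not> Yrec p"
  shows "\<exists>c. \<forall>t. c < fst t \<and> yco t \<le> int r \<longrightarrow> \<not> side p t"
proof -
  obtain N where N: "\<forall>n\<ge>N. int r < yco (p n)" using assms unfolding Yrec_def by (meson not_le)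
  obtain c where c: "fst (p 0) \<le> c" "\<forall>n. c < fst (p n) \<longrightarrow> N \<le> n" using far_bound by blast
  show ?thesis
  proof (intro exI[of _ c] allI impI)
    fix t assume t: "c < fst t \<and> yco t \<le> int r"
    show "\<not> side p t"
    proof (rule not_side_below)
      fix n assume n: "fst (p n) = fst t"
      then have "int r < yco (p n)" using N c(2) t by auto
      then show "snd t \<le> snd (p n)" using t n by (simp add: yco_def)
    qed (use c t in auto)
  qed
qed

lemma side_far:
  assumes "walk p" "proper p" "\<not> Xrec p"
  shows "\<exists>c. \<forall>t. c < fst t \<and> xco t \<le> int r \<longrightarrow> side p t"
proof -
  obtain N where N: "\<forall>n\<ge>N. int r < xco (p n)" using assms(3) unfolding Xrec_def by (meson not_le)
  obtain c where c: "fst (p 0) \<le> c" "\<forall>n. c < fst (p n) \<longrightarrow> N \<le> n" using far_bound by blast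
  show ?thesis
  proof (intro exI[of _ c] allI impI)
    fix t assume t: "c < fst t \<and> xco t \<le> int r"
    show "side p t"
    proof (rule side_above[OF assms(1,2)])
      fix n assume n: "fst (p n) = fst t"
      then have "int r < xco (p n)" using N c(2) t by auto
      then show "snd (p n) < snd t" using t n by (simp add: xco_def)
    qed (use c t in auto)
  qed
qed

text \<open>The prolonging ray stays in columns up to \<open>fst (p 0)\<close>, so it is never met
  by \<open>u\<close> from time \<open>N\<close> on.\<close>

lemma side_const:
  assumes "walk p" "proper p" "walk u" "N \<le> n"
    and "\<And>n. N \<le> n \<Longrightarrow> u n \<notin> range p \<and> fst (p 0) < fst (u n)"
  shows "side p (u n) \<longleftrightarrow> side p (u N)"
  using assms(4)
proof (induction rule: dec_induct)
  case (step n)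
  have "side p (u n) \<longleftrightarrow> side p (u (Suc n))"
    using assms(3)
  proof (cases rule: walk_cases[of u n])
    case 2
    show ?thesis
      by (rule side_adj[OF assms(1,2) 2]) (use assms(5)[of n] assms(5)[of "Suc n"] step in auto)
  qed simp
  then show ?case using step by simp
qed simp

lemma eventually_side_const:
  assumes "walk p" "proper p" "walk u" "proper u" "range p \<inter> range u = {}"
  shows "\<exists>N. \<forall>n\<ge>N. fst (p 0) < fst (u n) \<and> (side p (u n) \<longleftrightarrow> side p (u N))"
proof -
  obtain N where N: "\<forall>n\<ge>N. fst (p 0) < fst (u n)" using properD[OF assms(4)] by blast
  show ?thesis using side_const[OF assms(1-3), of N] N assms(5) by (intro exI[of _ N]) blast
qed

text \<open>Of two disjoint walks one is eventually above the other: compare the extreme cells of both in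
  a far column.\<close>

lemma far_column:
  assumes "proper u" "proper p"
  shows "\<exists>T. finite T \<and> T \<noteq> {} \<and> (\<exists>s. T = {t \<in> range p \<union> range u. fst t = s}) \<and>
    (\<forall>t\<in>T. (\<forall>n. t = u n \<longrightarrow> N \<le> n) \<and> (\<forall>m. t = p m \<longrightarrow> M \<le> m))"
proof -
  obtain c where c: "\<forall>n. c < fst (u n) \<longrightarrow> N \<le> n" using far_bound by blast
  obtain d where d: "\<forall>m. d < fst (p m) \<longrightarrow> M \<le> m" using far_bound by blast
  obtain n where n: "max c d < fst (u n)" using properD[OF assms(1)] by blast
  let ?T = "{t \<in> range p \<union> range u. fst t = fst (u n)}"
  have "?T \<subseteq> p ` {m. fst (p m) \<le> fst (u n)} \<union> u ` {m. fst (u m) \<le> fst (u n)}" by auto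
  then have "finite ?T" by (rule finite_subset) (use assms in \<open>simp add: proper_def\<close>)
  moreover have "u n \<in> ?T" by simp
  moreover have "\<forall>t\<in>?T. (\<forall>n. t = u n \<longrightarrow> N \<le> n) \<and> (\<forall>m. t = p m \<longrightarrow> M \<le> m)"
    using c d n by (metis (mono_tags, lifting) max_less_iff_conj mem_Collect_eq)
  ultimately show ?thesis by blast
qed

lemma side_antisym:
  assumes "walk p" "proper p" "walk u" "proper u" "range p \<inter> range u = {}"
  shows "(\<forall>N. \<exists>n\<ge>N. side p (u n)) \<Longrightarrow> \<exists>M. \<forall>m\<ge>M. \<not> side u (p m)"
    and "(\<forall>N. \<exists>n\<ge>N. \<not> side p (u n)) \<Longrightarrow> \<exists>M. \<forall>m\<ge>M. side u (p m)"
proof -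
  obtain N where N: "\<forall>n\<ge>N. fst (p 0) < fst (u n) \<and> (side p (u n) \<longleftrightarrow> side p (u N))"
    using eventually_side_const[OF assms] by blast
  obtain M where M: "\<forall>n\<ge>M. fst (u 0) < fst (p n) \<and> (side u (p n) \<longleftrightarrow> side u (p M))"
    using eventually_side_const[OF assms(3,4,1,2)] assms(5) by blast
  obtain T s where T: "finite T" "T \<noteq> {}" "T = {t \<in> range p \<union> range u. fst t = s}"
    "\<And>n. u n \<in> T \<Longrightarrow> N \<le> n" "\<And>m. p m \<in> T \<Longrightarrow> M \<le> m"
    using far_column[OF assms(4,2), of N M] by blast
  have dis: "p m \<noteq> u n" for m n using assms(5) by blast
  {
    assume "\<forall>N. \<exists>n\<ge>N. side p (u n)"
    then have up: "\<forall>n\<ge>N. side p (u n)" using N by blast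
    obtain t where t: "t \<in> T" "\<And>t'. t' \<in> T \<Longrightarrow> snd t \<le> snd t'"
      using T(1,2) arg_min_if_finite(1)[of T snd] arg_min_least[of T _ snd] by metis
    have low: "snd t \<le> snd (p n)" if "fst (p n) = fst t" for n using t(2)[of "p n"] t(1) that T(3) by auto
    have low': "snd t \<le> snd (u n)" if "fst (u n) = fst t" for n using t(2)[of "u n"] t(1) that T(3) by auto
    \<comment> \<open>On \<open>u\<close>, this lowest cell would lie below all of \<open>p\<close>
      in its column, contrary to \<open>up\<close>.\<close>
    have "t \<notin> range u"
    proof
      assume "t \<in> range u"
      then obtain n where n: "t = u n" "N \<le> n" using T(4) t(1) by blast
      then have "fst (p 0) < fst t" using N by blast
      with low have "\<not> side p t" by (rule not_side_below)
      then show False using n up by blast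
    qed
    then obtain m where m: "t = p m" "M \<le> m" using t(1) T(3,5) by blast
    then have "fst (u 0) < fst t" using M by blast
    with low' have "\<not> side u t" by (rule not_side_below)
    then have "\<forall>m\<ge>M. \<not> side u (p m)" using M m by blast
    then show "\<exists>M. \<forall>m\<ge>M. \<not> side u (p m)" by blast
  }
  {
    assume "\<forall>N. \<exists>n\<ge>N. \<not> side p (u n)"
    then have dn: "\<forall>n\<ge>N. \<not> side p (u n)" using N by blast
    obtain t where t: "t \<in> T" "\<And>t'. t' \<in> T \<Longrightarrow> snd t' \<le> snd t"
      using T(1,2) arg_min_if_finite(1)[of T "\<lambda>t. - snd t"] arg_min_least[of T _ "\<lambda>t. - snd t"]
      by (metis neg_le_iff_le)
    have hi: "snd (p n) \<le> snd t" if "fst (p n) = fst t" for n using t(2)[of "p n"] t(1) that T(3) by auto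
    have hi': "snd (u n) \<le> snd t" if "fst (u n) = fst t" for n using t(2)[of "u n"] t(1) that T(3) by auto
    have "t \<notin> range u"
    proof
      assume "t \<in> range u"
      then obtain n where n: "t = u n" "N \<le> n" using T(4) t(1) by blast
      have "snd (p m) < snd t" if "fst (p m) = fst t" for m
        using hi[OF that] that dis[of m n] n(1) by (simp add: prod_eq_iff order_less_le)
      moreover have "fst (p 0) < fst t" using N n by blast
      ultimately have "side p t" by (rule side_above[OF assms(1,2)])
      then show False using n dn by blast
    qed
    then obtain m where m: "t = p m" "M \<le> m" using t(1) T(3,5) by blast
    have "snd (u n) < snd t" if "fst (u n) = fst t" for n
      using hi'[OF that] that dis[of m n] m(1) by (simp add: prod_eq_iff order_less_le)
    moreover have "fst (u 0) < fst t" using M m by blast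
    ultimately have "side u t" by (rule side_above[OF assms(3,4)])
    then have "\<forall>m\<ge>M. side u (p m)" using M m by blast
    then show "\<exists>M. \<forall>m\<ge>M. side u (p m)" by blast
  }
qed

text \<open>Two walks \<open>f\<close>, \<open>g\<close> with the same initial cell are regarded as one two-way infinite walk.\<close>

definition beyond :: "(nat \<Rightarrow> cell) \<Rightarrow> (nat \<Rightarrow> cell) \<Rightarrow> cell \<Rightarrow> bool" where
  "beyond f g t \<longleftrightarrow> odd (card (lcross f t)) \<noteq> odd (card (lcross g t))"

lemma beyond_side: "f 0 = g 0 \<Longrightarrow> beyond f g t \<longleftrightarrow> side f t \<noteq> side g t"
  by (auto simp: beyond_def side_def)

text \<open>The contributions of the common initial cell of \<open>f\<close> and \<open>g\<close>
  cancel; there is no ray to be avoided, and invariance holds everywhere off the two-way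
  walk.\<close>

lemma beyond_adj:
  assumes "walk f" "proper f" "walk g" "proper g" "f 0 = g 0" "adj t t'"
    "t \<notin> range f \<union> range g" "t' \<notin> range f \<union> range g"
  shows "beyond f g t \<longleftrightarrow> beyond f g t'"
proof -
  have up: "beyond f g t \<longleftrightarrow> beyond f g t'" if "t' = (fst t, snd t + 1)" "t \<notin> range f \<union> range g" for t t'
    using that lcross_up[of t f] lcross_up[of t g] by (simp add: beyond_def)
  have right: "beyond f g t \<longleftrightarrow> beyond f g t'" if "t' = (fst t + 1, snd t) \<or> t' = (fst t + 1, snd t - 1)"
    "t \<notin> range f \<union> range g" "t' \<notin> range f \<union> range g" for t t'
    using lcross_right[OF assms(1,2) _ _ that(1)] lcross_right[OF assms(3,4) _ _ that(1)] that(2,3) assms(5)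
    by (auto simp: beyond_def)
  show ?thesis using assms(6)
    by (rule adj_cases) (use up[of t' t] right[of t' t] up[of t t'] right[of t t'] assms(7-) in blast)+
qed

lemma beyond_walk:
  assumes "walk f" "proper f" "walk g" "proper g" "f 0 = g 0" "walk u"
    "range u \<inter> (range f \<union> range g) = {}"
  shows "beyond f g (u n) \<longleftrightarrow> beyond f g (u 0)"
proof (induction n)
  case (Suc n)
  have "beyond f g (u n) \<longleftrightarrow> beyond f g (u (Suc n))"
    using assms(6)
  proof (cases rule: walk_cases[of u n])
    case 2
    show ?thesis by (rule beyond_adj[OF assms(1-5) 2]) (use assms(7) in auto)
  qed simp
  then show ?case using Suc by simp
qed simp

lemma not_beyond_below:
  assumes "\<And>t'. t' \<in> range f \<union> range g \<Longrightarrow> fst t' = fst t \<Longrightarrow> snd t \<le> snd t'"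
  shows "\<not> beyond f g t"
  using lcross_empty[of f t] lcross_empty[of g t] assms by (auto simp: beyond_def)

text \<open>A cell outside is either below all cells of the walk in its column, where nothing is
  counted, or above the whole walk, where both ends give the same parity because they start in the
  same cell.\<close>

lemma not_beyond_outside:
  assumes "walk f" "proper f" "walk g" "proper g" "f 0 = g 0"
    "range f \<union> range g \<subseteq> quad k" "t \<notin> quad k"
  shows "\<not> beyond f g t"
proof (cases "k \<le> xco t")
  case True
  then have "yco t < k" using assms(7) by (auto simp: quad_def)
  then show ?thesis using assms(6)
    by (intro not_beyond_below) (fastforce simp: quad_def yco_def)
next
  case False
  then have *: "snd t' < snd t" if "t' \<in> range f \<union> range g" for t'
    using that assms(6) by (fastforce simp: quad_def xco_def)
  have "odd (card (lcross f t)) \<longleftrightarrow> fst (f 0) < fst t" by (rule odd_lcross_above) (use assms * in auto)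
  moreover have "odd (card (lcross g t)) \<longleftrightarrow> fst (g 0) < fst t" by (rule odd_lcross_above) (use assms * in auto)
  ultimately show ?thesis using assms(5) by (simp add: beyond_def)
qed

section \<open>Connectedness\<close>

definition astep :: "cell set \<Rightarrow> cell \<Rightarrow> cell \<Rightarrow> bool" where
  "astep S p p' \<longleftrightarrow> p \<in> S \<and> p' \<in> S \<and> adj p p'"

definition conn :: "cell set \<Rightarrow> cell \<Rightarrow> cell \<Rightarrow> bool" where
  "conn S = (astep S)\<^sup>*\<^sup>*"

lemma conn_refl [simp]: "conn S p p" by (simp add: conn_def)

lemma conn_trans: "conn S p p' \<Longrightarrow> conn S p' p'' \<Longrightarrow> conn S p p''"
  unfolding conn_def by (rule rtranclp_trans)

lemma conn_sym: "conn S p p' \<Longrightarrow> conn S p' p"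
proof -
  have "symp (astep S)" by (auto simp: symp_def astep_def intro: adj_sym)
  then show "conn S p p' \<Longrightarrow> conn S p' p" unfolding conn_def by (meson sympD symp_rtranclp)
qed

lemma conn_mono: "conn S p p' \<Longrightarrow> S \<subseteq> S' \<Longrightarrow> conn S' p p'"
  unfolding conn_def by (erule rtranclp_mono[THEN predicate2D, rotated]) (auto simp: astep_def)

lemma conn_mem: "conn S p p' \<Longrightarrow> p \<in> S \<Longrightarrow> p' \<in> S"
  unfolding conn_def by (induction rule: rtranclp_induct) (auto simp: astep_def)

lemma conn_step: "p \<in> S \<Longrightarrow> p' \<in> S \<Longrightarrow> adj p p' \<Longrightarrow> conn S p p'"
  unfolding conn_def by (rule r_into_rtranclp) (simp add: astep_def)

lemma walk_conn:
  assumes "walk f" "range f \<subseteq> S" shows "conn S (f m) (f n)"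
proof -
  have "conn S (f 0) (f n)" for n
  proof (induction n)
    case (Suc n)
    have "conn S (f n) (f (Suc n))"
      using assms(1) by (cases rule: walk_cases[of f n]) (use assms(2) in \<open>auto intro: conn_step\<close>)
    with Suc show ?case by (rule conn_trans)
  qed simp
  then show ?thesis using conn_sym conn_trans by blast
qed

definition good :: "cell set \<Rightarrow> cell \<Rightarrow> bool" where
  "good B v \<longleftrightarrow> (\<exists>R. R 0 = v \<and> (\<forall>n. R n \<in> B \<and> adj (R n) (R (Suc n))) \<and> reach R)"

text \<open>Idle steps are skipped by jumping to the next time \<open>nx n\<close> at which the cell
  is different; it exists since the walk leaves every column for good.\<close>

lemma good_of_walk:
  assumes "walk R" "range R \<subseteq> B" "reach R"
  shows "good B (R 0)"
proof -
  have ex: "\<exists>j. n < j \<and> R j \<noteq> R n" for n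
  proof -
    obtain N where "\<forall>m\<ge>N. fst (R n) < fst (R m)" using properD[OF proper_if_reach[OF assms(3)]] by blast
    then show ?thesis by (intro exI[of _ "max N (Suc n)"]) (metis less_irrefl max.cobounded1 max.cobounded2 Suc_le_lessD)
  qed
  define nx where "nx n = (LEAST j. n < j \<and> R j \<noteq> R n)" for n
  have nx: "n < nx n" "R (nx n) \<noteq> R n" for n using LeastI_ex[OF ex[of n]] by (auto simp: nx_def)
  have eq: "R j = R n" if "n \<le> j" "j < nx n" for j n
    using not_less_Least[of j "\<lambda>j. n < j \<and> R j \<noteq> R n"] that by (auto simp: nx_def le_less)
  have adj: "adj (R n) (R (nx n))" for n
  proof -
    obtain j where j: "nx n = Suc j" using nx(1)[of n] by (cases "nx n") auto
    then have "R j = R n" using eq[of n j] nx(1)[of n] by simp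
    moreover have "R (Suc j) = R j \<or> adj (R j) (R (Suc j))" using assms(1) by (simp add: walk_def)
    ultimately show ?thesis using nx(2)[of n] j by simp
  qed
  define h where "h k = (nx ^^ k) 0" for k
  have h: "h 0 = 0" "h (Suc k) = nx (h k)" for k by (auto simp: h_def)
  have le: "k \<le> h k" for k
  proof (induction k)
    case (Suc k)
    then show ?case using nx(1)[of "h k"] h(2)[of k] by simp
  qed simp
  have "reach (\<lambda>k. R (h k))" unfolding reach_def
  proof
    fix r :: nat
    obtain N where "\<forall>n\<ge>N. R n \<in> quad (int r)" using assms(3) unfolding reach_def by blast
    then show "\<exists>N. \<forall>n\<ge>N. R (h n) \<in> quad (int r)" using le by (meson order_trans)
  qed
  then show ?thesis unfolding good_def using assms(2) adj h by (intro exI[of _ "\<lambda>k. R (h k)"]) auto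
qed

lemma walk_prefix:
  assumes "conn S v (R 0)" "walk R" "range R \<subseteq> S" "reach R"
  shows "\<exists>R'. R' 0 = v \<and> walk R' \<and> range R' \<subseteq> S \<and> reach R'"
  using assms(1)[unfolded conn_def]
proof (induction rule: converse_rtranclp_induct)
  case base
  then show ?case using assms by blast
next
  case (step v y)
  then obtain R' where R': "R' 0 = y" "walk R'" "range R' \<subseteq> S" "reach R'" by blast
  let ?R = "case_nat v R'"
  have "walk ?R" unfolding walk_def
    using step(1) R'(1,2) by (auto simp: walk_def astep_def split: nat.split)
  moreover have "?R n \<in> S" for n using step(1) R'(3) by (cases n) (auto simp: astep_def)
  then have "range ?R \<subseteq> S" by (rule image_subsetI)
  moreover have "reach ?R" unfolding reach_def
  proof
    fix r :: nat
    obtain N where N: "\<forall>n\<ge>N. R' n \<in> quad (int r)" using R'(4) unfolding reach_def by blast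
    show "\<exists>N. \<forall>n\<ge>N. ?R n \<in> quad (int r)"
      by (rule exI[of _ "Suc N"]) (use N in \<open>auto split: nat.split\<close>)
  qed
  ultimately show ?case by (intro exI[of _ ?R]) simp
qed

lemma good_conn:
  assumes "good B v" "conn B v v'" shows "good B v'"
proof -
  obtain R where R: "R 0 = v" "\<forall>n. R n \<in> B \<and> adj (R n) (R (Suc n))" "reach R"
    using assms(1) unfolding good_def by blast
  have "walk R" "range R \<subseteq> B" using R(2) by (auto simp: walk_def)
  then obtain R' where "R' 0 = v'" "walk R'" "range R' \<subseteq> B" "reach R'"
    using walk_prefix[of B v' R] conn_sym[OF assms(2)] R(1,3) by blast
  then show ?thesis using good_of_walk by blast
qed

text \<open>The finite connections are concatenated. The piece with number \<open>k\<close> stays in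
  \<open>quad (int k)\<close>, so the result reaches to +.\<close>

lemma good_of_nested:
  assumes "\<And>k. u k \<in> B \<inter> quad (int k)" "\<And>k. conn (B \<inter> quad (int k)) (u k) (u (Suc k))"
  shows "good B (u 0)"
proof -
  let ?S = "\<lambda>k. B \<inter> quad (int k)"
  have "\<exists>f l. f 0 = u k \<and> f l = u (Suc k) \<and> (\<forall>i<l. astep (?S k) (f i) (f (Suc i)))" for k
    using assms(2)[of k] unfolding conn_def rtranclp_power relpowp_fun_conv by blast
  then obtain f l where f: "\<And>k. f k 0 = u k" "\<And>k. f k (l k) = u (Suc k)"
    "\<And>k i. i < l k \<Longrightarrow> astep (?S k) (f k i) (f k (Suc i))" by metis
  have fS: "f k i \<in> ?S k" if "i \<le> l k" for k i
  proof (cases i)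
    case 0
    then show ?thesis using f(1)[of k] assms(1)[of k] by simp
  next
    case (Suc j)
    then show ?thesis using f(3)[of j k] that by (auto simp: astep_def)
  qed
  \<comment> \<open>A state \<open>(k, i)\<close> stands for cell \<open>i\<close> of piece
    \<open>k\<close>. Passing to the next piece is an idle step, since one piece ends where the next
    begins.\<close>
  define nxt where "nxt = (\<lambda>(k, i). if i < l k then (k, Suc i) else (Suc k, 0))"
  define st where "st n = (nxt ^^ n) (0, 0)" for n
  have st0: "st 0 = (0, 0)" and stS: "st (Suc n) = nxt (st n)" for n by (auto simp: st_def)
  have inv: "snd (st n) \<le> l (fst (st n))" for n
    by (induction n) (auto simp: st0 stS nxt_def split: prod.splits)
  define R where "R n = f (fst (st n)) (snd (st n))" for n
  have "walk R" unfolding walk_def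
  proof
    fix n
    obtain k i where ki: "st n = (k, i)" by (cases "st n")
    show "R (Suc n) = R n \<or> adj (R n) (R (Suc n))"
    proof (cases "i < l k")
      case True
      then show ?thesis using f(3)[of i k] by (simp add: R_def stS ki nxt_def astep_def)
    next
      case False
      then have "i = l k" using inv[of n] ki by simp
      then show ?thesis using f(1)[of "Suc k"] f(2)[of k] by (simp add: R_def stS ki nxt_def)
    qed
  qed
  moreover have RS: "R n \<in> ?S (fst (st n))" for n unfolding R_def by (rule fS[OF inv])
  then have "range R \<subseteq> B" by auto
  moreover have "reach R" unfolding reach_def
  proof
    fix r
    have run: "st n = (k, 0) \<Longrightarrow> i \<le> l k \<Longrightarrow> st (n + i) = (k, i)" for n k i
      by (induction i) (auto simp: stS nxt_def)
    have "\<exists>n. st n = (k, 0)" for k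
    proof (induction k)
      case (Suc k)
      then obtain n where "st n = (k, 0)" by blast
      then have "st (Suc (n + l k)) = (Suc k, 0)" using run[of n k "l k"] by (simp add: stS nxt_def)
      then show ?case by blast
    qed (use st0 in blast)
    then obtain N where N: "st N = (r, 0)" by blast
    have "r \<le> fst (st n)" if "N \<le> n" for n
      using that
    proof (induction rule: dec_induct)
      case (step n)
      then show ?case by (cases "st n") (auto simp: stS nxt_def)
    qed (simp add: N)
    then have "R n \<in> quad (int r)" if "N \<le> n" for n
      using RS[of n] quad_mono[of "int r" "int (fst (st n))"] that by auto
    then show "\<exists>N. \<forall>n\<ge>N. R n \<in> quad (int r)" by blast
  qed
  ultimately have "good B (R 0)" by (intro good_of_walk)
  then show ?thesis using f(1)[of 0] by (simp add: R_def st0)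
qed

section \<open>Interfaces\<close>

text \<open>Rotating \<open>w\<close> about \<open>b\<close> by 60 degrees gives the third cell at an endpoint of the tile edge between
  \<open>b\<close> and \<open>w\<close>. If \<open>b \<in> S\<close> and \<open>w \<notin> S\<close>, the interface between \<open>S\<close> and its complement continues
  there in exactly one way.\<close>

definition cw :: "cell \<Rightarrow> cell" where "cw d = (fst d + snd d, - fst d)"
definition ccw :: "cell \<Rightarrow> cell" where "ccw d = (- snd d, fst d + snd d)"

definition third :: "(cell \<Rightarrow> cell) \<Rightarrow> cell \<times> cell \<Rightarrow> cell" where
  "third rot e = (let d = rot (fst (snd e) - fst (fst e), snd (snd e) - snd (fst e))
     in (fst (fst e) + fst d, snd (fst e) + snd d))"

definition turn :: "(cell \<Rightarrow> cell) \<Rightarrow> cell set \<Rightarrow> cell \<times> cell \<Rightarrow> cell \<times> cell" where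
  "turn rot S e = (if third rot e \<in> S then (third rot e, snd e) else (fst e, third rot e))"

definition edge :: "cell set \<Rightarrow> cell \<times> cell \<Rightarrow> bool" where
  "edge S e \<longleftrightarrow> fst e \<in> S \<and> snd e \<notin> S \<and> adj (fst e) (snd e)"

definition orbit :: "(cell \<Rightarrow> cell) \<Rightarrow> cell set \<Rightarrow> cell \<times> cell \<Rightarrow> nat \<Rightarrow> cell \<times> cell" where
  "orbit rot S e n = (turn rot S ^^ n) e"

definition trail :: "(cell \<Rightarrow> cell) \<Rightarrow> cell set \<Rightarrow> cell \<times> cell \<Rightarrow> nat \<Rightarrow> cell" where
  "trail rot S e n = fst (orbit rot S e n)"

text \<open>One sense of rotation is enough: a closed interface is also closed when traversed
  backwards.\<close>

definition aperiodic :: "cell set \<Rightarrow> cell \<times> cell \<Rightarrow> bool" where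
  "aperiodic S e \<longleftrightarrow> (\<forall>n. orbit cw S e (Suc n) \<noteq> e)"

definition rots :: "((cell \<Rightarrow> cell) \<times> (cell \<Rightarrow> cell)) set" where
  "rots = {(cw, ccw), (ccw, cw)}"

lemma third_adj:
  assumes "(rot, rot') \<in> rots" "adj (fst e) (snd e)"
  shows "adj (fst e) (third rot e)" "adj (third rot e) (snd e)" "adj (snd e) (third rot e)"
proof -
  let ?d = "(fst (snd e) - fst (fst e), snd (snd e) - snd (fst e))"
  have "rot d \<in> dirs" "(fst d - fst (rot d), snd d - snd (rot d)) \<in> dirs" if "d \<in> dirs" for d
    using assms(1) that unfolding rots_def dirs_def
    by (elim insertE emptyE; simp add: cw_def ccw_def)+
  from this[of ?d] assms(2) show "adj (fst e) (third rot e)" "adj (third rot e) (snd e)"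
    unfolding adj_def by (simp_all add: third_def Let_def algebra_simps)
  then show "adj (snd e) (third rot e)" by (rule_tac adj_sym)
qed

lemma edge_turn: "(rot, rot') \<in> rots \<Longrightarrow> edge S e \<Longrightarrow> edge S (turn rot S e)"
  using third_adj[of rot rot' e] by (auto simp: edge_def turn_def)

text \<open>Seen from the new edge and rotating the other way, the third cell is the one just
  replaced, which still belongs to the same side.\<close>

lemma turn_inverse:
  assumes "(rot, rot') \<in> rots" "edge S e" shows "turn rot' S (turn rot S e) = e"
proof -
  obtain b1 b2 w1 w2 where e: "e = ((b1, b2), (w1, w2))" by (metis surj_pair)
  have rot: "rot = cw \<and> rot' = ccw \<or> rot = ccw \<and> rot' = cw" using assms(1) by (simp add: rots_def)
  have S: "(b1, b2) \<in> S" "(w1, w2) \<notin> S" using assms(2) by (simp_all add: e edge_def)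
  show ?thesis using rot
    by (elim disjE conjE; cases "third rot e \<in> S")
      (simp_all add: turn_def, simp_all add: e third_def cw_def ccw_def Let_def S)
qed

lemma orbit_0 [simp]: "orbit rot S e 0 = e" by (simp add: orbit_def)
lemma orbit_Suc: "orbit rot S e (Suc n) = turn rot S (orbit rot S e n)" by (simp add: orbit_def)

lemma orbit_Suc_right: "orbit rot S e (Suc n) = orbit rot S (turn rot S e) n"
  by (simp add: orbit_def funpow_swap1)

lemma edge_orbit: "(rot, rot') \<in> rots \<Longrightarrow> edge S e \<Longrightarrow> edge S (orbit rot S e n)"
  by (induction n) (auto simp: orbit_Suc edge_turn)

lemma orbit_inverse:
  assumes "(rot, rot') \<in> rots" "edge S e"
  shows "orbit rot' S (orbit rot S e (m + k)) m = orbit rot S e k"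
proof (induction m)
  case (Suc m)
  have "orbit rot' S (orbit rot S e (Suc m + k)) (Suc m)
      = orbit rot' S (turn rot' S (turn rot S (orbit rot S e (m + k)))) m"
    unfolding orbit_Suc_right[of rot'] add_Suc orbit_Suc[of rot] ..
  then show ?case
    using turn_inverse[OF assms(1) edge_orbit[OF assms], of "m + k"] Suc by simp
qed simp

lemma aperiodic_orbit:
  assumes "(rot, rot') \<in> rots" "edge S e" "aperiodic S e"
  shows "orbit rot S e (Suc n) \<noteq> e"
proof (cases "rot = cw")
  case False
  then have rot: "rot = ccw" "(ccw, cw) \<in> rots" using assms(1) by (auto simp: rots_def)
  show ?thesis
  proof
    assume "orbit rot S e (Suc n) = e"
    then have "orbit cw S e (Suc n) = e"
      using orbit_inverse[OF rot(2) assms(2), of "Suc n" 0] rot(1) by simp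
    then show False using assms(3) by (simp add: aperiodic_def)
  qed
qed (use assms(3) in \<open>simp add: aperiodic_def\<close>)

text \<open>A coincidence of two times can be traced back to time 0, where it would close the
  interface.\<close>

lemma inj_orbit:
  assumes "(rot, rot') \<in> rots" "edge S e" "aperiodic S e"
  shows "inj (orbit rot S e)"
proof (rule linorder_injI)
  fix m n :: nat assume "m < n"
  then obtain k where n: "n = m + Suc k" using less_imp_Suc_add by auto
  show "orbit rot S e m \<noteq> orbit rot S e n"
    using orbit_inverse[OF assms(1,2), of m "Suc k"] orbit_inverse[OF assms(1,2), of m 0]
      aperiodic_orbit[OF assms, of k] n by auto
qed

lemma walk_trail:
  assumes "(rot, rot') \<in> rots" "edge S e"
  shows "walk (trail rot S e)" "range (trail rot S e) \<subseteq> S" "trail rot S e 0 = fst e"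
proof -
  note edg = edge_orbit[OF assms]
  show "range (trail rot S e) \<subseteq> S" using edg by (auto simp: trail_def edge_def)
  show "walk (trail rot S e)" unfolding walk_def trail_def orbit_Suc
    using third_adj(1)[OF assms(1)] edg by (auto simp: turn_def edge_def)
qed (simp add: trail_def)

text \<open>The columns up to \<open>c\<close> contain only finitely many cells of the
  quarter-plane, hence finitely many edges, and an aperiodic interface passes each edge at most
  once.\<close>

lemma proper_trail:
  assumes "(rot, rot') \<in> rots" "edge S e" "aperiodic S e" "S \<subseteq> quad k"
  shows "proper (trail rot S e)"
  unfolding proper_def
proof
  fix c
  let ?F = "{p \<in> quad k. fst p \<le> c}"
  let ?g = "\<lambda>(b, d). (b, (fst b + fst d, snd b + snd d)) :: cell \<times> cell"
  have "orbit rot S e ` {n. fst (trail rot S e n) \<le> c} \<subseteq> ?g ` (?F \<times> dirs)"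
  proof
    fix y assume "y \<in> orbit rot S e ` {n. fst (trail rot S e n) \<le> c}"
    then obtain n where n: "y = orbit rot S e n" "fst (fst y) \<le> c" by (auto simp: trail_def)
    let ?d = "(fst (snd y) - fst (fst y), snd (snd y) - snd (fst y))"
    have "edge S y" using edge_orbit[OF assms(1,2)] n by simp
    then have "fst y \<in> ?F" "?d \<in> dirs" using n(2) assms(4) by (auto simp: edge_def adj_def)
    then have "(fst y, ?d) \<in> ?F \<times> dirs" by blast
    moreover have "y = ?g (fst y, ?d)" by (simp add: prod_eq_iff)
    ultimately show "y \<in> ?g ` (?F \<times> dirs)" by blast
  qed
  moreover have "finite (?g ` (?F \<times> dirs))" using finite_quad by (auto simp: dirs_def)
  ultimately have "finite (orbit rot S e ` {n. fst (trail rot S e n) \<le> c})" by (rule finite_subset)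
  then show "finite {n. fst (trail rot S e n) \<le> c}"
    using inj_orbit[OF assms(1-3)] by (meson finite_imageD inj_on_subset subset_UNIV)
qed

text \<open>The outer cells of the interface are disjoint from every walk in \<open>S\<close>, so
  they have a well-defined side of it; the cells of \<open>trail\<close> may lie on such a
  walk.\<close>

definition wtrail :: "(cell \<Rightarrow> cell) \<Rightarrow> cell set \<Rightarrow> cell \<times> cell \<Rightarrow> nat \<Rightarrow> cell" where
  "wtrail rot S e n = snd (orbit rot S e n)"

lemma wtrail_adj:
  assumes "(rot, rot') \<in> rots" "edge S e"
  shows "adj (trail rot S e n) (wtrail rot S e n)" "wtrail rot S e n \<notin> S"
  using edge_orbit[OF assms, of n] by (auto simp: trail_def wtrail_def edge_def)

lemma walk_wtrail:
  assumes "(rot, rot') \<in> rots" "edge S e" shows "walk (wtrail rot S e)"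
  unfolding walk_def wtrail_def orbit_Suc
  using third_adj(3)[OF assms(1)] edge_orbit[OF assms] by (auto simp: turn_def edge_def)

lemma wtrail_Xrec:
  assumes "(rot, rot') \<in> rots" "edge S e" "Xrec (trail rot S e)" shows "Xrec (wtrail rot S e)"
proof -
  obtain r where r: "\<forall>N. \<exists>n\<ge>N. xco (trail rot S e n) \<le> int r" using assms(3) unfolding Xrec_def by blast
  have le: "xco (wtrail rot S e n) \<le> xco (trail rot S e n) + 1" for n
    by (rule adj_xco[OF wtrail_adj(1)[OF assms(1,2)]])
  have "\<exists>n\<ge>N. xco (wtrail rot S e n) \<le> int (r + 1)" for N
  proof -
    obtain n where "n \<ge> N" "xco (trail rot S e n) \<le> int r" using r by blast
    then show ?thesis using le[of n] by (intro exI[of _ n]) simp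
  qed
  then show ?thesis unfolding Xrec_def by blast
qed

lemma wtrail_Yrec:
  assumes "(rot, rot') \<in> rots" "edge S e" "Yrec (trail rot S e)" shows "Yrec (wtrail rot S e)"
proof -
  obtain r where r: "\<forall>N. \<exists>n\<ge>N. yco (trail rot S e n) \<le> int r" using assms(3) unfolding Yrec_def by blast
  have le: "yco (wtrail rot S e n) \<le> yco (trail rot S e n) + 2" for n
    by (rule adj_yco[OF wtrail_adj(1)[OF assms(1,2)]])
  have "\<exists>n\<ge>N. yco (wtrail rot S e n) \<le> int (r + 2)" for N
  proof -
    obtain n where "n \<ge> N" "yco (trail rot S e n) \<le> int r" using r by blast
    then show ?thesis using le[of n] by (intro exI[of _ n]) simp
  qed
  then show ?thesis unfolding Yrec_def by blast
qed

lemma proper_wtrail: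
  assumes "(rot, rot') \<in> rots" "edge S e" "proper (trail rot S e)" shows "proper (wtrail rot S e)"
  unfolding proper_def
proof
  fix c
  have le: "fst (trail rot S e n) \<le> fst (wtrail rot S e n) + 1" for n
    using adj_fst[OF wtrail_adj(1)[OF assms(1,2)], of n] by linarith
  have "{n. fst (wtrail rot S e n) \<le> c} \<subseteq> {n. fst (trail rot S e n) \<le> c + 1}"
    by (rule Collect_mono) (use le order_trans add_right_mono in blast)
  then show "finite {n. fst (wtrail rot S e n) \<le> c}"
    by (rule finite_subset) (use assms(3) in \<open>simp add: proper_def\<close>)
qed

lemma reach_if_not_rec: assumes "\<not> Xrec p" "\<not> Yrec p" shows "reach p"
  unfolding reach_def
proof
  fix r :: nat
  obtain M where M: "\<forall>n\<ge>M. \<not> xco (p n) \<le> int r" using assms(1) unfolding Xrec_def by blast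
  obtain N where N: "\<forall>n\<ge>N. \<not> yco (p n) \<le> int r" using assms(2) unfolding Yrec_def by blast
  show "\<exists>N. \<forall>n\<ge>N. p n \<in> quad (int r)"
    by (rule exI[of _ "max M N"]) (use M N in \<open>force simp: quad_def\<close>)
qed

text \<open>By \<open>side_far\<close> all far cells with bounded \<open>xco\<close> are above
  \<open>p\<close>, and \<open>u\<close> visits such cells infinitely often.\<close>

lemma recurrent_side:
  assumes "walk p" "proper p" "\<not> Xrec p" "proper u" "Xrec u"
  shows "\<exists>n\<ge>N. side p (u n)"
proof -
  obtain r where r: "\<forall>N. \<exists>n\<ge>N. xco (u n) \<le> int r" using assms(5) unfolding Xrec_def by blast
  obtain c where c: "\<forall>t. c < fst t \<and> xco t \<le> int r \<longrightarrow> side p t" using side_far[OF assms(1-3)] by blast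
  obtain M where M: "\<forall>n\<ge>M. c < fst (u n)" using properD[OF assms(4)] by blast
  obtain n where n: "n \<ge> max M N" "xco (u n) \<le> int r" using r by blast
  then have "n \<ge> N" "c < fst (u n)" using M by auto
  then show ?thesis using c n(2) by blast
qed

lemma recurrent_not_side:
  assumes "\<not> Yrec p" "proper u" "Yrec u"
  shows "\<exists>n\<ge>N. \<not> side p (u n)"
proof -
  obtain r where r: "\<forall>N. \<exists>n\<ge>N. yco (u n) \<le> int r" using assms(3) unfolding Yrec_def by blast
  obtain c where c: "\<forall>t. c < fst t \<and> yco t \<le> int r \<longrightarrow> \<not> side p t" using not_side_far[OF assms(1)] by blast
  obtain M where M: "\<forall>n\<ge>M. c < fst (u n)" using properD[OF assms(2)] by blast
  obtain n where n: "n \<ge> max M N" "yco (u n) \<le> int r" using r by blast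
  then have "n \<ge> N" "c < fst (u n)" using M by auto
  then show ?thesis using c n(2) by blast
qed

section \<open>Characterization of the cells joined to infinity\<close>

definition lev :: "cell set \<Rightarrow> nat \<Rightarrow> cell set" where
  "lev B k = B \<inter> quad (int k)"

definition by_interface :: "cell set \<Rightarrow> cell \<Rightarrow> bool" where
  "by_interface B v \<longleftrightarrow> (\<exists>k e. edge (lev B k) e \<and> conn B v (fst e) \<and>
     (reach (trail cw (lev B k) e) \<or> reach (trail ccw (lev B k) e)))"

definition straddling :: "cell set \<Rightarrow> nat \<Rightarrow> cell \<Rightarrow> bool" where
  "straddling B k v \<longleftrightarrow> (\<exists>e. edge (lev B k) e \<and> conn B v (fst e) \<and> aperiodic (lev B k) e \<and>
     Xrec (trail cw (lev B k) e) \<and> Yrec (trail ccw (lev B k) e))"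

definition tame :: "cell set \<Rightarrow> bool" where
  "tame B \<longleftrightarrow> (\<forall>k e. edge (lev B k) e \<and> aperiodic (lev B k) e \<longrightarrow>
     \<not> (Xrec (trail cw (lev B k) e) \<and> Yrec (trail cw (lev B k) e)) \<and>
     \<not> (Xrec (trail ccw (lev B k) e) \<and> Yrec (trail ccw (lev B k) e)))"

lemma lev_mono: "j \<le> k \<Longrightarrow> lev B k \<subseteq> lev B j"
  using quad_mono[of "int j" "int k"] by (auto simp: lev_def)

lemma lev_subset: "lev B k \<subseteq> B" "lev B k \<subseteq> quad (int k)"
  by (auto simp: lev_def)

lemma rots_cw: "(cw, ccw) \<in> rots" and rots_ccw: "(ccw, cw) \<in> rots"
  by (auto simp: rots_def)

lemma good_if_by_interface: assumes "by_interface B v" shows "good B v"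
proof -
  obtain k e rot where e: "edge (lev B k) e" "conn B v (fst e)" "rot = cw \<or> rot = ccw"
    "reach (trail rot (lev B k) e)" using assms unfolding by_interface_def by blast
  then obtain rot' where rot: "(rot, rot') \<in> rots" by (auto simp: rots_def)
  have "good B (trail rot (lev B k) e 0)"
    using walk_trail[OF rot e(1)] e(4) lev_subset(1) by (intro good_of_walk) blast+
  then show ?thesis using good_conn[OF _ conn_sym[OF e(2)]] walk_trail(3)[OF rot e(1)] by simp
qed

text \<open>In a tame set the interface of a straddling component is of this kind. The notion is
  monotone in \<open>S\<close>, so walks from different levels can be compared in the coarser
  one.\<close>

definition lpath :: "cell set \<Rightarrow> (nat \<Rightarrow> cell) \<Rightarrow> (nat \<Rightarrow> cell) \<Rightarrow> bool" where
  "lpath S f g \<longleftrightarrow> walk f \<and> walk g \<and> proper f \<and> proper g \<and> f 0 = g 0 \<and> range f \<subseteq> S \<and> range g \<subseteq> S \<and>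
     Xrec f \<and> \<not> Xrec g"

lemma lpathD:
  assumes "lpath S f g"
  shows "walk f" "proper f" "walk g" "proper g" "f 0 = g 0" "range f \<subseteq> S" "range g \<subseteq> S" "Xrec f" "\<not> Xrec g"
  using assms unfolding lpath_def by blast+

lemma lpath_conn_range:
  assumes "lpath S f g" "z \<in> range f \<union> range g" shows "conn S (f 0) z"
proof -
  note f = lpathD[OF assms(1)]
  show ?thesis
    using assms(2) walk_conn[OF f(1,6), of 0] walk_conn[OF f(3,7), of 0] f(5) by auto
qed

text \<open>The walk \<open>f'\<close> returns to bounded \<open>xco\<close> and thereby gets above
  \<open>g\<close>; not being beyond, it is then also above \<open>f\<close>. So \<open>f\<close> is
  eventually not above \<open>f'\<close>, whereas by its own recurrence it gets above
  \<open>g'\<close>.\<close>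

lemma lpath_beyond:
  assumes "lpath S f g" "lpath S f' g'" "(range f \<union> range g) \<inter> (range f' \<union> range g') = {}"
    and "\<not> beyond f g (f' 0)"
  shows "beyond f' g' (f 0)"
proof -
  note f = lpathD[OF assms(1)] and f' = lpathD[OF assms(2)]
  have dis: "range f' \<inter> (range f \<union> range g) = {}" "range f \<inter> (range f' \<union> range g') = {}"
    "range f \<inter> range f' = {}" using assms(3) by auto
  note const = beyond_walk[OF f(1-5) f'(1) dis(1)] and const' = beyond_walk[OF f'(1-5) f(1) dis(2)]
  have "\<exists>n\<ge>N. side f (f' n)" for N
  proof -
    obtain n where "n \<ge> N" "side g (f' n)" using recurrent_side[OF f(3,4,9) f'(2,8)] by blast
    moreover have "side f (f' n) \<longleftrightarrow> side g (f' n)"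
      using const[of n] assms(4) beyond_side[of f g, OF f(5)] by blast
    ultimately show ?thesis by blast
  qed
  then have "\<forall>N. \<exists>n\<ge>N. side f (f' n)" by blast
  then obtain M where M: "\<forall>m\<ge>M. \<not> side f' (f m)"
    using side_antisym(1)[OF f(1,2) f'(1,2) dis(3)] by blast
  obtain m where "m \<ge> M" "side g' (f m)" using recurrent_side[OF f'(3,4,9) f(2,8)] by blast
  then have "beyond f' g' (f m)" using M beyond_side[of f' g', OF f'(5)] by blast
  then show ?thesis using const' by blast
qed

text \<open>The region beyond the walk lies inside the quarter-plane and can be left only across the
  walk. A connection in \<open>B\<close> that starts there thus remains in level \<open>k\<close>
  until it joins the component of the walk.\<close>

lemma lpath_beyond_conn:
  assumes "lpath (lev B k) f g" "conn B p (f 0)" "beyond f g p"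
  shows "conn (lev B k) (f 0) p"
proof (rule ccontr)
  note f = lpathD[OF assms(1)] and rng = lpath_conn_range[OF assms(1)]
  assume p: "\<not> conn (lev B k) (f 0) p"
  have quad: "range f \<union> range g \<subseteq> quad (int k)" using f(6,7) lev_subset(2) by (meson Un_least order_trans)
  have "\<not> conn (lev B k) (f 0) z \<and> beyond f g z" if "conn B p z" for z
    using that[unfolded conn_def]
  proof (induction rule: rtranclp_induct)
    case (step z z')
    then have z: "\<not> conn (lev B k) (f 0) z" "beyond f g z" "z \<in> B" "z' \<in> B" "adj z z'" by (auto simp: astep_def)
    have "z \<in> quad (int k)" using not_beyond_outside[OF f(1-5) quad] z(2) by blast
    then have zl: "z \<in> lev B k" using z(3) by (simp add: lev_def)
    have z': "\<not> conn (lev B k) (f 0) z'"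
    proof
      assume c: "conn (lev B k) (f 0) z'"
      moreover have "f 0 \<in> lev B k" using f(6) by blast
      ultimately have "z' \<in> lev B k" by (rule conn_mem)
      then have "conn (lev B k) z' z" using zl adj_sym[OF z(5)] by (intro conn_step)
      then show False using c z(1) conn_trans by blast
    qed
    have "beyond f g z \<longleftrightarrow> beyond f g z'"
      by (rule beyond_adj[OF f(1-5) z(5)]) (use z(1) z' rng in blast)+
    then show ?case using z z' by blast
  qed (use p assms(3) in blast)
  then show False using assms(2) conn_refl by blast
qed

lemma lpath_conn:
  assumes "lpath (lev B k) f g" "lpath (lev B k) f' g'" "conn B (f 0) (f' 0)"
  shows "conn (lev B k) (f 0) (f' 0)"
proof (rule ccontr)
  note rng = lpath_conn_range[OF assms(1)] and rng' = lpath_conn_range[OF assms(2)]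
  assume n: "\<not> conn (lev B k) (f 0) (f' 0)"
  have dis: "(range f \<union> range g) \<inter> (range f' \<union> range g') = {}"
  proof (rule equals0I)
    fix z assume "z \<in> (range f \<union> range g) \<inter> (range f' \<union> range g')"
    then have "conn (lev B k) (f 0) z" "conn (lev B k) (f' 0) z" using rng rng' by blast+
    then show False using n conn_trans[OF _ conn_sym] by blast
  qed
  show False
  proof (cases "beyond f g (f' 0)")
    case True
    then show False using lpath_beyond_conn[OF assms(1) conn_sym[OF assms(3)]] n by blast
  next
    case False
    then have "beyond f' g' (f 0)" by (rule lpath_beyond[OF assms(1,2) dis])
    then show False using lpath_beyond_conn[OF assms(2,3)] n conn_sym by blast
  qed
qed

lemma lpath_if_straddling:
  assumes "tame B" "straddling B k v" "j \<le> k"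
  shows "\<exists>f g. lpath (lev B j) f g \<and> conn B v (f 0) \<and> f 0 \<in> lev B j"
proof -
  obtain e where e: "edge (lev B k) e" "conn B v (fst e)" "aperiodic (lev B k) e"
    "Xrec (trail cw (lev B k) e)" "Yrec (trail ccw (lev B k) e)"
    using assms(2) unfolding straddling_def by blast
  have "\<not> Xrec (trail ccw (lev B k) e)" using assms(1) e unfolding tame_def by blast
  then have "lpath (lev B j) (trail cw (lev B k) e) (trail ccw (lev B k) e)"
    using walk_trail[OF rots_cw e(1)] walk_trail[OF rots_ccw e(1)] e lev_mono[OF assms(3), of B]
      proper_trail[OF rots_cw e(1,3) lev_subset(2)] proper_trail[OF rots_ccw e(1,3) lev_subset(2)]
    unfolding lpath_def by auto
  moreover have "trail cw (lev B k) e 0 \<in> lev B j"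
    using e(1) lev_mono[OF assms(3), of B] by (auto simp: trail_def edge_def)
  ultimately show ?thesis using e(2) walk_trail(3)[OF rots_cw e(1)] by metis
qed

text \<open>The walks chosen for \<open>j\<close> and \<open>Suc j\<close> are both of the required
  kind in level \<open>j\<close> and belong to the cluster of \<open>v\<close>, so
  \<open>lpath_conn\<close> joins them inside level \<open>j\<close>. Infinitely many levels are
  assumed because the pigeonhole principle delivers no more.\<close>

lemma good_if_straddling:
  assumes "tame B" "infinite {k. straddling B k v}"
  shows "good B v"
proof -
  have "\<exists>f g. lpath (lev B j) f g \<and> conn B v (f 0) \<and> f 0 \<in> lev B j \<and>
    (\<forall>f' g'. lpath (lev B (Suc j)) f' g' \<longrightarrow> lpath (lev B j) f' g')" for j
  proof -
    obtain k where "j \<le> k" "straddling B k v" using assms(2) unfolding infinite_nat_iff_unbounded_le by blast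
    moreover have "lpath (lev B (Suc j)) f' g' \<longrightarrow> lpath (lev B j) f' g'" for f' g'
      using lev_mono[of j "Suc j" B] unfolding lpath_def by auto
    ultimately show ?thesis using lpath_if_straddling[OF assms(1)] by blast
  qed
  then obtain f g where f: "\<And>j. lpath (lev B j) (f j) (g j)" "\<And>j. conn B v (f j 0)" "\<And>j. f j 0 \<in> lev B j"
    "\<And>j. lpath (lev B j) (f (Suc j)) (g (Suc j))" by metis
  have "conn (lev B j) (f j 0) (f (Suc j) 0)" for j
    by (rule lpath_conn[OF f(1,4) conn_trans[OF conn_sym[OF f(2)] f(2)]])
  then have "good B (f 0 0)" using f(3) by (intro good_of_nested) (auto simp: lev_def)
  then show ?thesis by (rule good_conn[OF _ conn_sym[OF f(2)]])
qed

lemma goodE: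
  assumes "good B v"
  obtains R where "R 0 = v" "walk R" "range R \<subseteq> B" "reach R"
  using assms unfolding good_def walk_def by blast

lemma good_tail:
  assumes "good B v"
  obtains R where "conn B v (R 0)" "walk R" "range R \<subseteq> lev B k" "reach R"
proof -
  obtain R where R: "R 0 = v" "walk R" "range R \<subseteq> B" "reach R" using goodE[OF assms] by blast
  obtain N where N: "\<forall>n\<ge>N. R n \<in> quad (int k)" using R(4) unfolding reach_def by blast
  show thesis
  proof (rule that[of "\<lambda>n. R (N + n)"])
    show "conn B v (R (N + 0))" using walk_conn[OF R(2,3), of 0] R(1) by simp
    show "walk (\<lambda>n. R (N + n))" by (rule walk_shift[OF R(2)])
    show "range (\<lambda>n. R (N + n)) \<subseteq> lev B k" using R(3) N by (auto simp: lev_def)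
    show "reach (\<lambda>n. R (N + n))" using R(4) unfolding reach_def by (meson le_add2 order_trans trans_le_add2)
  qed
qed

text \<open>The outer cells avoid a tail of the path contained in the level, hence stay eventually
  on one side of it; the two recurrences would put them on either side infinitely often.\<close>

lemma tame_if_good: assumes "good B v" shows "tame B"
proof -
  have *: "\<not> (Xrec (trail rot (lev B k) e) \<and> Yrec (trail rot (lev B k) e))"
    if rot: "(rot, rot') \<in> rots" and e: "edge (lev B k) e" "aperiodic (lev B k) e" for k e rot rot'
  proof
    assume rec: "Xrec (trail rot (lev B k) e) \<and> Yrec (trail rot (lev B k) e)"
    obtain R where R: "walk R" "range R \<subseteq> lev B k" "reach R" using good_tail[OF assms] by blast
    let ?w = "wtrail rot (lev B k) e"
    note pR = proper_if_reach[OF R(3)] and nR = not_rec_if_reach[OF R(3)]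
    have pw: "proper ?w" by (rule proper_wtrail[OF rot e(1) proper_trail[OF rot e lev_subset(2)]])
    have off: "?w n \<notin> range R" for n using wtrail_adj(2)[OF rot e(1), of n] R(2) by (rule contra_subsetD[rotated])
    have dis: "range R \<inter> range ?w = {}"
    proof (rule equals0I)
      fix z assume z: "z \<in> range R \<inter> range ?w"
      then obtain n where "z = ?w n" by (elim IntE rangeE)
      then show False using off[of n] z by simp
    qed
    obtain N where N: "\<forall>n\<ge>N. side R (?w n) \<longleftrightarrow> side R (?w N)"
      using eventually_side_const[OF R(1) pR walk_wtrail[OF rot e(1)] pw dis] by blast
    obtain n where "n \<ge> N" "side R (?w n)"
      using recurrent_side[OF R(1) pR nR(1) pw wtrail_Xrec[OF rot e(1)]] rec by blast
    moreover obtain m where "m \<ge> N" "\<not> side R (?w m)"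
      using recurrent_not_side[OF nR(2) pw wtrail_Yrec[OF rot e(1)]] rec by blast
    ultimately show False using N by blast
  qed
  show ?thesis unfolding tame_def using *[OF rots_cw] *[OF rots_ccw] by blast
qed

text \<open>If the interface avoids \<open>R\<close>, one of its ends is above the far part of
  \<open>R\<close> and the other below, so \<open>R\<close> and in particular \<open>v\<close> lie
  beyond it. Then the interface has a cell in the column of \<open>v\<close>, and that column meets
  \<open>quad 0\<close> in a finite set independent of \<open>k\<close>.\<close>

lemma straddling_bound_if_good:
  assumes "good B v"
  shows "\<exists>M. finite M \<and> (\<forall>k u. straddling B k u \<longrightarrow> (\<exists>m\<in>M. conn B m u))"
proof -
  obtain R where R: "R 0 = v" "walk R" "range R \<subseteq> B" "reach R" using goodE[OF assms] by blast
  note pR = proper_if_reach[OF R(4)] and nR = not_rec_if_reach[OF R(4)]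
  let ?M = "insert v {p \<in> quad 0. fst p \<le> fst v}"
  have "\<exists>m\<in>?M. conn B m u" if straddling: "straddling B k u" for k u
  proof -
    obtain e where e: "edge (lev B k) e" "conn B u (fst e)" "aperiodic (lev B k) e"
      "Xrec (trail cw (lev B k) e)" "Yrec (trail ccw (lev B k) e)"
      using straddling unfolding straddling_def by blast
    let ?f = "trail cw (lev B k) e" and ?g = "trail ccw (lev B k) e"
    note wf = walk_trail[OF rots_cw e(1)] and wg = walk_trail[OF rots_ccw e(1)]
    note pf = proper_trail[OF rots_cw e(1,3) lev_subset(2)] and pg = proper_trail[OF rots_ccw e(1,3) lev_subset(2)]
    have cu: "conn B z u" if "z \<in> range ?f \<union> range ?g" for z
    proof -
      have "conn (lev B k) (fst e) z"
        using that walk_conn[OF wf(1,2), of 0] walk_conn[OF wg(1,2), of 0] wf(3) wg(3) by auto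
      then show ?thesis using conn_mono[OF _ lev_subset(1)] e(2) conn_trans conn_sym by blast
    qed
    show ?thesis
    proof (cases "range R \<inter> (range ?f \<union> range ?g) = {}")
      case False
      then obtain n where "R n \<in> range ?f \<union> range ?g" by blast
      then have "conn B v u" using walk_conn[OF R(2,3), of 0 n] R(1) cu conn_trans by metis
      then show ?thesis by blast
    next
      case True
      then have dis: "range R \<inter> range ?f = {}" "range R \<inter> range ?g = {}" by auto
      have "\<forall>N. \<exists>n\<ge>N. side R (?f n)" using recurrent_side[OF R(2) pR nR(1) pf e(4)] by blast
      then obtain M1 where M1: "\<forall>m\<ge>M1. \<not> side ?f (R m)"
        using side_antisym(1)[OF R(2) pR wf(1) pf dis(1)] by blast
      have "\<forall>N. \<exists>n\<ge>N. \<not> side R (?g n)" using recurrent_not_side[OF nR(2) pg e(5)] by blast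
      then obtain M2 where M2: "\<forall>m\<ge>M2. side ?g (R m)"
        using side_antisym(2)[OF R(2) pR wg(1) pg dis(2)] by blast
      have fg: "?f 0 = ?g 0" using wf(3) wg(3) by simp
      have "beyond ?f ?g (R (max M1 M2))" unfolding beyond_side[of ?f ?g, OF fg] using M1 M2 by auto
      then have "beyond ?f ?g v" using beyond_walk[OF wf(1) pf wg(1) pg fg R(2) True] R(1) by blast
      then obtain t where t: "t \<in> range ?f \<union> range ?g" "fst t = fst v"
        using not_beyond_below[of ?f ?g v] by blast
      then have "t \<in> quad (int k)" using wf(2) wg(2) lev_subset(2) by blast
      then have "t \<in> ?M" using t(2) quad_mono[of 0 "int k"] by auto
      then show ?thesis using cu[OF t(1)] by blast
    qed
  qed
  moreover have "finite ?M" using finite_quad by simp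
  ultimately show ?thesis by blast
qed

lemma finite_ex_least:
  fixes f :: "'a \<Rightarrow> int"
  assumes "finite T" "t \<in> T" shows "\<exists>t\<in>T. \<forall>t'\<in>T. f t \<le> f t'"
proof -
  have "T \<noteq> {}" using assms(2) by blast
  then show ?thesis
    using arg_min_if_finite(1)[OF assms(1)] arg_min_least[OF assms(1)]
    by (intro bexI[of _ "arg_min_on f T"] ballI)
qed

lemma lexicographic_least:
  assumes "v0 \<in> E" "E \<subseteq> quad n"
  shows "\<exists>v\<in>E. \<forall>p\<in>E. fst v \<le> fst p \<and> (fst p = fst v \<longrightarrow> snd v \<le> snd p)"
proof -
  let ?F = "{p \<in> E. fst p \<le> fst v0}"
  have fin: "finite ?F" by (rule finite_subset[OF _ finite_quad[of n "fst v0"]]) (use assms(2) in auto)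
  have "v0 \<in> ?F" using assms(1) by simp
  then obtain a where a: "a \<in> ?F" "\<forall>p\<in>?F. fst a \<le> fst p"
    using finite_ex_least[OF fin, of v0 fst] by blast
  let ?G = "{p \<in> ?F. fst p = fst a}"
  have fin': "finite ?G" by (rule finite_subset[OF _ fin]) auto
  have "a \<in> ?G" using a(1) by simp
  then obtain v where v: "v \<in> ?G" "\<forall>p\<in>?G. snd v \<le> snd p"
    using finite_ex_least[OF fin', of a snd] by blast
  have "fst v \<le> fst p \<and> (fst p = fst v \<longrightarrow> snd v \<le> snd p)" if "p \<in> E" for p
  proof (intro conjI impI)
    have va: "fst v = fst a" "fst a \<le> fst v0" using v(1) a(1) by simp_all
    show "fst v \<le> fst p"
    proof (cases "fst p \<le> fst v0")
      case True
      then have "p \<in> ?F" using that by simp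
      then show ?thesis using bspec[OF a(2)] va by simp
    qed (use va in linarith)
    assume "fst p = fst v"
    then have "p \<in> ?G" using that va by simp
    then show "snd v \<le> snd p" by (rule bspec[OF v(2)])
  qed
  then show ?thesis using v(1) by blast
qed

text \<open>Starting at the lexicographically least cell of the component puts the ray that prolongs
  \<open>R\<close> outside the component. The two ends of the interface leave on different sides of
  the prolonged path, and their outer cells cannot change sides without coming back to the initial
  edge.\<close>

lemma straddling_if_good:
  assumes "good B v0" "\<not> by_interface B v0"
  shows "straddling B k v0"
proof -
  let ?S = "lev B k"
  obtain R0 where R0: "conn B v0 (R0 0)" "walk R0" "range R0 \<subseteq> ?S" "reach R0"
    using good_tail[OF assms(1)] by blast
  let ?E = "{p. conn ?S (R0 0) p}"
  have R0S: "R0 0 \<in> ?S" using R0(3) by blast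
  have ES: "?E \<subseteq> ?S" using conn_mem[OF _ R0S] by blast
  obtain v where v: "v \<in> ?E" "\<forall>p\<in>?E. fst v \<le> fst p \<and> (fst p = fst v \<longrightarrow> snd v \<le> snd p)"
    using lexicographic_least[of "R0 0" ?E "int k"] ES lev_subset(2) by (metis (no_types, lifting) conn_refl mem_Collect_eq order_trans)
  have vE: "conn ?S v p \<Longrightarrow> fst v \<le> fst p \<and> (fst p = fst v \<longrightarrow> snd v \<le> snd p)" for p
    using v conn_trans by blast
  have vS: "v \<in> ?S" using v(1) ES by blast
  obtain R where R: "R 0 = v" "walk R" "range R \<subseteq> ?S" "reach R"
    using walk_prefix[OF _ R0(2-4), of v] v(1) conn_sym by blast
  note pR = proper_if_reach[OF R(4)] and nR = not_rec_if_reach[OF R(4)]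
  have RE: "fst v \<le> fst (R n) \<and> (fst (R n) = fst v \<longrightarrow> snd v \<le> snd (R n))" for n
    using vE walk_conn[OF R(2,3), of 0 n] R(1) by metis
  have nbr: "p \<notin> ?S" if "adj v p" "fst p < fst v \<or> fst p = fst v \<and> snd p < snd v" for p
    using vE[of p] conn_step[OF vS _ that(1)] that(2) by force
  \<comment> \<open>The outer cell is the first cell of the ray prolonging \<open>R\<close>; one
    turn in either direction leads to outer cells on different sides.\<close>
  define e where "e = (v, (fst v - 1, snd v))"
  have "adj v (fst v - 1, snd v)" by (simp add: adj_def dirs_def)
  then have e: "edge ?S e" unfolding edge_def e_def using vS nbr by simp
  have cw1: "orbit cw ?S e 1 = (v, (fst v - 1, snd v + 1))"
  proof -
    have "third cw e = (fst v - 1, snd v + 1)" by (simp add: third_def e_def cw_def)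
    moreover have "(fst v - 1, snd v + 1) \<notin> ?S" by (rule nbr) (auto simp: adj_def dirs_def)
    ultimately show ?thesis by (simp add: orbit_def turn_def e_def)
  qed
  have ccw1: "orbit ccw ?S e 1 = (v, (fst v, snd v - 1))"
  proof -
    have "third ccw e = (fst v, snd v - 1)" by (simp add: third_def e_def ccw_def)
    moreover have "(fst v, snd v - 1) \<notin> ?S" by (rule nbr) (auto simp: adj_def dirs_def)
    ultimately show ?thesis by (simp add: orbit_def turn_def e_def)
  qed
  have side_const: "side R (wtrail rot ?S e n) \<longleftrightarrow> side R (wtrail rot ?S e 1)"
    if rot: "(rot, rot') \<in> rots" and ret: "\<And>m. 1 \<le> m \<Longrightarrow> m \<le> n \<Longrightarrow> orbit rot ?S e m \<noteq> e" and "1 \<le> n"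
    for rot rot' n
  proof -
    have off: "wtrail rot ?S e m \<notin> range R \<and> \<not> (fst (wtrail rot ?S e m) < fst (R 0) \<and> snd (wtrail rot ?S e m) = snd (R 0))"
      if m: "1 \<le> m" "m \<le> n" for m
    proof (intro conjI notI)
      show "wtrail rot ?S e m \<in> range R \<Longrightarrow> False"
        using subsetD[OF R(3)] wtrail_adj(2)[OF rot e, of m] by (rule notE[rotated])
      assume w: "fst (wtrail rot ?S e m) < fst (R 0) \<and> snd (wtrail rot ?S e m) = snd (R 0)"
      have "conn ?S v (trail rot ?S e m)"
        using walk_conn[OF walk_trail(1,2)[OF rot e], of 0 m] walk_trail(3)[OF rot e] by (simp add: e_def)
      note b = vE[OF this]
      \<comment> \<open>An outer cell on the ray is adjacent to a cell of the component; minimality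
        of \<open>v\<close> leaves only the initial edge.\<close>
      have "fst (wtrail rot ?S e m) = fst v - 1 \<and> fst (trail rot ?S e m) = fst v \<and> snd (trail rot ?S e m) = snd v"
        using wtrail_adj(1)[OF rot e, of m] by (rule adj_cases) (use b w R(1) in \<open>auto simp: prod_eq_iff\<close>)
      then have "orbit rot ?S e m = e"
        using w R(1) by (simp add: e_def prod_eq_iff trail_def wtrail_def)
      then show False using ret[OF m] by blast
    qed
    show ?thesis using \<open>1 \<le> n\<close> ret off
    proof (induction n rule: dec_induct)
      case (step n)
      have "side R (wtrail rot ?S e n) \<longleftrightarrow> side R (wtrail rot ?S e (Suc n))"
        using walk_wtrail[OF rot e]
      proof (cases rule: walk_cases[of _ n])
        case 2
        show ?thesis by (rule side_adj[OF R(2) pR 2]) (use step.prems(2)[of n] step.prems(2)[of "Suc n"] step.hyps in auto)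
      qed simp
      then show ?case using step by simp
    qed simp
  qed
  have side_cw1: "side R (wtrail cw ?S e 1)"
  proof -
    have "snd (fst v - 1, snd v + 1) \<le> snd (R n)" if "fst (R n) = fst (fst v - 1, snd v + 1)" for n
      using RE[of n] that by simp
    then have "lcross R (fst v - 1, snd v + 1) = {}" by (rule lcross_empty)
    then show ?thesis using R(1) cw1 by (simp add: wtrail_def side_def)
  qed
  have side_ccw1: "\<not> side R (wtrail ccw ?S e 1)"
  proof -
    have "snd (fst v, snd v - 1) \<le> snd (R n)" if "fst (R n) = fst (fst v, snd v - 1)" for n
      using RE[of n] that by simp
    then have "lcross R (fst v, snd v - 1) = {}" by (rule lcross_empty)
    then show ?thesis using R(1) ccw1 by (simp add: wtrail_def side_def)
  qed
  have ap: "aperiodic ?S e" unfolding aperiodic_def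
  proof (rule ccontr)
    assume "\<not> (\<forall>n. orbit cw ?S e (Suc n) \<noteq> e)"
    then have ex: "\<exists>n. orbit cw ?S e (Suc n) = e" by blast
    define n where "n = (LEAST n. orbit cw ?S e (Suc n) = e)"
    have n: "orbit cw ?S e (Suc n) = e" unfolding n_def by (rule LeastI_ex[OF ex])
    have least: "orbit cw ?S e (Suc m) \<noteq> e" if "m < n" for m
      using not_less_Least[OF that[unfolded n_def]] .
    have "orbit cw ?S e 1 \<noteq> e" unfolding cw1 by (simp add: e_def)
    then have "n \<noteq> 0" using n by (intro notI) simp
    \<comment> \<open>Just before closing up, the interface is at the edge that the opposite
      rotation reaches first, whose outer cell is on the other side of \<open>R\<close>.\<close>
    have "turn ccw ?S e = orbit cw ?S e n"
      using turn_inverse[OF rots_cw edge_orbit[OF rots_cw e, of n]] n by (simp add: orbit_Suc)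
    then have "wtrail cw ?S e n = wtrail ccw ?S e 1" by (simp add: wtrail_def orbit_def)
    moreover have "orbit cw ?S e m \<noteq> e" if "1 \<le> m" "m \<le> n" for m
      using least[of "m - 1"] that by simp
    then have "side R (wtrail cw ?S e n) \<longleftrightarrow> side R (wtrail cw ?S e 1)"
      using side_const[OF rots_cw, of n] \<open>n \<noteq> 0\<close> by simp
    ultimately show False using side_cw1 side_ccw1 by simp
  qed
  have ret: "orbit rot ?S e m \<noteq> e" if "(rot, rot') \<in> rots" "1 \<le> m" for rot rot' m
    using aperiodic_orbit[OF that(1) e ap, of "m - 1"] that(2) by simp
  have pw: "proper (wtrail rot ?S e)" if "(rot, rot') \<in> rots" for rot rot'
    by (rule proper_wtrail[OF that e proper_trail[OF that e ap lev_subset(2)]])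
  have "conn ?S (R0 0) v" using v(1) by simp
  then have "conn B (R0 0) v" by (rule conn_mono[OF _ lev_subset(1)])
  then have cv: "conn B v0 (fst e)" using conn_trans[OF R0(1)] by (simp add: e_def)
  then have nreach: "\<not> reach (trail cw ?S e)" "\<not> reach (trail ccw ?S e)"
    using assms(2) e unfolding by_interface_def by blast+
  \<comment> \<open>The outer cells of this end stay above \<open>R\<close>, while recurrence to a
    bounded height would bring one of them below.\<close>
  have "\<not> Yrec (trail cw ?S e)"
  proof
    assume "Yrec (trail cw ?S e)"
    then obtain n where "n \<ge> 1" "\<not> side R (wtrail cw ?S e n)"
      using recurrent_not_side[OF nR(2) pw[OF rots_cw] wtrail_Yrec[OF rots_cw e]] by blast
    then show False using side_const[OF rots_cw ret[OF rots_cw], of n] side_cw1 by simp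
  qed
  then have X: "Xrec (trail cw ?S e)" using reach_if_not_rec nreach(1) by blast
  have "\<not> Xrec (trail ccw ?S e)"
  proof
    assume "Xrec (trail ccw ?S e)"
    then obtain n where "n \<ge> 1" "side R (wtrail ccw ?S e n)"
      using recurrent_side[OF R(2) pR nR(1) pw[OF rots_ccw] wtrail_Xrec[OF rots_ccw e]] by blast
    then show False using side_const[OF rots_ccw ret[OF rots_ccw], of n] side_ccw1 by simp
  qed
  then have "Yrec (trail ccw ?S e)" using reach_if_not_rec nreach(2) by blast
  then show ?thesis unfolding straddling_def using e cv ap X by blast
qed

section \<open>Both directions from one cluster\<close>

definition pcode :: "cell \<Rightarrow> nat" where
  "pcode z = prod_encode (int_encode (fst z), int_encode (snd z))"

definition pdec :: "nat \<Rightarrow> cell" where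
  "pdec n = (int_decode (pfst n), int_decode (psnd n))"

lemma pdec_pcode [simp]: "pdec (pcode z) = z" and pcode_pdec [simp]: "pcode (pdec n) = n"
  by (simp_all add: pdec_def pcode_def)

text \<open>Finitely many clusters contain the straddling components of all levels. The finite set
  is given by a bound on codes, so that it costs a single number quantifier.\<close>

definition anchored :: "cell set \<Rightarrow> bool" where
  "anchored B \<longleftrightarrow> (\<exists>M. \<forall>k u. straddling B k (pdec u) \<longrightarrow> (\<exists>m. m \<le> M \<and> conn B (pdec m) (pdec u)))"

lemma good_iff: "good B v \<longleftrightarrow> by_interface B v \<or> tame B \<and> (\<forall>k. straddling B k v)"
proof
  assume "good B v"
  then show "by_interface B v \<or> tame B \<and> (\<forall>k. straddling B k v)"
    using straddling_if_good tame_if_good by blast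
next
  assume "by_interface B v \<or> tame B \<and> (\<forall>k. straddling B k v)"
  then show "good B v"
  proof
    assume "tame B \<and> (\<forall>k. straddling B k v)"
    then show ?thesis by (intro good_if_straddling) auto
  qed (rule good_if_by_interface)
qed

lemma anchored_if_good: assumes "good B v" shows "anchored B"
proof -
  obtain M where M: "finite M" "\<forall>k u. straddling B k u \<longrightarrow> (\<exists>m\<in>M. conn B m u)"
    using straddling_bound_if_good[OF assms] by blast
  have "\<exists>m. m \<le> Max (pcode ` M) \<and> conn B (pdec m) (pdec u)" if straddling: "straddling B k (pdec u)" for k u
  proof -
    obtain m where "m \<in> M" "conn B m (pdec u)" using M(2) straddling by blast
    then show ?thesis using M(1) by (intro exI[of _ "pcode m"]) simp
  qed
  then show ?thesis unfolding anchored_def by blast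
qed

lemma straddling_conn: "straddling B k v \<Longrightarrow> conn B u v \<Longrightarrow> straddling B k u"
  unfolding straddling_def using conn_trans by blast

text \<open>One level alone yields no path; \<open>anchored\<close> is included because it makes the
  witnesses found at different levels comparable.\<close>

definition good_approx :: "nat \<Rightarrow> cell set \<Rightarrow> cell \<Rightarrow> bool" where
  "good_approx k B v \<longleftrightarrow> by_interface B v \<or> tame B \<and> anchored B \<and> straddling B k v"

lemma good_approx_if_good: "good B v \<Longrightarrow> good_approx k B v"
  unfolding good_approx_def using good_iff anchored_if_good by blast

text \<open>By \<open>anchored\<close> each \<open>v k\<close> is joined to one of finitely many
  representatives, and one of these serves infinitely many \<open>k\<close>. It straddles all those
  levels, and its mirror image inherits from \<open>- v k\<close> either an interface reaching to +
  or the straddling at infinitely many levels.\<close>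

lemma both_good_if_straddling:
  assumes "infinite K" "\<And>k. k \<in> K \<Longrightarrow> straddling B k (v k)" "tame B" "anchored B"
    and "\<And>k. good_approx k B' (- v k)"
    and "\<And>u w. conn B u w \<Longrightarrow> conn B' (- u) (- w)"
  shows "\<exists>v. good B v \<and> good B' (- v)"
proof -
  obtain M where M: "\<forall>k u. straddling B k (pdec u) \<longrightarrow> (\<exists>m. m \<le> M \<and> conn B (pdec m) (pdec u))"
    using assms(4) unfolding anchored_def by blast
  have "\<exists>m. m \<le> M \<and> conn B (pdec m) (v k)" if "k \<in> K" for k
    using M[rule_format, of k "pcode (v k)"] assms(2)[OF that] by simp
  then obtain m where m: "\<And>k. k \<in> K \<Longrightarrow> m k \<le> M \<and> conn B (pdec (m k)) (v k)" by metis
  have "finite (m ` K)" by (rule finite_subset[of _ "{..M}"]) (use m in auto)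
  then obtain k0 where "k0 \<in> K" "infinite {k \<in> K. m k = m k0}"
    using pigeonhole_infinite[OF assms(1), of m] by blast
  then obtain c where c: "infinite {k \<in> K. m k = c}" by blast
  let ?K = "{k \<in> K. m k = c}" and ?u = "pdec c"
  have conn: "conn B ?u (v k)" if "k \<in> ?K" for k using m that by auto
  have "?K \<subseteq> {k. straddling B k ?u}" using conn assms(2) straddling_conn by blast
  then have "good B ?u" using c good_if_straddling[OF assms(3)] finite_subset by blast
  moreover have "good B' (- ?u)"
  proof (cases "\<exists>k\<in>?K. by_interface B' (- v k)")
    case True
    then obtain k where k: "k \<in> ?K" "by_interface B' (- v k)" by blast
    show ?thesis
      by (rule good_conn[OF good_if_by_interface[OF k(2)] conn_sym[OF assms(6)[OF conn[OF k(1)]]]])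
  next
    case False
    then have *: "tame B'" "straddling B' k (- v k)" if "k \<in> ?K" for k
      using assms(5)[of k] that unfolding good_approx_def by blast+
    have "?K \<noteq> {}" using c by (metis finite.emptyI)
    then have "tame B'" using *(1) by blast
    moreover have "?K \<subseteq> {k. straddling B' k (- ?u)}"
      using *(2) straddling_conn[OF _ assms(6)[OF conn]] by blast
    ultimately show ?thesis using c good_if_straddling finite_subset by blast
  qed
  ultimately show ?thesis by blast
qed

lemma conn_minus: assumes "conn B u w" shows "conn {z. - z \<in> B} (- u) (- w)"
  using assms[unfolded conn_def]
proof (induction rule: rtranclp_induct)
  case (step y z)
  then have "conn {z. - z \<in> B} (- y) (- z)" by (intro conn_step) (auto simp: astep_def adj_minus)
  with step.IH show ?case by (rule conn_trans)
qed simp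

lemma both_good_iff:
  "(\<exists>v. good B v \<and> good {z. - z \<in> B} (- v)) \<longleftrightarrow>
   (\<forall>k. \<exists>v. good_approx k B v \<and> good_approx k {z. - z \<in> B} (- v))"
proof
  show "\<exists>v. good B v \<and> good {z. - z \<in> B} (- v) \<Longrightarrow>
      \<forall>k. \<exists>v. good_approx k B v \<and> good_approx k {z. - z \<in> B} (- v)"
    using good_approx_if_good by blast
next
  let ?B = "{z. - z \<in> B}"
  assume "\<forall>k. \<exists>v. good_approx k B v \<and> good_approx k ?B (- v)"
  then obtain v where v: "\<And>k. good_approx k B (v k)" "\<And>k. good_approx k ?B (- v k)" by metis
  show "\<exists>v. good B v \<and> good ?B (- v)"
  proof (cases "\<exists>k. by_interface B (v k) \<and> by_interface ?B (- v k)")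
    case True
    then show ?thesis using good_if_by_interface by blast
  next
    case False
    let ?K = "{k. tame B \<and> anchored B \<and> straddling B k (v k)}"
    let ?K' = "{k. tame ?B \<and> anchored ?B \<and> straddling ?B k (- v k)}"
    \<comment> \<open>No level is settled by interfaces in both directions, so each has a straddling
      witness in \<open>B\<close> or in its mirror image, and one of the two cases occurs infinitely
      often.\<close>
    have "k \<in> ?K \<union> ?K'" for k using False v(1)[of k] v(2)[of k] unfolding good_approx_def by blast
    then have "?K \<union> ?K' = UNIV" by blast
    then have "infinite (?K \<union> ?K')" by (simp only: infinite_UNIV_nat not_False_eq_True)
    then have "infinite ?K \<or> infinite ?K'" by (simp only: finite_Un de_Morgan_conj)
    then consider "infinite ?K" | "infinite ?K'" by blast
    then show ?thesis
    proof cases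
      case 1
      then have "?K \<noteq> {}" by (metis finite.emptyI)
      then show ?thesis using v(2) conn_minus
        by (intro both_good_if_straddling[OF 1]) auto
    next
      case 2
      then have "?K' \<noteq> {}" by (metis finite.emptyI)
      moreover have "conn B (- u) (- w)" if "conn ?B u w" for u w using conn_minus[OF that] by simp
      ultimately have "\<exists>v. good ?B v \<and> good B (- v)" using v(1)
        by (intro both_good_if_straddling[OF 2, where v = "\<lambda>k. - v k"]) auto
      then show ?thesis by (metis minus_minus)
    qed
  qed
qed

section \<open>The tiling in lattice coordinates\<close>

lemma hex_vertex_values:
  "hex_vertex a c ` {..<6} = (\<lambda>u. c + a *\<^sub>R u) `
     {(1, 0), (1/2, sqrt 3/2), (-1/2, sqrt 3/2), (-1, 0), (-1/2, -(sqrt 3/2)), (1/2, -(sqrt 3/2))}"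
proof -
  have trig: "cos (2 * pi / 3) = - (1/2)" "sin (2 * pi / 3) = sqrt 3 / 2"
    "cos (4 * pi / 3) = - (1/2)" "sin (4 * pi / 3) = - (sqrt 3 / 2)"
    "cos (5 * pi / 3) = 1/2" "sin (5 * pi / 3) = - (sqrt 3 / 2)"
  proof -
    have "2 * pi / 3 = pi - pi / 3" "4 * pi / 3 = pi / 3 + pi" "5 * pi / 3 = - (pi / 3) + 2 * pi"
      by (simp_all add: field_simps)
    then show "cos (2 * pi / 3) = - (1/2)" "sin (2 * pi / 3) = sqrt 3 / 2"
      "cos (4 * pi / 3) = - (1/2)" "sin (4 * pi / 3) = - (sqrt 3 / 2)"
      "cos (5 * pi / 3) = 1/2" "sin (5 * pi / 3) = - (sqrt 3 / 2)"
      by (simp_all only: cos_periodic_pi sin_periodic_pi cos_periodic sin_periodic cos_minus sin_minus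
          cos_60 sin_60 cos_pi_minus sin_pi_minus)
  qed
  have "{..<6::nat} = {0, 1, 2, 3, 4, 5}" by auto
  then show ?thesis by (simp add: hex_vertex_def trig cos_60 sin_60)
qed

lemma hexagon_translation: "(\<lambda>z. v + z) ` hexagon a c = hexagon a (v + c)"
proof -
  have "hex_vertex a (v + c) ` {..<6} = (\<lambda>z. v + z) ` (hex_vertex a c ` {..<6})"
    unfolding image_image by (intro image_cong) (simp_all add: hex_vertex_def add.assoc)
  then show ?thesis unfolding hexagon_def by (simp only: convex_hull_translation)
qed

lemma hexagon_ne: "hexagon a c \<noteq> {}"
  unfolding hexagon_def by (simp add: lessThan_empty_iff)

text \<open>A nonzero translation \<open>v\<close> cannot preserve a nonempty compact set, because
  it increases the maximum of the inner product with \<open>v\<close>.\<close>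

lemma hexagon_inject: "hexagon a c = hexagon a c' \<longleftrightarrow> c = c'"
proof
  assume eq: "hexagon a c = hexagon a c'"
  define v where "v = c' - c"
  have "compact (hexagon a c)" unfolding hexagon_def by (intro compact_convex_hull finite_imp_compact) simp
  then obtain z where z: "z \<in> hexagon a c" "\<forall>y\<in>hexagon a c. v \<bullet> y \<le> v \<bullet> z"
    using continuous_attains_sup[OF _ hexagon_ne, of a c "\<lambda>z. v \<bullet> z"] continuous_on_inner[OF continuous_on_const continuous_on_id]
    by blast
  have "v + z \<in> (\<lambda>z. v + z) ` hexagon a c" using z(1) by blast
  then have "v + z \<in> hexagon a c" unfolding hexagon_translation using eq by (simp add: v_def)
  then have "v \<bullet> (v + z) \<le> v \<bullet> z" by (rule bspec[OF z(2)])
  then have "v \<bullet> v \<le> 0" unfolding inner_add_right by linarith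
  then have "v \<bullet> v = 0" using inner_ge_zero[of v] by linarith
  then have "v = 0" by (simp only: inner_eq_zero_iff)
  then show "c = c'" by (simp add: v_def)
qed simp

lemma hexagon_cball: "a > 0 \<Longrightarrow> hexagon a c \<subseteq> cball c a"
  unfolding hexagon_def
proof (intro hull_minimal image_subsetI)
  fix k assume "a > 0"
  have "dist c (hex_vertex a c k) = norm (a *\<^sub>R (cos (real k * pi / 3), sin (real k * pi / 3)))"
    by (simp add: hex_vertex_def dist_norm del: scaleR_Pair)
  also have "\<dots> = a" unfolding norm_scaleR norm_Pair using \<open>a > 0\<close> by simp
  finally show "hex_vertex a c k \<in> cball c a" by simp
qed simp

text \<open>The line \<open>n \<bullet> z = b\<close> contains the affine hull of the two points,
  and the hull of the remaining ones lies strictly on one side.\<close>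

lemma convex_hull_edge_of:
  fixes P Q n :: "'a::euclidean_space"
  assumes "finite V" "P \<in> V" "Q \<in> V" "P \<noteq> Q" "n \<bullet> P = b" "n \<bullet> Q = b"
    and "\<And>z. z \<in> V \<Longrightarrow> z \<noteq> P \<Longrightarrow> z \<noteq> Q \<Longrightarrow> n \<bullet> z < b"
  shows "(convex hull {P, Q}) edge_of (convex hull V)"
  unfolding edge_of_def
proof
  have "affine hull {P, Q} \<subseteq> {z. n \<bullet> z = b}"
    by (rule hull_minimal) (use assms in \<open>auto intro: affine_hyperplane\<close>)
  moreover have "convex hull (V - {P, Q}) \<subseteq> {z. n \<bullet> z < b}"
    by (rule hull_minimal) (use assms in \<open>auto intro: convex_halfspace_lt\<close>)
  ultimately have "affine hull {P, Q} \<inter> convex hull (V - {P, Q}) = {}" by auto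
  then show "(convex hull {P, Q}) face_of (convex hull V)"
    by (intro face_of_convex_hulls) (use assms in auto)
  show "aff_dim (convex hull {P, Q}) = 1" using assms(4) by (simp add: aff_dim_convex_hull aff_dim_2)
qed

text \<open>The vectors \<open>n\<close> are the outer normals of length 2, for which the edges of
  the unit hexagon lie on \<open>n \<bullet> u = sqrt 3\<close>.\<close>

lemma hexagon_edge_of:
  fixes u u' n :: point
  assumes "a > 0"
    and "(u, u', n) \<in> {((1, 0), (1/2, sqrt 3/2), (sqrt 3, 1)), ((1/2, sqrt 3/2), (-1/2, sqrt 3/2), (0, 2)),
      ((-1/2, sqrt 3/2), (-1, 0), (- sqrt 3, 1)), ((-1, 0), (-1/2, -(sqrt 3/2)), (- sqrt 3, -1)),
      ((-1/2, -(sqrt 3/2)), (1/2, -(sqrt 3/2)), (0, -2)), ((1/2, -(sqrt 3/2)), (1, 0), (sqrt 3, -1))}"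
  shows "(convex hull {c + a *\<^sub>R u, c + a *\<^sub>R u'}) edge_of hexagon a c"
proof -
  let ?U = "{(1, 0), (1/2, sqrt 3/2), (-1/2, sqrt 3/2), (-1, 0), (-1/2, -(sqrt 3/2)), (1/2, -(sqrt 3/2))} :: point set"
  have U: "u \<in> ?U" "u' \<in> ?U" "u \<noteq> u'" "n \<bullet> u = sqrt 3" "n \<bullet> u' = sqrt 3"
    using assms(2) by auto
  have lt: "n \<bullet> z < sqrt 3" if "z \<in> ?U" "z \<noteq> u" "z \<noteq> u'" for z
    using assms(2) that by (elim insertE emptyE) (simp_all, (auto)?)
  show ?thesis unfolding hexagon_def hex_vertex_values
  proof (rule convex_hull_edge_of[where n = n and b = "n \<bullet> c + a * sqrt 3"])
    fix z assume z: "z \<in> (\<lambda>u. c + a *\<^sub>R u) ` ?U" "z \<noteq> c + a *\<^sub>R u" "z \<noteq> c + a *\<^sub>R u'"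
    then obtain y where y: "y \<in> ?U" "z = c + a *\<^sub>R y" by blast
    then have "n \<bullet> y < sqrt 3" using lt z by blast
    then show "n \<bullet> z < n \<bullet> c + a * sqrt 3" using y(2) assms(1) by (simp add: inner_add_right)
  qed (use U assms(1) in \<open>auto simp: inner_add_right\<close>)
qed

section \<open>Adjacency of tiles in lattice coordinates\<close>

lemma hex_centre_diff:
  "hex_centre a p i' j' = hex_centre a p i j +
     (3 / 2 * a * of_int (i' - i), sqrt 3 / 2 * a * of_int ((i' - i) + 2 * (j' - j)))"
  by (rule prod_eqI) (simp_all add: hex_centre_def field_simps)

lemma hex_centre_inject:
  "a > 0 \<Longrightarrow> hex_centre a p i j = hex_centre a p i' j' \<longleftrightarrow> i = i' \<and> j = j'"
  unfolding hex_centre_diff[of a p i' j' i j] by (auto simp: prod_eq_iff)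

lemma adjacent_sym: "adjacent t t' \<Longrightarrow> adjacent t' t"
  by (auto simp: adjacent_def)

text \<open>Tiles with a common point have centres at distance at most \<open>2 * a\<close>. The
  squared distance is \<open>3 * a^2\<close> times the form \<open>m^2 + m * n + n^2\<close>, so the
  form is at most 1, and it equals 1 exactly at the six listed displacements. For the converse three
  common edges are exhibited, and symmetry gives the others.\<close>

lemma adjacent_hexagon:
  assumes "a > 0"
  shows "adjacent (hexagon a (hex_centre a p i j)) (hexagon a (hex_centre a p i' j')) \<longleftrightarrow>
    (i' - i, j' - j) \<in> {(1, 0), (0, 1), (1, -1), (-1, 0), (0, -1), (-1, 1)}"
proof
  let ?c = "hex_centre a p i j" and ?c' = "hex_centre a p i' j'"
  assume ad: "adjacent (hexagon a ?c) (hexagon a ?c')"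
  then have ne: "?c \<noteq> ?c'" unfolding adjacent_def hexagon_inject by (rule conjunct1)
  from ad obtain e where e: "e edge_of hexagon a ?c" "e edge_of hexagon a ?c'"
    unfolding adjacent_def by (elim conjE exE)
  have "e \<noteq> {}" using e(1) by (auto simp: edge_of_def)
  then obtain z where "z \<in> hexagon a ?c" "z \<in> hexagon a ?c'"
    using e by (meson edge_of_imp_subset equals0I subsetD)
  then have "z \<in> cball ?c a" "z \<in> cball ?c' a" using subsetD[OF hexagon_cball[OF assms]] by metis+
  then have "dist ?c z \<le> a" "dist ?c' z \<le> a" by (simp_all only: mem_cball)
  then have "dist ?c ?c' \<le> 2 * a" using dist_triangle2[of ?c ?c' z] by linarith
  then have "(norm (?c' - ?c))\<^sup>2 \<le> (2 * a)\<^sup>2"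
    by (intro power_mono) (simp_all add: dist_norm norm_minus_commute)
  moreover define m n where "m = i' - i" and "n = j' - j"
  have "(norm (?c' - ?c))\<^sup>2 = (3 / 2 * a * of_int m)\<^sup>2 + (sqrt 3 / 2 * a * of_int (m + 2 * n))\<^sup>2"
    unfolding hex_centre_diff[of a p i' j' i j] m_def n_def add_diff_cancel_left' power2_norm_eq_inner
    by (simp only: inner_Pair inner_real_def power2_eq_square)
  also have "\<dots> = 3 * a\<^sup>2 * of_int (m\<^sup>2 + m * n + n\<^sup>2)"
    by (simp add: power_mult_distrib power_divide field_simps power2_eq_square)
  finally have "3 * a\<^sup>2 * of_int (m\<^sup>2 + m * n + n\<^sup>2) \<le> 4 * a\<^sup>2" by (simp add: power_mult_distrib)
  then have "(a\<^sup>2) * (3 * of_int (m\<^sup>2 + m * n + n\<^sup>2)) \<le> a\<^sup>2 * 4" by (simp only: ac_simps)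
  then have "3 * real_of_int (m\<^sup>2 + m * n + n\<^sup>2) \<le> 4" using assms by (simp only: mult_le_cancel_left) simp
  then have "real_of_int (3 * (m\<^sup>2 + m * n + n\<^sup>2)) \<le> real_of_int 4"
    by (simp only: of_int_mult of_int_numeral)
  then have "3 * (m\<^sup>2 + m * n + n\<^sup>2) \<le> 4" by (simp only: of_int_le_iff)
  then have mn: "m\<^sup>2 + m * n + n\<^sup>2 \<le> 1" by presburger
  \<comment> \<open>Completing the square in four times the form bounds each coordinate
    separately.\<close>
  have "(2 * m + n)\<^sup>2 + 3 * n\<^sup>2 \<le> 4" "(2 * n + m)\<^sup>2 + 3 * m\<^sup>2 \<le> 4"
    using mn by (simp_all add: power2_eq_square algebra_simps)
  then have "n\<^sup>2 \<le> 1" "m\<^sup>2 \<le> 1"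
    using zero_le_power2[of "2 * m + n"] zero_le_power2[of "2 * n + m"] by linarith+
  then have "n \<in> {-1, 0, 1}" "m \<in> {-1, 0, 1}" by (auto simp: abs_square_le_1)
  moreover have "\<not> (m = 0 \<and> n = 0)" using ne by (auto simp: m_def n_def)
  ultimately show "(i' - i, j' - j) \<in> {(1, 0), (0, 1), (1, -1), (-1, 0), (0, -1), (-1, 1)}"
    using mn unfolding m_def[symmetric] n_def[symmetric] by auto
next
  have half: "adjacent (hexagon a (hex_centre a p i j)) (hexagon a (hex_centre a p i' j'))"
    if "(i' - i, j' - j) \<in> {(1, 0), (0, 1), (1, -1)}" for i j i' j'
  proof -
    let ?c = "hex_centre a p i j" and ?c' = "hex_centre a p i' j'"
    have ne: "hexagon a ?c \<noteq> hexagon a ?c'"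
      using that assms by (auto simp: hexagon_inject hex_centre_inject)
    note diff = hex_centre_diff[of a p i' j' i j]
    show ?thesis using that unfolding adjacent_def
    proof (elim insertE emptyE)
      assume "(i' - i, j' - j) = (1, 0)"
      then have ij: "i' - i = 1" "j' - j = 0" by simp_all
      have "?c + a *\<^sub>R (1, 0) = ?c' + a *\<^sub>R (-1/2, -(sqrt 3/2))"
        "?c + a *\<^sub>R (1/2, sqrt 3/2) = ?c' + a *\<^sub>R (-1, 0)"
        unfolding diff ij by (simp_all add: prod_eq_iff field_simps)
      then show "hexagon a ?c \<noteq> hexagon a ?c' \<and> (\<exists>e. e edge_of hexagon a ?c \<and> e edge_of hexagon a ?c')"
        using ne hexagon_edge_of[OF assms, of "(1, 0)" "(1/2, sqrt 3/2)" "(sqrt 3, 1)" ?c]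
          hexagon_edge_of[OF assms, of "(-1, 0)" "(-1/2, -(sqrt 3/2))" "(- sqrt 3, -1)" ?c']
        by (auto simp: insert_commute)
    next
      assume "(i' - i, j' - j) = (0, 1)"
      then have ij: "i' - i = 0" "j' - j = 1" by simp_all
      have "?c + a *\<^sub>R (1/2, sqrt 3/2) = ?c' + a *\<^sub>R (1/2, -(sqrt 3/2))"
        "?c + a *\<^sub>R (-1/2, sqrt 3/2) = ?c' + a *\<^sub>R (-1/2, -(sqrt 3/2))"
        unfolding diff ij by (simp_all add: prod_eq_iff field_simps)
      then show "hexagon a ?c \<noteq> hexagon a ?c' \<and> (\<exists>e. e edge_of hexagon a ?c \<and> e edge_of hexagon a ?c')"
        using ne hexagon_edge_of[OF assms, of "(1/2, sqrt 3/2)" "(-1/2, sqrt 3/2)" "(0, 2)" ?c]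
          hexagon_edge_of[OF assms, of "(-1/2, -(sqrt 3/2))" "(1/2, -(sqrt 3/2))" "(0, -2)" ?c']
        by (auto simp: insert_commute)
    next
      assume "(i' - i, j' - j) = (1, -1)"
      then have ij: "i' - i = 1" "j' - j = -1" by simp_all
      have "?c + a *\<^sub>R (1/2, -(sqrt 3/2)) = ?c' + a *\<^sub>R (-1, 0)"
        "?c + a *\<^sub>R (1, 0) = ?c' + a *\<^sub>R (-1/2, sqrt 3/2)"
        unfolding diff ij by (simp_all add: prod_eq_iff field_simps)
      then show "hexagon a ?c \<noteq> hexagon a ?c' \<and> (\<exists>e. e edge_of hexagon a ?c \<and> e edge_of hexagon a ?c')"
        using ne hexagon_edge_of[OF assms, of "(1/2, -(sqrt 3/2))" "(1, 0)" "(sqrt 3, -1)" ?c]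
          hexagon_edge_of[OF assms, of "(-1/2, sqrt 3/2)" "(-1, 0)" "(- sqrt 3, 1)" ?c']
        by (auto simp: insert_commute)
    qed
  qed
  assume "(i' - i, j' - j) \<in> {(1, 0), (0, 1), (1, -1), (-1, 0), (0, -1), (-1, 1)}"
  then have "(i' - i, j' - j) \<in> {(1, 0), (0, 1), (1, -1)} \<or> (i - i', j - j') \<in> {(1, 0), (0, 1), (1, -1)}"
    by auto
  then show "adjacent (hexagon a (hex_centre a p i j)) (hexagon a (hex_centre a p i' j'))"
    using half[of i' i j' j] half[of i i' j j'] adjacent_sym by blast
qed

lemma diagonal_hexagon:
  assumes "a > 0" "diagonal (hex_tiling a p) d"
  shows "\<exists>i0 j0. \<forall>n. d n = hexagon a (hex_centre a p (i0 + n) j0)"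
proof -
  have "\<exists>i j. d n = hexagon a (hex_centre a p i j)" for n
    using assms(2) unfolding diagonal_def hex_tiling_def by blast
  then obtain I J where d: "\<And>n. d n = hexagon a (hex_centre a p (I n) (J n))" by metis
  have step: "I n = I (n - 1) + 1 \<and> J n = J (n - 1)" for n
  proof -
    let ?i = "I (n - 1)" and ?j = "J (n - 1)"
    have "northeast_neighbour (d (n - 1)) (d n)" using assms(2) unfolding diagonal_def by blast
    then obtain v where ad: "adjacent (d (n - 1)) (d n)" and v: "fst v > 0" "snd v > 0"
      "d n = (\<lambda>z. v + z) ` d (n - 1)" unfolding northeast_neighbour_def by blast
    have "hex_centre a p (I n) (J n) = v + hex_centre a p ?i ?j"
      using v(3) unfolding d hexagon_translation hexagon_inject .
    then have "v = (3 / 2 * a * of_int (I n - ?i), sqrt 3 / 2 * a * of_int ((I n - ?i) + 2 * (J n - ?j)))"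
      unfolding hex_centre_diff[of a p "I n" "J n" ?i ?j] by (metis add.commute add_left_cancel)
    then have pos: "0 < 3 / 2 * a * of_int (I n - ?i)" "0 < sqrt 3 / 2 * a * of_int ((I n - ?i) + 2 * (J n - ?j))"
      using v(1,2) by simp_all
    \<comment> \<open>Among the six displacements only \<open>(1, 0)\<close> satisfies both
      inequalities.\<close>
    have "I n - ?i > 0" "(I n - ?i) + 2 * (J n - ?j) > 0"
      using zero_less_mult_pos[OF pos(1)] zero_less_mult_pos[OF pos(2)] assms(1) of_int_0_less_iff by force+
    moreover have "(I n - ?i, J n - ?j) \<in> {(1, 0), (0, 1), (1, -1), (-1, 0), (0, -1), (-1, 1)}"
      using ad unfolding d adjacent_hexagon[OF assms(1)] .
    ultimately show ?thesis by auto
  qed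
  have IJ: "I n = I 0 + n \<and> J n = J 0" for n
  proof (induction n rule: int_induct[where k = 0])
    case (step1 n)
    then show ?case using step[of "n + 1"] by simp
  next
    case (step2 n)
    then show ?case using step[of n] by simp
  qed simp
  have "d n = hexagon a (hex_centre a p (I 0 + n) (J 0))" for n
    unfolding d using IJ[of n] by metis
  then show ?thesis by blast
qed

definition cell_tile :: "real \<Rightarrow> point \<Rightarrow> int \<Rightarrow> int \<Rightarrow> cell \<Rightarrow> tile" where
  "cell_tile a p i0 j0 z = hexagon a (hex_centre a p (i0 - snd z) (j0 + fst z + snd z))"

lemma cell_tile_inject: "a > 0 \<Longrightarrow> cell_tile a p i0 j0 z = cell_tile a p i0 j0 z' \<longleftrightarrow> z = z'"
  by (cases z; cases z') (auto simp: cell_tile_def hexagon_inject hex_centre_inject)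

lemma range_cell_tile: "range (cell_tile a p i0 j0) = hex_tiling a p"
proof -
  have "hexagon a (hex_centre a p i j) = cell_tile a p i0 j0 (j - j0 + (i - i0), i0 - i)" for i j
    by (simp add: cell_tile_def)
  then show ?thesis unfolding hex_tiling_def
  proof (intro equalityI subsetI)
    fix t assume "t \<in> range (cell_tile a p i0 j0)"
    then show "t \<in> {hexagon a (hex_centre a p i j) |i j. True}" unfolding cell_tile_def by blast
  qed blast
qed

lemma adjacent_cell_tile:
  assumes "a > 0" shows "adjacent (cell_tile a p i0 j0 z) (cell_tile a p i0 j0 z') \<longleftrightarrow> adj z z'"
proof -
  have "(u, v) \<in> dirs \<longleftrightarrow> (- v, u + v) \<in> {(1, 0), (0, 1), (1, -1), (-1, 0), (0, -1), (-1, 1)}" for u v :: int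
    unfolding dirs_def by simp smt
  from this[of "fst z' - fst z" "snd z' - snd z"]
  have "adj z z' \<longleftrightarrow> (snd z - snd z', fst z' - fst z + (snd z' - snd z)) \<in>
      {(1, 0), (0, 1), (1, -1), (-1, 0), (0, -1), (-1, 1)}"
    unfolding adj_def by simp
  then show ?thesis unfolding cell_tile_def adjacent_hexagon[OF assms] by (simp add: algebra_simps)
qed

lemma Q_cell_tile:
  assumes "a > 0" "\<And>n. d n = hexagon a (hex_centre a p (i0 + n) j0)"
  shows "cell_tile a p i0 j0 z \<in> Q_plus (hex_tiling a p) d n \<longleftrightarrow> z \<in> quad n"
    and "cell_tile a p i0 j0 z \<in> Q_minus (hex_tiling a p) d n \<longleftrightarrow> - z \<in> quad (- n)"
proof -
  let ?v = "(3 / 2 * a * of_int (xco z - n), sqrt 3 / 2 * a * of_int (yco z - n))"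
  have "hex_centre a p (i0 - snd z) (j0 + fst z + snd z) = ?v + hex_centre a p (i0 + n) j0"
    unfolding hex_centre_diff[of a p "i0 - snd z" _ "i0 + n" j0]
    by (rule prod_eqI) (simp_all add: xco_def yco_def field_simps)
  then have tv: "cell_tile a p i0 j0 z = (\<lambda>z. v + z) ` d n \<longleftrightarrow> v = ?v" for v
    unfolding cell_tile_def assms(2) hexagon_translation hexagon_inject by auto
  have inT: "cell_tile a p i0 j0 z \<in> hex_tiling a p" using range_cell_tile by blast
  have *: "cell_tile a p i0 j0 z \<in> Q_plus (hex_tiling a p) d n \<longleftrightarrow> ?v \<in> {0..} \<times> {0..}"
    "cell_tile a p i0 j0 z \<in> Q_minus (hex_tiling a p) d n \<longleftrightarrow> ?v \<in> {..0} \<times> {..0}"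
    unfolding Q_plus_def Q_minus_def mem_Collect_eq tv using inT by blast+
  have sgn: "0 \<le> c * r \<longleftrightarrow> 0 \<le> r" "c * r \<le> 0 \<longleftrightarrow> r \<le> 0" if "c > 0" for c r :: real
    using that by (auto simp: zero_le_mult_iff mult_le_0_iff)
  have pos: "3 / 2 * a > 0" "sqrt 3 / 2 * a > 0" using assms(1) by simp_all
  show "cell_tile a p i0 j0 z \<in> Q_plus (hex_tiling a p) d n \<longleftrightarrow> z \<in> quad n"
    unfolding *(1) mem_Times_iff fst_conv snd_conv atLeast_iff sgn[OF pos(1)] sgn[OF pos(2)]
    by (simp add: quad_def)
  show "cell_tile a p i0 j0 z \<in> Q_minus (hex_tiling a p) d n \<longleftrightarrow> - z \<in> quad (- n)"
    unfolding *(2) mem_Times_iff fst_conv snd_conv atMost_iff sgn[OF pos(1)] sgn[OF pos(2)]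
    by (auto simp: quad_def xco_def yco_def)
qed

text \<open>Reflection in the centre of \<open>d 0\<close> turns a path reaching to - into one
  reaching to +, so both halves become instances of \<open>good\<close>.\<close>

lemma winning_iff_good:
  assumes "a > 0" "\<And>n. d n = hexagon a (hex_centre a p (i0 + n) j0)"
  shows "winning_for_black (hex_tiling a p) d x \<longleftrightarrow>
    (\<exists>v. good {z. x (cell_tile a p i0 j0 z)} v \<and> good {z. x (cell_tile a p i0 j0 (- z))} (- v))"
proof -
  let ?T = "hex_tiling a p" and ?t = "cell_tile a p i0 j0"
  note Q = Q_cell_tile[OF assms]
  have bp: "black_path ?T x (\<lambda>n. ?t (R n)) \<longleftrightarrow> (\<forall>n. x (?t (R n)) \<and> adj (R n) (R (Suc n)))" for R
    using range_cell_tile[of a p i0 j0] adjacent_cell_tile[OF assms(1)]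
    by (auto simp: black_path_def inf_path_def)
  have path: "\<exists>R. t = (\<lambda>n. ?t (R n))" if "black_path ?T x t" for t
  proof -
    have "\<forall>n. \<exists>z. t n = ?t z" using that range_cell_tile[of a p i0 j0]
      unfolding black_path_def inf_path_def by (metis rangeE)
    then show ?thesis by metis
  qed
  have rp: "reaches (Q_plus ?T d) (\<lambda>n. ?t (R n)) \<longleftrightarrow> reach R" for R
  proof
    show "reaches (Q_plus ?T d) (\<lambda>n. ?t (R n)) \<Longrightarrow> reach R"
      unfolding reaches_def reach_def Q(1) by blast
    assume r: "reach R"
    show "reaches (Q_plus ?T d) (\<lambda>n. ?t (R n))" unfolding reaches_def Q(1)
    proof
      fix n
      obtain N where "\<forall>j\<ge>N. R j \<in> quad (int (nat n))" using r unfolding reach_def by blast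
      moreover have "quad (int (nat n)) \<subseteq> quad n" by (rule quad_mono) simp
      ultimately show "\<exists>i. \<forall>j\<ge>i. R j \<in> quad n" by (meson subsetD)
    qed
  qed
  have rm: "reaches (Q_minus ?T d) (\<lambda>n. ?t (R n)) \<longleftrightarrow> reach (\<lambda>n. - R n)" for R
  proof
    show "reaches (Q_minus ?T d) (\<lambda>n. ?t (R n)) \<Longrightarrow> reach (\<lambda>n. - R n)"
      unfolding reaches_def reach_def Q(2) by (metis minus_minus)
    assume r: "reach (\<lambda>n. - R n)"
    show "reaches (Q_minus ?T d) (\<lambda>n. ?t (R n))" unfolding reaches_def Q(2)
    proof
      fix n
      obtain N where "\<forall>j\<ge>N. - R j \<in> quad (int (nat (- n)))" using r unfolding reach_def by blast
      moreover have "quad (int (nat (- n))) \<subseteq> quad (- n)" by (rule quad_mono) simp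
      ultimately show "\<exists>i. \<forall>j\<ge>i. - R j \<in> quad (- n)" by (meson subsetD)
    qed
  qed
  show ?thesis
  proof
    assume "winning_for_black ?T d x"
    then obtain t s where ts: "black_path ?T x t" "black_path ?T x s" "t 0 = s 0"
      "reaches (Q_plus ?T d) t" "reaches (Q_minus ?T d) s" unfolding winning_for_black_def by blast
    obtain R R' where R: "t = (\<lambda>n. ?t (R n))" "s = (\<lambda>n. ?t (R' n))" using path ts(1,2) by metis
    have "R 0 = R' 0" using ts(3) R cell_tile_inject[OF assms(1)] by simp
    moreover have "good {z. x (?t z)} (R 0)" using ts R bp rp unfolding good_def by blast
    moreover have "good {z. x (?t (- z))} (- R' 0)" unfolding good_def
      using ts(2,5) unfolding R bp rm by (intro exI[of _ "\<lambda>n. - R' n"]) (simp add: adj_minus)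
    ultimately show "\<exists>v. good {z. x (?t z)} v \<and> good {z. x (?t (- z))} (- v)" by metis
  next
    assume "\<exists>v. good {z. x (?t z)} v \<and> good {z. x (?t (- z))} (- v)"
    then obtain R R' where R: "\<forall>n. x (?t (R n)) \<and> adj (R n) (R (Suc n))" "reach R"
      "\<forall>n. x (?t (- R' n)) \<and> adj (R' n) (R' (Suc n))" "reach R'" "R' 0 = - R 0"
      unfolding good_def by auto
    have "black_path ?T x (\<lambda>n. ?t (R n))" "black_path ?T x (\<lambda>n. ?t (- R' n))"
      using R(1,3) unfolding bp by (simp_all add: adj_minus)
    moreover have "reaches (Q_plus ?T d) (\<lambda>n. ?t (R n))" "reaches (Q_minus ?T d) (\<lambda>n. ?t (- R' n))"
      using R(2,4) unfolding rp rm[of "\<lambda>n. - R' n"] by simp_all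
    ultimately show "winning_for_black ?T d x" unfolding winning_for_black_def using R(5)
      by (intro exI[of _ "\<lambda>n. ?t (R n)"] exI[of _ "\<lambda>n. ?t (- R' n)"]) simp
  qed
qed

section \<open>Complexity of the characterization\<close>

lemma pcode_inject: "pcode z = pcode z' \<longleftrightarrow> z = z'"
  by (metis pdec_pcode)

lemma pcode_eq_iff: "pcode z = n \<longleftrightarrow> z = pdec n"
  by auto

definition cfunctional :: "(cantor \<Rightarrow> nat \<Rightarrow> cell) \<Rightarrow> bool" where
  "cfunctional F \<longleftrightarrow> functional (\<lambda>x n. pcode (F x n))"

lemma functional_pcode [fun_intros]: "cfunctional F \<Longrightarrow> functional (\<lambda>x n. pcode (F x n))"
  by (simp add: cfunctional_def)

lemma cfunctional_pdec [fun_intros]: "functional F \<Longrightarrow> cfunctional (\<lambda>x n. pdec (F x n))"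
  by (simp add: cfunctional_def)

lemma cfunctional_Pair [fun_intros]:
  "ifunctional F \<Longrightarrow> ifunctional G \<Longrightarrow> cfunctional (\<lambda>x n. (F x n, G x n))"
  unfolding cfunctional_def pcode_def fst_conv snd_conv by (intro fun_intros)

lemma ifunctional_fst [fun_intros]: "cfunctional F \<Longrightarrow> ifunctional (\<lambda>x n. fst (F x n))"
  using ifunctional_decode[OF functional_pfst, of "\<lambda>x n. pcode (F x n)"]
  by (simp add: cfunctional_def pcode_def)

lemma ifunctional_snd [fun_intros]: "cfunctional F \<Longrightarrow> ifunctional (\<lambda>x n. snd (F x n))"
  using ifunctional_decode[OF functional_psnd, of "\<lambda>x n. pcode (F x n)"]
  by (simp add: cfunctional_def pcode_def)

lemma cfunctional_if [fun_intros]: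
  "odecidable P \<Longrightarrow> cfunctional F \<Longrightarrow> cfunctional G \<Longrightarrow> cfunctional (\<lambda>x n. if P x n then F x n else G x n)"
  unfolding cfunctional_def if_distrib[of pcode] by (intro functional_if)

lemma odecidable_cell_eq [fun_intros]:
  "cfunctional F \<Longrightarrow> cfunctional G \<Longrightarrow> odecidable (\<lambda>x n. F x n = G x n)"
  unfolding pcode_inject[symmetric] by (intro fun_intros)

lemma odecidable_dirs [fun_intros]: "cfunctional F \<Longrightarrow> odecidable (\<lambda>x n. F x n \<in> dirs)"
proof -
  assume "cfunctional F"
  then have "odecidable (\<lambda>x n. pcode (F x n) \<in> pcode ` dirs)"
    by (intro fun_intros) (simp add: dirs_def)
  moreover have "pcode z \<in> pcode ` dirs \<longleftrightarrow> z \<in> dirs" for z by (auto simp: pcode_inject)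
  ultimately show ?thesis by simp
qed

lemma odecidable_adj [fun_intros]:
  "cfunctional F \<Longrightarrow> cfunctional G \<Longrightarrow> odecidable (\<lambda>x n. adj (F x n) (G x n))"
  unfolding adj_def by (intro fun_intros)

lemma odecidable_quad [fun_intros]:
  "ifunctional K \<Longrightarrow> cfunctional F \<Longrightarrow> odecidable (\<lambda>x n. F x n \<in> quad (K x n))"
  unfolding quad_def mem_Collect_eq xco_def yco_def mult_2 by (intro fun_intros)

definition ecode :: "cell \<times> cell \<Rightarrow> nat" where
  "ecode e = prod_encode (pcode (fst e), pcode (snd e))"

definition edec :: "nat \<Rightarrow> cell \<times> cell" where
  "edec n = (pdec (pfst n), pdec (psnd n))"

lemma edec_ecode [simp]: "edec (ecode e) = e" and ecode_edec [simp]: "ecode (edec n) = n"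
  by (simp_all add: edec_def ecode_def)

lemma ex_edge_iff: "(\<exists>e. P e) \<longleftrightarrow> (\<exists>n. P (edec n))" and all_edge_iff: "(\<forall>e. P e) \<longleftrightarrow> (\<forall>n. P (edec n))"
  by (metis edec_ecode)+

lemma ex_cell_iff: "(\<exists>v. P v) \<longleftrightarrow> (\<exists>n. P (pdec n))"
  by (metis pdec_pcode)

definition efunctional :: "(cantor \<Rightarrow> nat \<Rightarrow> cell \<times> cell) \<Rightarrow> bool" where
  "efunctional E \<longleftrightarrow> functional (\<lambda>x n. ecode (E x n))"

lemma functional_ecode [fun_intros]: "efunctional E \<Longrightarrow> functional (\<lambda>x n. ecode (E x n))"
  by (simp add: efunctional_def)

lemma efunctional_edec [fun_intros]: "functional F \<Longrightarrow> efunctional (\<lambda>x n. edec (F x n))"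
  by (simp add: efunctional_def)

lemma efunctional_Pair [fun_intros]:
  "cfunctional F \<Longrightarrow> cfunctional G \<Longrightarrow> efunctional (\<lambda>x n. (F x n, G x n))"
  unfolding efunctional_def ecode_def fst_conv snd_conv by (intro fun_intros)

lemma cfunctional_fst [fun_intros]: "efunctional E \<Longrightarrow> cfunctional (\<lambda>x n. fst (E x n))"
  using functional_pfst[of "\<lambda>x n. ecode (E x n)"]
  by (simp add: cfunctional_def efunctional_def ecode_def)

lemma cfunctional_snd [fun_intros]: "efunctional E \<Longrightarrow> cfunctional (\<lambda>x n. snd (E x n))"
  using functional_psnd[of "\<lambda>x n. ecode (E x n)"]
  by (simp add: cfunctional_def efunctional_def ecode_def)

lemma odecidable_edge_eq [fun_intros]:
  "efunctional F \<Longrightarrow> efunctional G \<Longrightarrow> odecidable (\<lambda>x n. F x n = G x n)"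
  unfolding prod_eq_iff[where 'a = cell and 'b = cell] by (intro fun_intros)

lemma coarith_decidable: "odecidable (\<lambda>x m. P m x) \<Longrightarrow> coarith 0 P"
  unfolding coarith_def by (simp add: odecidable_not)

section \<open>Complexity of connections and interfaces\<close>

definition black :: "(nat \<Rightarrow> nat) \<Rightarrow> cantor \<Rightarrow> cell set" where
  "black ix x = {z. x (ix (pcode z))}"

text \<open>The number \<open>c\<close> is read as a stack of directions with
  \<open>pfst (c - 1)\<close> on top. An illegal direction leaves the cell in place, so every code
  describes a connection inside \<open>B\<close>, and connectedness becomes an existential
  search.\<close>

definition move :: "cell set \<Rightarrow> cell \<times> nat \<Rightarrow> cell \<times> nat" where
  "move B = (\<lambda>(z, c). let d = pdec (pfst (c - 1)); z' = (fst z + fst d, snd z + snd d)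
     in (if d \<in> dirs \<and> z \<in> B \<and> z' \<in> B then z' else z, psnd (c - 1)))"

lemma conn_iff_move: "conn B u v \<longleftrightarrow> (\<exists>c n. fst ((move B ^^ n) (u, c)) = v)"
proof
  assume "conn B u v"
  then show "\<exists>c n. fst ((move B ^^ n) (u, c)) = v" unfolding conn_def
  proof (induction rule: converse_rtranclp_induct)
    case base
    show ?case by (intro exI[of _ 0]) simp
  next
    case (step u y)
    then obtain c n where cn: "fst ((move B ^^ n) (y, c)) = v" by blast
    let ?d = "(fst y - fst u, snd y - snd u)"
    have "move B (u, Suc (prod_encode (pcode ?d, c))) = (y, c)"
      using step(1) by (simp add: move_def astep_def adj_def)
    then have "fst ((move B ^^ Suc n) (u, Suc (prod_encode (pcode ?d, c)))) = v"
      using cn by (simp only: funpow_Suc_right comp_apply)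
    then show ?case by blast
  qed
next
  have step: "conn B z (fst (move B (z, c)))" for z c
    by (auto simp: move_def Let_def adj_def intro: conn_step)
  have "conn B u (fst ((move B ^^ n) (u, c)))" for c n
  proof (induction n)
    case (Suc n)
    obtain z c' where "(move B ^^ n) (u, c) = (z, c')" by (cases "(move B ^^ n) (u, c)")
    with Suc show ?case using step[of z c'] conn_trans by auto
  qed simp
  then show "\<exists>c n. fst ((move B ^^ n) (u, c)) = v \<Longrightarrow> conn B u v" by blast
qed

context
  fixes ix :: "nat \<Rightarrow> nat"
  assumes ix: "computable ix"
begin

lemma odecidable_black: "cfunctional F \<Longrightarrow> odecidable (\<lambda>x n. F x n \<in> black ix x)"
  unfolding black_def mem_Collect_eq
  by (intro odecidable_oracle functional_comp1[OF ix] functional_pcode)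

lemma odecidable_lev:
  "functional K \<Longrightarrow> cfunctional F \<Longrightarrow> odecidable (\<lambda>x n. F x n \<in> lev (black ix x) (K x n))"
  unfolding lev_def Int_iff by (intro fun_intros odecidable_black)

lemma functional_move:
  "functional (\<lambda>x n. ((\<lambda>s. prod_encode (map_prod pcode id (move (black ix x) (pdec (pfst s), psnd s))))
      ^^ psnd n) (pfst n))"
proof -
  have "functional (\<lambda>x n. prod_encode (map_prod pcode id (move (black ix x) (pdec (pfst (psnd n)), psnd (psnd n)))))"
    unfolding move_def prod.case Let_def map_prod_simp id_apply
    by (intro fun_intros odecidable_black)
  from functional_funpow[OF this, of "\<lambda>x n. 0" "\<lambda>x n. pfst n" "\<lambda>x n. psnd n"]
  show ?thesis by (simp add: fun_intros)
qed

lemma move_code: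
  "((\<lambda>s. prod_encode (map_prod pcode id (move B (pdec (pfst s), psnd s)))) ^^ n) (prod_encode (pcode z, c))
    = prod_encode (map_prod pcode id ((move B ^^ n) (z, c)))"
  by (induction n) (auto simp: map_prod_def split: prod.splits)

lemma arith_conn:
  assumes "functional U" "functional V"
  shows "arith (Suc 0) (\<lambda>m x. conn (black ix x) (pdec (U x m)) (pdec (V x m)))"
proof -
  let ?J = "\<lambda>x n. ((\<lambda>s. prod_encode (map_prod pcode id (move (black ix x) (pdec (pfst s), psnd s))))
      ^^ psnd n) (pfst n)"
  have eq: "conn (black ix x) (pdec u) (pdec v) \<longleftrightarrow>
     (\<exists>c n. pfst (?J x (prod_encode (prod_encode (u, c), n))) = v)" for x u v
  proof -
    have J: "pfst (?J x (prod_encode (prod_encode (u, c), n))) = pcode (fst ((move (black ix x) ^^ n) (pdec u, c)))" for c n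
      using move_code[of n "black ix x" "pdec u" c] by (simp add: map_prod_def split_beta)
    show ?thesis unfolding conn_iff_move J pcode_eq_iff ..
  qed
  have "arith (Suc 0) (\<lambda>m x. \<exists>c n. pfst (?J x (prod_encode (prod_encode (U x m, c), n))) = V x m)"
  proof (rule arith_ex, rule arith_ex_coarith, rule coarith_decidable)
    have J: "functional F \<Longrightarrow> functional (\<lambda>x n. ?J x (F x n))" for F
      by (rule functional_compose[OF functional_move])
    show "odecidable (\<lambda>x m. pfst (?J x (prod_encode (prod_encode (U x (pfst (pfst m)), psnd (pfst m)), psnd m)))
        = V x (pfst (pfst m)))"
      by (intro fun_intros J functional_compose[OF assms(1)] functional_compose[OF assms(2)])
  qed
  then show ?thesis unfolding eq .
qed

lemma efunctional_turn:
  assumes "rot = cw \<or> rot = ccw" "functional K" "efunctional E"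
  shows "efunctional (\<lambda>x n. turn rot (lev (black ix x) (K x n)) (E x n))"
proof -
  have third: "cfunctional (\<lambda>x n. third rot (E x n))"
    using assms(1) unfolding third_def Let_def
    by (elim disjE; simp only: cw_def ccw_def fst_conv snd_conv) (intro fun_intros assms(3))+
  have "efunctional (\<lambda>x n. (if third rot (E x n) \<in> lev (black ix x) (K x n) then third rot (E x n) else fst (E x n),
      if third rot (E x n) \<in> lev (black ix x) (K x n) then snd (E x n) else third rot (E x n)))"
    by (intro fun_intros odecidable_lev third assms(2,3))
  moreover have "turn rot S e = (if third rot e \<in> S then third rot e else fst e,
      if third rot e \<in> S then snd e else third rot e)" for S e by (simp add: turn_def)
  ultimately show ?thesis by simp
qed

lemma efunctional_orbit:
  assumes "rot = cw \<or> rot = ccw" "functional K" "efunctional E" "functional N"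
  shows "efunctional (\<lambda>x n. orbit rot (lev (black ix x) (K x n)) (E x n) (N x n))"
proof -
  let ?H = "\<lambda>x n. ecode (turn rot (lev (black ix x) (pfst n)) (edec (psnd n)))"
  have "functional ?H"
    by (rule functional_ecode[OF efunctional_turn[OF assms(1)]]) (intro fun_intros)+
  from functional_funpow[OF this assms(2) functional_ecode[OF assms(3)] assms(4)]
  have "functional (\<lambda>x n. ((\<lambda>s. ecode (turn rot (lev (black ix x) (K x n)) (edec s))) ^^ N x n) (ecode (E x n)))"
    by simp
  moreover have "((\<lambda>s. ecode (turn rot S (edec s))) ^^ n) (ecode e) = ecode (orbit rot S e n)" for S e n
    by (induction n) (auto simp: orbit_Suc)
  ultimately show ?thesis unfolding efunctional_def by simp
qed

lemma cfunctional_trail: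
  "rot = cw \<or> rot = ccw \<Longrightarrow> functional K \<Longrightarrow> efunctional E \<Longrightarrow> functional N \<Longrightarrow>
   cfunctional (\<lambda>x n. trail rot (lev (black ix x) (K x n)) (E x n) (N x n))"
  unfolding trail_def by (intro cfunctional_fst efunctional_orbit)

lemma odecidable_edge:
  "functional K \<Longrightarrow> efunctional E \<Longrightarrow> odecidable (\<lambda>x n. edge (lev (black ix x) (K x n)) (E x n))"
  unfolding edge_def by (intro fun_intros odecidable_lev)

text \<open>Each turn queries the coloring at a single cell, so trails are computable from it and
  only the three quantifiers of \<open>reach\<close> count.\<close>

lemma coarith_reach:
  assumes rot: "rot = cw \<or> rot = ccw" and K: "functional K" and E: "functional E"
  shows "coarith (Suc (Suc (Suc 0))) (\<lambda>m x. reach (trail rot (lev (black ix x) (K x m)) (edec (E x m))))"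
  unfolding reach_def
  by (intro coarith_all_arith arith_ex_coarith coarith_all_arith arith_decidable
      fun_intros cfunctional_trail[OF rot] functional_compose[OF K] functional_compose[OF E])

lemma arith_Xrec:
  assumes rot: "rot = cw \<or> rot = ccw" and K: "functional K" and E: "functional E"
  shows "arith (Suc (Suc (Suc 0))) (\<lambda>m x. Xrec (trail rot (lev (black ix x) (K x m)) (edec (E x m))))"
  unfolding Xrec_def xco_def
  by (intro arith_ex_coarith coarith_all_arith arith_ex_coarith coarith_decidable
      fun_intros cfunctional_trail[OF rot] functional_compose[OF K] functional_compose[OF E])

lemma arith_Yrec:
  assumes rot: "rot = cw \<or> rot = ccw" and K: "functional K" and E: "functional E"
  shows "arith (Suc (Suc (Suc 0))) (\<lambda>m x. Yrec (trail rot (lev (black ix x) (K x m)) (edec (E x m))))"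
  unfolding Yrec_def yco_def mult_2
  by (intro arith_ex_coarith coarith_all_arith arith_ex_coarith coarith_decidable
      fun_intros cfunctional_trail[OF rot] functional_compose[OF K] functional_compose[OF E])

lemma coarith_aperiodic:
  assumes K: "functional K" and E: "functional E"
  shows "coarith (Suc 0) (\<lambda>m x. aperiodic (lev (black ix x) (K x m)) (edec (E x m)))"
  unfolding aperiodic_def
  by (intro coarith_all_arith arith_decidable fun_intros efunctional_orbit
      functional_compose[OF K] functional_compose[OF E]) simp

lemma arith_edge:
  assumes K: "functional K" and E: "functional E"
  shows "arith k (\<lambda>m x. edge (lev (black ix x) (K x m)) (edec (E x m)))"
proof (rule arith_mono)
  show "arith 0 (\<lambda>m x. edge (lev (black ix x) (K x m)) (edec (E x m)))"
    by (intro arith_decidable odecidable_edge K efunctional_edec E)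
qed simp

lemma cw_ccw: "cw = cw \<or> cw = ccw" "ccw = cw \<or> ccw = ccw" by simp_all

lemma arith_by_interface:
  assumes "functional V"
  shows "arith (Suc (Suc (Suc (Suc 0)))) (\<lambda>m x. by_interface (black ix x) (pdec (V x m)))"
proof -
  \<comment> \<open>Wrapping the end of the connection as \<open>pdec (pcode _)\<close> brings it
    into the form of \<open>arith_conn\<close>.\<close>
  have "arith (Suc (Suc (Suc (Suc 0)))) (\<lambda>m x. \<exists>k n. edge (lev (black ix x) k) (edec n) \<and>
     conn (black ix x) (pdec (V x m)) (pdec (pcode (fst (edec n)))) \<and>
     (reach (trail cw (lev (black ix x) k) (edec n)) \<or> reach (trail ccw (lev (black ix x) k) (edec n))))"
    by (intro arith_ex arith_conj arith_disj arith_edge arith_mono[OF arith_conn]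
        arith_of_coarith_less[OF coarith_reach] cw_ccw fun_intros functional_compose[OF assms]) simp_all
  then show ?thesis unfolding by_interface_def pdec_pcode ex_edge_iff .
qed

lemma arith_straddling:
  assumes "functional V" "functional K"
  shows "arith (Suc (Suc (Suc 0))) (\<lambda>m x. straddling (black ix x) (K x m) (pdec (V x m)))"
proof -
  have "arith (Suc (Suc (Suc 0))) (\<lambda>m x. \<exists>n. edge (lev (black ix x) (K x m)) (edec n) \<and>
     conn (black ix x) (pdec (V x m)) (pdec (pcode (fst (edec n)))) \<and> aperiodic (lev (black ix x) (K x m)) (edec n) \<and>
     Xrec (trail cw (lev (black ix x) (K x m)) (edec n)) \<and> Yrec (trail ccw (lev (black ix x) (K x m)) (edec n)))"
    by (intro arith_ex arith_conj arith_edge arith_mono[OF arith_conn] arith_Xrec arith_Yrec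
        arith_of_coarith_less[OF coarith_aperiodic] cw_ccw fun_intros
        functional_compose[OF assms(1)] functional_compose[OF assms(2)]) simp_all
  then show ?thesis unfolding straddling_def pdec_pcode ex_edge_iff .
qed

lemma coarith_tame: "coarith (Suc (Suc (Suc 0))) (\<lambda>m x. tame (black ix x))"
  unfolding tame_def all_edge_iff
  by (intro coarith_all coarith_imp coarith_conj coarith_not arith_conj arith_edge arith_Xrec arith_Yrec
      arith_of_coarith_less[OF coarith_aperiodic] cw_ccw fun_intros) simp

lemma arith_anchored: "arith (Suc (Suc (Suc (Suc 0)))) (\<lambda>m x. anchored (black ix x))"
  unfolding anchored_def
  by (intro arith_ex_coarith coarith_all coarith_imp arith_straddling
      coarith_of_arith_less[OF arith_ex[OF arith_conj[OF arith_mono[OF arith_decidable] arith_conn]]]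
      fun_intros) simp_all

lemma arith_good_approx:
  assumes "functional V" "functional K"
  shows "arith (Suc (Suc (Suc (Suc 0)))) (\<lambda>m x. good_approx (K x m) (black ix x) (pdec (V x m)))"
  unfolding good_approx_def
  by (intro arith_disj arith_conj arith_by_interface arith_anchored assms
      arith_of_coarith[OF coarith_tame] arith_Suc[OF arith_straddling])

lemma arith_good:
  assumes "functional V"
  shows "arith (Suc (Suc (Suc (Suc (Suc 0))))) (\<lambda>m x. good (black ix x) (pdec (V x m)))"
  unfolding good_iff
  by (intro arith_disj arith_conj arith_Suc[OF arith_by_interface] arith_of_coarith[OF coarith_all_arith]
      arith_of_coarith_less[OF coarith_tame] arith_straddling assms fun_intros functional_compose[OF assms]) simp_all

end

definition pneg :: "nat \<Rightarrow> nat" where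
  "pneg n = pcode (- pdec n)"

lemma pdec_pneg: "pdec (pneg n) = - pdec n"
  by (simp add: pneg_def)

lemma computable_pneg: "computable pneg"
proof -
  have "pneg = (\<lambda>n. prod_encode (int_encode (- int_decode (pfst n)), int_encode (- int_decode (psnd n))))"
    by (rule ext) (simp add: pneg_def pcode_def pdec_def)
  moreover have "computable \<dots>" by (intro comp_intros)
  ultimately show ?thesis by simp
qed

lemma black_pneg: "black (\<lambda>n. ix (pneg n)) x = {z. - z \<in> black ix x}"
  by (simp add: black_def pneg_def)

text \<open>The defining form has an existential quantifier in front of Sigma-5 predicates; the form
  given by \<open>both_good_iff\<close> has a universal one in front of a Sigma-4 predicate.\<close>

lemma both_good_Delta:
  assumes "computable ix"
  shows "lightface_Delta (Suc (Suc (Suc (Suc (Suc 0)))))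
    {x. \<exists>v. good (black ix x) v \<and> good {z. - z \<in> black ix x} (- v)}"
proof (rule lightface_Delta_arith)
  let ?ix = "\<lambda>n. ix (pneg n)"
  have ix': "computable ?ix" by (rule computable_comp[OF assms computable_pneg])
  have neg: "functional F \<Longrightarrow> functional (\<lambda>x n. pneg (F x n))" for F
    by (rule functional_comp1[OF computable_pneg])
  have "arith (Suc (Suc (Suc (Suc (Suc 0))))) (\<lambda>m x. \<exists>v. good (black ix x) (pdec v) \<and> good (black ?ix x) (pdec (pneg v)))"
    by (intro arith_ex arith_conj arith_good[OF assms] arith_good[OF ix'] neg fun_intros)
  then show "arith (Suc (Suc (Suc (Suc (Suc 0))))) (\<lambda>_ x. \<exists>v. good (black ix x) v \<and> good {z. - z \<in> black ix x} (- v))"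
    unfolding pdec_pneg black_pneg ex_cell_iff[of "\<lambda>v. good _ v \<and> good _ (- v)"] .
  have "coarith (Suc (Suc (Suc (Suc (Suc 0))))) (\<lambda>m x. \<forall>k. \<exists>v. good_approx k (black ix x) (pdec v) \<and>
      good_approx k (black ?ix x) (pdec (pneg v)))"
    by (intro coarith_all_arith arith_ex arith_conj arith_good_approx[OF assms] arith_good_approx[OF ix'] neg fun_intros)
  then show "coarith (Suc (Suc (Suc (Suc (Suc 0))))) (\<lambda>_ x. \<exists>v. good (black ix x) v \<and> good {z. - z \<in> black ix x} (- v))"
    unfolding both_good_iff pdec_pneg black_pneg ex_cell_iff[of "\<lambda>v. good_approx _ _ v \<and> good_approx _ _ (- v)"] .
qed

text \<open>The number of a tile is found by unbounded search through the enumeration, comparing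
  lattice coordinates; the search ends because \<open>e\<close> is onto.\<close>

lemma computable_tile_index:
  assumes "a > 0" "computable_enumeration a p e"
  obtains ix where "computable ix" "\<And>n. e (ix n) = cell_tile a p i0 j0 (pdec n)"
proof -
  obtain I J where bij: "bij_betw e UNIV (hex_tiling a p)"
    and IJ: "computable (\<lambda>n. int_encode (I n))" "computable (\<lambda>n. int_encode (J n))"
    and e: "\<And>n. e n = hexagon a (hex_centre a p (I n) (J n))"
    using assms(2) unfolding computable_enumeration_def by blast
  define f where "f q = (of_bool (\<not> (I (psnd q) = i0 - snd (pdec (pfst q)) \<and>
     J (psnd q) = j0 + fst (pdec (pfst q)) + snd (pdec (pfst q)))) :: nat)" for q
  have f: "f (prod_encode (n, k)) = 0 \<longleftrightarrow> e k = cell_tile a p i0 j0 (pdec n)" for n k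
    using assms(1) by (auto simp: f_def e cell_tile_def hexagon_inject hex_centre_inject)
  have "icomputable (\<lambda>q. I (psnd q))" "icomputable (\<lambda>q. J (psnd q))"
    unfolding icomputable_def by (intro computable_comp[OF IJ(1)] computable_comp[OF IJ(2)] comp_intros)+
  then have "decidable (\<lambda>q. \<not> (I (psnd q) = i0 - snd (pdec (pfst q)) \<and>
     J (psnd q) = j0 + fst (pdec (pfst q)) + snd (pdec (pfst q))))"
    unfolding pdec_def fst_conv snd_conv by (intro comp_intros)
  then have "computable f" unfolding decidable_def f_def .
  moreover have ex: "\<exists>k. f (prod_encode (n, k)) = 0" for n
  proof -
    have "cell_tile a p i0 j0 (pdec n) \<in> range e"
      using bij range_cell_tile[of a p i0 j0] by (auto simp: bij_betw_def)
    then show ?thesis unfolding f by (metis rangeE)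
  qed
  ultimately have "computable (\<lambda>n. LEAST k. f (prod_encode (n, k)) = 0)" by (rule computable_Least)
  moreover have "e (LEAST k. f (prod_encode (n, k)) = 0) = cell_tile a p i0 j0 (pdec n)" for n
    using LeastI_ex[OF ex[of n]] unfolding f .
  ultimately show thesis by (rule that)
qed

theorem theorem1:
  fixes a :: real and p :: point and d :: "int \<Rightarrow> tile" and e :: "nat \<Rightarrow> tile"
  assumes "a > 0"
    and "diagonal (hex_tiling a p) d"
    and "computable_enumeration a p e"
  defines "W \<equiv> (\<lambda>x. x \<circ> e) ` winning_set (hex_tiling a p) d"
  shows "lightface_Delta 5 W \<and> boldface_Delta 5 W"
proof -
  obtain i0 j0 where d: "\<And>n. d n = hexagon a (hex_centre a p (i0 + n) j0)"
    using diagonal_hexagon[OF assms(1,2)] by blast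
  obtain ix where ix: "computable ix" "\<And>n. e (ix n) = cell_tile a p i0 j0 (pdec n)"
    using computable_tile_index[OF assms(1,3)] by metis
  have bij: "bij_betw e UNIV (hex_tiling a p)" using assms(3) by (simp add: computable_enumeration_def)
  have win: "winning_for_black (hex_tiling a p) d x \<longleftrightarrow>
      (\<exists>v. good (black ix y) v \<and> good {z. - z \<in> black ix y} (- v))" if "y = x \<circ> e" for x y
    unfolding winning_iff_good[OF assms(1) d] using ix(2) that by (simp add: black_def)
  have "W = {y. \<exists>v. good (black ix y) v \<and> good {z. - z \<in> black ix y} (- v)}"
  proof (intro equalityI subsetI)
    fix y assume "y \<in> W"
    then obtain x where "y = x \<circ> e" "winning_for_black (hex_tiling a p) d x"
      unfolding W_def winning_set_def by blast
    then show "y \<in> {y. \<exists>v. good (black ix y) v \<and> good {z. - z \<in> black ix y} (- v)}" using win by simp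
  next
    fix y assume y: "y \<in> {y. \<exists>v. good (black ix y) v \<and> good {z. - z \<in> black ix y} (- v)}"
    \<comment> \<open>The point of Cantor space is carried back along the inverse of
      \<open>e\<close> and restricted, since colorings are extensional on the tiling.\<close>
    define x where "x = restrict (y \<circ> the_inv_into UNIV e) (hex_tiling a p)"
    have e: "inj e" "e n \<in> hex_tiling a p" for n using bij by (auto simp: bij_betw_def)
    then have "x (e n) = y n" for n by (simp add: x_def the_inv_into_f_f)
    then have yx: "y = x \<circ> e" by (simp add: fun_eq_iff)
    have "x \<in> winning_set (hex_tiling a p) d"
      unfolding winning_set_def using win[OF yx] y by (simp add: x_def)
    then show "y \<in> W" unfolding W_def using yx by blast
  qed
  then have "lightface_Delta 5 W" using both_good_Delta[OF ix(1)] by (simp add: eval_nat_numeral)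
  then show ?thesis using boldface_Delta_of_lightface by blast
qed

end
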